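(* Let $(M,g)$ be a smooth Riemannian manifold. Then any connected, compact, conic singular sub-manifold $W$ of $M$ is Lipschitz normally embedded (LNE) in $(M,g)$.
   Context: Smooth means $C^\infty$. **LNE.** Let $(M,g)$ be a smooth Riemannian manifold and let $d_M$ be the distance on $M$ given by the infimum of lengths of rectifiable curves connecting two points. For $S\subset M$, the outer distance $d_S$ is the restriction of $d_M$ to $S\times S$. The inner distance $d^S_{\rm in}(x,x')\in[0,+\infty]$ is the infimum of the lengths of rectifiable paths lying in $S$ joining $x$ and $x'$. The set $S$ is Lipschitz normally embedded (LNE) if there is a constant $L>0$ with $d^S_{\rm in}(x,x')\le L\, d_S(x,x')$ for all $x,x'\in S$. **Sub-manifolds.** Sub-manifolds are embedded (manifold topology equal to the induced topology, inclusion a smooth injective immersion); different connected components may have different dimensions. Unless a boundary is mentioned, sub-manifolds have no boundary. A subset $N$ of a smooth manifold with boundary $(P,\partial P)$ is a p-sub-manifold of $P$ if it is a smooth sub-manifold with (possibly empty) boundary $\partial N$, with $\partial N=N\cap\partial P$, and $T_xN+T_x\partial P=T_xP$ for every $x\in\partial N$. **Conic points.** For $a\in\mathbb R^n$, let $[\mathbb R^n,a]=[0,\infty)\times\mathbb S^{n-1}$, a manifold with boundary $0\times\mathbb S^{n-1}$, and let $\mathrm{bl}_a:[\mathbb R^n,a]\to\mathbb R^n$, $(r,u)\mapsto ru+a$. The strict transform of $S\subset \mathbb R^n$ is $[S,a]=\mathrm{clos}(\mathrm{bl}_a^{-1}(S\setminus a))$, the closure being taken in $[\mathbb R^n,a]$.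 Let $X\subset\mathbb R^n$ have non-empty and closed germ at $a$. The point $a$ is a conic point of $X$ (or $X$ is conic at $a$) if there is $r>0$ such that the strict transform of $X\cap\{|x-a|<r\}$, taken inside $[0,r)\times\mathbb S^{n-1}$, is a closed subset and a p-sub-manifold of $[0,r)\times\mathbb S^{n-1}$. A subset $Z$ of a smooth $n$-manifold $M$ is conic at $z\in Z$ if there is a smooth chart $\psi:\mathcal U\to B^n_1$ of $M$ centred at $z$, onto the open unit ball of $\mathbb R^n$, such that $\psi(Z\cap\mathcal U)$ is conic at $\psi(z)$ (this does not depend on the chart). **Conic singular sub-manifolds of a manifold.** A point of a subset $S$ of a smooth manifold is singular if the germ of $S$ at this point is not the germ of a smooth sub-manifold; $S_{\rm sing}$ is the set of singular points of $S$. A subset $W$ of a smooth manifold $M$ is a conic singular sub-manifold if (i) it is a closed subset of $M$; (ii) each point of $W$ is conic; (iii) $W_{\rm sing}$ is finite or empty. *)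

theory Defs
  imports "HOL-Analysis.Analysis"
begin

section \<open>Smooth maps between Euclidean spaces\<close>

text \<open>Only meant for open \<open>S\<close>. In finite dimension, continuity of all iterated directional
  derivatives (together with differentiability at each stage) is the usual \<open>C\<^sup>k\<close> condition.\<close>

primrec Ck_on :: "nat \<Rightarrow> 'a::real_normed_vector set \<Rightarrow> ('a \<Rightarrow> 'b::real_normed_vector) \<Rightarrow> bool" where
  "Ck_on 0 S f \<longleftrightarrow> continuous_on S f"
| "Ck_on (Suc k) S f \<longleftrightarrow>
     (\<forall>x\<in>S. f differentiable (at x)) \<and> (\<forall>v. Ck_on k S (\<lambda>x. frechet_derivative f (at x) v))"

definition smooth_on :: "'a::real_normed_vector set \<Rightarrow> ('a \<Rightarrow> 'b::real_normed_vector) \<Rightarrow> bool" where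
  "smooth_on S f \<longleftrightarrow> (\<forall>k. Ck_on k S f)"


section \<open>Smooth manifolds\<close>

text \<open>The manifold is the whole type \<open>'m\<close>, a Hausdorff second countable space; its smooth structure
  is given by an atlas \<open>A\<close> of pairs \<open>(U, \<phi>)\<close> with values in the model space \<open>'b\<close>, whose dimension
  \<open>n = DIM('b) \<ge> 1\<close> is the dimension of the manifold.\<close>

type_synonym ('m, 'b) chart = "'m set \<times> ('m \<Rightarrow> 'b)"

definition is_chart :: "('m::topological_space, 'b::euclidean_space) chart \<Rightarrow> bool" where
  "is_chart c \<longleftrightarrow> (case c of (U, \<phi>) \<Rightarrow>
     open U \<and> open (\<phi> ` U) \<and> homeomorphism U (\<phi> ` U) \<phi> (inv_into U \<phi>))"

definition transition :: "('m, 'b) chart \<Rightarrow> ('m, 'b) chart \<Rightarrow> 'b \<Rightarrow> 'b" where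
  "transition c d = snd d \<circ> inv_into (fst c) (snd c)"

definition smooth_compatible ::
    "('m::topological_space, 'b::euclidean_space) chart \<Rightarrow> ('m, 'b) chart \<Rightarrow> bool" where
  "smooth_compatible c d \<longleftrightarrow>
     smooth_on (snd c ` (fst c \<inter> fst d)) (transition c d) \<and>
     smooth_on (snd d ` (fst c \<inter> fst d)) (transition d c)"

definition smooth_atlas :: "('m::topological_space, 'b::euclidean_space) chart set \<Rightarrow> bool" where
  "smooth_atlas A \<longleftrightarrow>
     (\<forall>c\<in>A. is_chart c) \<and> \<Union> (fst ` A) = UNIV \<and> (\<forall>c\<in>A. \<forall>d\<in>A. smooth_compatible c d)"

text \<open>The maximal atlas.\<close>

definition smooth_charts ::
    "('m::topological_space, 'b::euclidean_space) chart set \<Rightarrow> ('m, 'b) chart set" where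
  "smooth_charts A = {c. is_chart c \<and> (\<forall>d\<in>A. smooth_compatible c d)}"


section \<open>Riemannian metrics, lengths and distances\<close>

text \<open>A metric is given by its local expressions: \<open>g c x\<close> is the inner product on \<open>T\<^sub>xM\<close> read in
  the chart \<open>c\<close>. The last clause is the transformation law of a covariant 2-tensor.\<close>

definition riemannian_metric ::
    "('m::topological_space, 'b::euclidean_space) chart set
      \<Rightarrow> (('m, 'b) chart \<Rightarrow> 'm \<Rightarrow> 'b \<Rightarrow> 'b \<Rightarrow> real) \<Rightarrow> bool" where
  "riemannian_metric A g \<longleftrightarrow>
     (\<forall>c\<in>A. \<forall>x\<in>fst c. bilinear (g c x) \<and> (\<forall>v w. g c x v w = g c x w v)
        \<and> (\<forall>v. v \<noteq> 0 \<longrightarrow> g c x v v > 0)) \<and>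
     (\<forall>c\<in>A. \<forall>v w. smooth_on (snd c ` fst c) (\<lambda>y. g c (inv_into (fst c) (snd c) y) v w)) \<and>
     (\<forall>c\<in>A. \<forall>d\<in>A. \<forall>x\<in>fst c \<inter> fst d. \<forall>v w.
        g c x v w = g d x (frechet_derivative (transition c d) (at (snd c x)) v)
                          (frechet_derivative (transition c d) (at (snd c x)) w))"

text \<open>By the transformation law, the speed does not depend on the chosen chart.\<close>

definition speed ::
    "('m::topological_space, 'b::euclidean_space) chart set
      \<Rightarrow> (('m, 'b) chart \<Rightarrow> 'm \<Rightarrow> 'b \<Rightarrow> 'b \<Rightarrow> real) \<Rightarrow> (real \<Rightarrow> 'm) \<Rightarrow> real \<Rightarrow> real" where
  "speed A g \<gamma> t =
     (let c = (SOME c. c \<in> A \<and> \<gamma> t \<in> fst c); v = vector_derivative (snd c \<circ> \<gamma>) (at t)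
      in sqrt (g c (\<gamma> t) v v))"

definition piecewise_C1_path ::
    "('m::topological_space, 'b::euclidean_space) chart set \<Rightarrow> (real \<Rightarrow> 'm) \<Rightarrow> bool" where
  "piecewise_C1_path A \<gamma> \<longleftrightarrow> path \<gamma> \<and>
     (\<exists>F. finite F \<and>
       (\<forall>c\<in>A. (snd c \<circ> \<gamma>) C1_differentiable_on (({0<..<1} - F) \<inter> \<gamma> -` fst c)))"

text \<open>The classical Riemannian distance; it only serves to define the length of arbitrary
  continuous paths. It is infinite between different connected components.\<close>

definition C1_dist ::
    "('m::topological_space, 'b::euclidean_space) chart set
      \<Rightarrow> (('m, 'b) chart \<Rightarrow> 'm \<Rightarrow> 'b \<Rightarrow> 'b \<Rightarrow> real) \<Rightarrow> 'm \<Rightarrow> 'm \<Rightarrow> ennreal" where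
  "C1_dist A g x y =
     (INF \<gamma>\<in>{\<gamma>. piecewise_C1_path A \<gamma> \<and> pathstart \<gamma> = x \<and> pathfinish \<gamma> = y}.
        \<integral>\<^sup>+t\<in>{0..1}. ennreal (speed A g \<gamma> t) \<partial>lborel)"

definition path_length ::
    "('m::topological_space, 'b::euclidean_space) chart set
      \<Rightarrow> (('m, 'b) chart \<Rightarrow> 'm \<Rightarrow> 'b \<Rightarrow> 'b \<Rightarrow> real) \<Rightarrow> (real \<Rightarrow> 'm) \<Rightarrow> ennreal" where
  "path_length A g \<gamma> =
     (SUP (k, t)\<in>{(k::nat, t::nat \<Rightarrow> real). mono t \<and> range t \<subseteq> {0..1}}.
        \<Sum>i<k. C1_dist A g (\<gamma> (t i)) (\<gamma> (t (Suc i))))"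

definition rectifiable ::
    "('m::topological_space, 'b::euclidean_space) chart set
      \<Rightarrow> (('m, 'b) chart \<Rightarrow> 'm \<Rightarrow> 'b \<Rightarrow> 'b \<Rightarrow> real) \<Rightarrow> (real \<Rightarrow> 'm) \<Rightarrow> bool" where
  "rectifiable A g \<gamma> \<longleftrightarrow> path \<gamma> \<and> path_length A g \<gamma> < \<infinity>"

definition inner_dist ::
    "('m::topological_space, 'b::euclidean_space) chart set
      \<Rightarrow> (('m, 'b) chart \<Rightarrow> 'm \<Rightarrow> 'b \<Rightarrow> 'b \<Rightarrow> real) \<Rightarrow> 'm set \<Rightarrow> 'm \<Rightarrow> 'm \<Rightarrow> ennreal" where
  "inner_dist A g S x y =
     (INF \<gamma>\<in>{\<gamma>. rectifiable A g \<gamma> \<and> path_image \<gamma> \<subseteq> S \<and> pathstart \<gamma> = x \<and> pathfinish \<gamma> = y}.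
        path_length A g \<gamma>)"

definition riemannian_dist ::
    "('m::topological_space, 'b::euclidean_space) chart set
      \<Rightarrow> (('m, 'b) chart \<Rightarrow> 'm \<Rightarrow> 'b \<Rightarrow> 'b \<Rightarrow> real) \<Rightarrow> 'm \<Rightarrow> 'm \<Rightarrow> ennreal" where
  "riemannian_dist A g = inner_dist A g UNIV"

definition lipschitz_normally_embedded ::
    "('m::topological_space, 'b::euclidean_space) chart set
      \<Rightarrow> (('m, 'b) chart \<Rightarrow> 'm \<Rightarrow> 'b \<Rightarrow> 'b \<Rightarrow> real) \<Rightarrow> 'm set \<Rightarrow> bool" where
  "lipschitz_normally_embedded A g S \<longleftrightarrow>
     (\<exists>L::real. L > 0 \<and>
        (\<forall>x\<in>S. \<forall>x'\<in>S. inner_dist A g S x x' \<le> ennreal L * riemannian_dist A g x x'))"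


section \<open>Sub-manifolds of Euclidean space\<close>

text \<open>The model spaces of all dimensions are taken inside the ambient space: a linear subspace
  (case \<open>e = 0\<close>) or a closed half-space of a linear subspace (case \<open>e \<noteq> 0\<close>).\<close>

definition half_space :: "'a::euclidean_space set \<Rightarrow> 'a \<Rightarrow> 'a set" where
  "half_space F e = {y \<in> F. 0 \<le> y \<bullet> e}"

text \<open>\<open>h\<close> restricted to \<open>Q \<inter> half_space F e\<close> is an inverse chart of \<open>N\<close> for the induced topology,
  with \<open>h y = x\<close>, which is a smooth immersion into the ambient space (smoothness up to the boundary
  being expressed by the extension of \<open>h\<close> to the open set \<open>Q\<close> of the ambient space).\<close>

definition local_param ::
    "'a::euclidean_space set \<Rightarrow> 'a \<Rightarrow> 'a set \<Rightarrow> 'a \<Rightarrow> 'a set \<Rightarrow> ('a \<Rightarrow> 'a) \<Rightarrow> 'a \<Rightarrow> bool" where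
  "local_param N x F e Q h y \<longleftrightarrow>
     subspace F \<and> e \<in> F \<and> open Q \<and> y \<in> Q \<inter> half_space F e \<and> h y = x \<and>
     smooth_on Q h \<and>
     openin (top_of_set N) (h ` (Q \<inter> half_space F e)) \<and>
     homeomorphism (Q \<inter> half_space F e) (h ` (Q \<inter> half_space F e)) h
       (inv_into (Q \<inter> half_space F e) h) \<and>
     (\<forall>z \<in> Q \<inter> half_space F e. inj_on (frechet_derivative h (at z)) F)"

definition submanifold_with_boundary :: "'a::euclidean_space set \<Rightarrow> bool" where
  "submanifold_with_boundary N \<longleftrightarrow> (\<forall>x\<in>N. \<exists>F e Q h y. local_param N x F e Q h y)"

definition manifold_boundary :: "'a::euclidean_space set \<Rightarrow> 'a set" where
  "manifold_boundary N = {x\<in>N. \<exists>F e Q h y. local_param N x F e Q h y \<and> e \<noteq> 0 \<and> y \<bullet> e = 0}"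

text \<open>The tangent space (also at boundary points, where it is still a full linear space); it does
  not depend on the parametrisation.\<close>

definition tangent_space :: "'a::euclidean_space set \<Rightarrow> 'a \<Rightarrow> 'a set" where
  "tangent_space N x =
     {v. \<exists>F e Q h y. local_param N x F e Q h y \<and> v \<in> frechet_derivative h (at y) ` F}"

definition euclidean_submanifold :: "'a::euclidean_space set \<Rightarrow> bool" where
  "euclidean_submanifold N \<longleftrightarrow> submanifold_with_boundary N \<and> manifold_boundary N = {}"

text \<open>Here \<open>P\<close> is a sub-manifold with boundary \<open>dP\<close> of a Euclidean space, so that sub-manifolds of
  \<open>P\<close> are those of the Euclidean space that are contained in \<open>P\<close>.\<close>

definition p_submanifold :: "'a::euclidean_space set \<Rightarrow> 'a set \<Rightarrow> 'a set \<Rightarrow> bool" where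
  "p_submanifold P dP N \<longleftrightarrow>
     N \<subseteq> P \<and> submanifold_with_boundary N \<and> manifold_boundary N = N \<inter> dP \<and>
     (\<forall>x \<in> manifold_boundary N.
        {u + v | u v. u \<in> tangent_space N x \<and> v \<in> tangent_space dP x} = tangent_space P x)"


section \<open>Conic points\<close>

definition blowup_space :: "(real \<times> 'b::euclidean_space) set" where
  "blowup_space = {0..} \<times> sphere 0 1"

definition blowup_map :: "'b::euclidean_space \<Rightarrow> real \<times> 'b \<Rightarrow> 'b" where
  "blowup_map a = (\<lambda>(r, u). r *\<^sub>R u + a)"

definition strict_transform :: "'b::euclidean_space \<Rightarrow> 'b set \<Rightarrow> (real \<times> 'b) set" where
  "strict_transform a S =
     top_of_set blowup_space closure_of {p \<in> blowup_space. blowup_map a p \<in> S - {a}}"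

text \<open>The first two conditions say that the germ of \<open>X\<close> at \<open>a\<close> is non-empty and closed.\<close>

definition conic_point :: "'b::euclidean_space set \<Rightarrow> 'b \<Rightarrow> bool" where
  "conic_point X a \<longleftrightarrow>
     a \<in> closure X \<and>
     (\<exists>\<rho>>0. closedin (top_of_set (ball a \<rho>)) (X \<inter> ball a \<rho>)) \<and>
     (\<exists>r>0. let P = {0..<r} \<times> sphere 0 1; dP = {0} \<times> sphere 0 1;
                N = strict_transform a (X \<inter> ball a r) \<inter> P
            in closedin (top_of_set P) N \<and> p_submanifold P dP N)"

definition conic_at ::
    "('m::topological_space, 'b::euclidean_space) chart set \<Rightarrow> 'm set \<Rightarrow> 'm \<Rightarrow> bool" where
  "conic_at A Z z \<longleftrightarrow>
     (\<exists>(U, \<psi>) \<in> smooth_charts A. z \<in> U \<and> \<psi> z = 0 \<and> \<psi> ` U = ball 0 1 \<and>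
        conic_point (\<psi> ` (Z \<inter> U)) (\<psi> z))"


section \<open>Conic singular sub-manifolds\<close>

definition smooth_submanifold ::
    "('m::topological_space, 'b::euclidean_space) chart set \<Rightarrow> 'm set \<Rightarrow> bool" where
  "smooth_submanifold A N \<longleftrightarrow>
     (\<forall>x\<in>N. \<exists>(U, \<phi>) \<in> smooth_charts A. x \<in> U \<and> euclidean_submanifold (\<phi> ` (N \<inter> U)))"

definition singular_points ::
    "('m::topological_space, 'b::euclidean_space) chart set \<Rightarrow> 'm set \<Rightarrow> 'm set" where
  "singular_points A S =
     {x\<in>S. \<not> (\<exists>N U. smooth_submanifold A N \<and> open U \<and> x \<in> U \<and> S \<inter> U = N \<inter> U)}"

definition conic_singular_submanifold ::
    "('m::topological_space, 'b::euclidean_space) chart set \<Rightarrow> 'm set \<Rightarrow> bool" where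
  "conic_singular_submanifold A W \<longleftrightarrow>
     closed W \<and> (\<forall>z\<in>W. conic_at A W z) \<and> finite (singular_points A W)"

end

theory Submission
  imports Defs
begin

text \<open>
  Lipschitz normal embedding is a local property for a compact connected set \<open>W\<close>: if every point of
  \<open>W\<close> has a neighbourhood in which the inner distance is bounded by a multiple of the outer one, then
  connectedness makes the inner distance finite, and near a pair of distinct points it is bounded, while
  the outer distance is bounded below. So every pair in \<open>W \<times> W\<close> has a neighbourhood with a Lipschitz
  constant, and finitely many of these neighbourhoods cover \<open>W \<times> W\<close>. It remains to study \<open>W\<close> near one
  point, and every point of \<open>W\<close> is conic.

  In a small chart the distance of \<open>M\<close> is comparable to the Euclidean distance
  (\<open>C1_dist_chart_comparison\<close>), so the local statement is one about a subset \<open>X\<close> of \<open>\<real>\<^sup>n\<close> with conic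
  point \<open>a\<close> (\<open>conic_point_locally_joined\<close>): two points \<open>x, x'\<close> of \<open>X\<close> near \<open>a\<close> are
  joined in \<open>X\<close> by a path with Lipschitz constant \<open>C \<bar>x - x'\<bar>\<close>. Write \<open>x = a + \<rho> u\<close>
  and \<open>x' = a + \<rho>' u'\<close> with unit vectors \<open>u, u'\<close>. Then \<open>\<bar>x - x'\<bar>\<close> is comparable to
  \<open>\<bar>\<rho> - \<rho>'\<bar> + max \<rho> \<rho>' \<bar>u - u'\<bar>\<close>. If \<open>u\<close> and \<open>u'\<close> are apart, this dominates
  \<open>\<rho> + \<rho>'\<close>, and one goes through the cone point. If they are close, both points lie in one boundary
  chart \<open>h\<close> of the strict transform, and the image of a straight segment of the half-space is the
  desired path.

  The last claim is the core of the proof (\<open>cone_chart_estimates\<close>). The strict transform meets the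
  boundary \<open>\<rho> = 0\<close> of the cylinder transversally, so on the half-space \<open>z \<bullet> e \<ge> 0\<close> the radius
  \<open>\<rho> \<circ> h\<close> is comparable to \<open>z \<bullet> e\<close>, and, by second order smoothness, its tangential derivatives
  are \<open>O(z \<bullet> e)\<close>. Therefore the distance between the images of \<open>z\<close> and \<open>z'\<close> in the cone is comparable
  to \<open>\<bar>(z - z') \<bullet> e\<bar> + max (z \<bullet> e) (z' \<bullet> e) \<bar>z - z'\<bar>\<close>, a quantity that
  shrinks at least linearly when \<open>z\<close> and \<open>z'\<close> are replaced by points of the segment between them.
\<close>

section \<open>Smooth maps\<close>

lemma Ck_on_cong:
  assumes "open S" "\<And>x. x \<in> S \<Longrightarrow> f x = g x" "Ck_on k S f"
  shows "Ck_on k S g"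
  using assms(2,3)
proof (induction k arbitrary: f g)
  case 0
  then show ?case by (simp cong: continuous_on_cong)
next
  case (Suc k)
  have der: "(g has_derivative frechet_derivative f (at x)) (at x)" if "x \<in> S" for x
    using has_derivative_transform_within_open[OF _ \<open>open S\<close> that, of f "frechet_derivative f (at x)" UNIV g]
      Suc.prems that by (auto simp: frechet_derivative_works)
  have "Ck_on k S (\<lambda>x. frechet_derivative g (at x) v)" for v
  proof (rule Suc.IH)
    show "frechet_derivative f (at x) v = frechet_derivative g (at x) v" if "x \<in> S" for x
      using frechet_derivative_at[OF der[OF that]] by simp
    show "Ck_on k S (\<lambda>x. frechet_derivative f (at x) v)" using Suc.prems(2) by simp
  qed
  with der show ?case by (auto simp: differentiable_def)
qed

lemma Ck_on_SucI:
  assumes "open S" "\<And>x. x \<in> S \<Longrightarrow> (f has_derivative f' x) (at x)"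
    and "\<And>v. Ck_on k S (\<lambda>x. f' x v)"
  shows "Ck_on (Suc k) S f"
proof -
  have "Ck_on k S (\<lambda>x. frechet_derivative f (at x) v)" for v
    by (rule Ck_on_cong[OF assms(1) _ assms(3)[of v]]) (metis assms(2) frechet_derivative_at)
  then show ?thesis using assms(2) by (auto simp: differentiable_def)
qed

lemma Ck_on_Suc_continuous: "Ck_on (Suc k) S f \<Longrightarrow> continuous_on S f"
  by (auto intro!: continuous_at_imp_continuous_on differentiable_imp_continuous_within)

lemma Ck_on_Suc_imp: "Ck_on (Suc k) S f \<Longrightarrow> Ck_on k S f"
proof (induction k arbitrary: f)
  case 0
  then show ?case by (simp add: Ck_on_Suc_continuous[of 0 S f])
next
  case (Suc k)
  then show ?case by (metis Ck_on.simps(2))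
qed

lemma smooth_on_has_derivative:
  "smooth_on S f \<Longrightarrow> x \<in> S \<Longrightarrow> (f has_derivative frechet_derivative f (at x)) (at x)"
  unfolding smooth_on_def by (metis Ck_on.simps(2) frechet_derivative_works)

lemma smooth_on_derivative: "smooth_on S f \<Longrightarrow> smooth_on S (\<lambda>x. frechet_derivative f (at x) v)"
  unfolding smooth_on_def by (metis Ck_on.simps(2))

lemma smooth_on_continuous: "smooth_on S f \<Longrightarrow> continuous_on S f"
  unfolding smooth_on_def by (metis Ck_on.simps(1))

lemma Ck_on_const: "Ck_on k S (\<lambda>x. c)"
  by (induction k arbitrary: c) auto

lemma Ck_on_bounded_linear: "bounded_linear f \<Longrightarrow> Ck_on k S f"
proof (cases k)
  case (Suc m)
  assume f: "bounded_linear f"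
  then have "frechet_derivative f (at x) = f" for x
    by (metis bounded_linear_imp_has_derivative frechet_derivative_at)
  with f Suc show ?thesis
    by (auto simp: Ck_on_const bounded_linear_imp_differentiable)
qed (auto intro: linear_continuous_on)

lemma Ck_on_add:
  assumes "open S" "Ck_on k S f" "Ck_on k S g"
  shows "Ck_on k S (\<lambda>x. f x + g x)"
  using assms(2,3)
proof (induction k arbitrary: f g)
  case (Suc k)
  then show ?case
    by (intro Ck_on_SucI[OF \<open>open S\<close>, where f' = "\<lambda>x v. frechet_derivative f (at x) v + frechet_derivative g (at x) v"])
      (auto simp: frechet_derivative_works intro!: derivative_eq_intros)
qed (auto intro: continuous_intros)

lemma Ck_on_bilinear:
  assumes "open S" and B: "bounded_bilinear B" and "Ck_on k S f" "Ck_on k S g"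
  shows "Ck_on k S (\<lambda>x. B (f x) (g x))"
  using assms(3,4)
proof (induction k arbitrary: f g)
  case 0
  then show ?case by (auto intro: bounded_bilinear.continuous_on[OF B])
next
  case (Suc k)
  have "Ck_on k S f" "Ck_on k S g" using Suc.prems by (auto dest: Ck_on_Suc_imp simp del: Ck_on.simps)
  with Suc show ?case
    by (intro Ck_on_SucI[OF \<open>open S\<close>, where f' = "\<lambda>x v. B (f x) (frechet_derivative g (at x) v)
          + B (frechet_derivative f (at x) v) (g x)"] Ck_on_add)
      (auto simp: frechet_derivative_works intro!: bounded_bilinear.FDERIV[OF B] assms(1))
qed

text \<open>The derivative of \<open>1 / f\<close> is a product of \<open>f'\<close> and two factors \<open>1 / f\<close>, which allows an induction on
  the order of differentiability.\<close>

lemma Ck_on_inverse: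
  fixes f :: "'a::real_normed_vector \<Rightarrow> real"
  assumes "open S" "Ck_on k S f" and nz: "\<And>x. x \<in> S \<Longrightarrow> f x \<noteq> 0"
  shows "Ck_on k S (\<lambda>x. inverse (f x))"
  using assms(2)
proof (induction k)
  case 0
  then show ?case using nz by (auto intro: continuous_intros)
next
  case (Suc k)
  have I: "Ck_on k S (\<lambda>x. inverse (f x))" using Suc Ck_on_Suc_imp by blast
  have D: "Ck_on k S (\<lambda>x. (- 1) * frechet_derivative f (at x) v)" for v
    using Suc.prems by (intro Ck_on_bilinear[OF \<open>open S\<close> bounded_bilinear_mult] Ck_on_const) auto
  have "Ck_on k S (\<lambda>x. (inverse (f x) * inverse (f x)) * ((- 1) * frechet_derivative f (at x) v))" for v
    by (intro Ck_on_bilinear[OF \<open>open S\<close> bounded_bilinear_mult] I D)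
  then show ?case using Suc.prems nz
    by (intro Ck_on_SucI[OF \<open>open S\<close>, where f' = "\<lambda>x v. (inverse (f x) * inverse (f x)) *
          ((- 1) * frechet_derivative f (at x) v)"])
      (auto simp: frechet_derivative_works intro!: derivative_eq_intros)
qed

lemma norm_linear_Basis_le:
  fixes L :: "'a::euclidean_space \<Rightarrow> 'b::real_normed_vector"
  assumes "linear L" and B: "\<And>b. b \<in> Basis \<Longrightarrow> norm (L b) \<le> C b"
  shows "norm (L v) \<le> sum C Basis * norm v"
proof -
  have "L v = (\<Sum>b\<in>Basis. (v \<bullet> b) *\<^sub>R L b)"
    using \<open>linear L\<close> by (metis (no_types, lifting) euclidean_representation linear_sum linear_scale sum.cong)
  also have "norm \<dots> \<le> (\<Sum>b\<in>Basis. norm v * C b)"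
  proof (rule sum_norm_le)
    fix b :: 'a assume b: "b \<in> Basis"
    show "norm ((v \<bullet> b) *\<^sub>R L b) \<le> norm v * C b"
      using B[OF b] Basis_le_norm[OF b, of v] by (simp add: mult_mono)
  qed
  finally show ?thesis by (simp add: sum_distrib_left mult.commute)
qed

text \<open>A \<open>C\<^sup>1\<close> map has bounded derivative near a point, because its finitely many partial derivatives
  are continuous; the mean value inequality on a ball then gives a Lipschitz constant.\<close>

lemma smooth_on_locally_Lipschitz:
  fixes f :: "'a::euclidean_space \<Rightarrow> 'b::euclidean_space"
  assumes S: "open S" "x \<in> S" and f: "smooth_on S f"
  obtains \<delta> K where "\<delta> > 0" "K > 0" "cball x \<delta> \<subseteq> S"
    "\<And>y v. y \<in> cball x \<delta> \<Longrightarrow> norm (frechet_derivative f (at y) v) \<le> K * norm v"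
    "K-lipschitz_on (cball x \<delta>) f"
proof -
  obtain \<delta> where \<delta>: "\<delta> > 0" "cball x \<delta> \<subseteq> S" using S open_contains_cball by blast
  have "\<exists>C. \<forall>y\<in>cball x \<delta>. norm (frechet_derivative f (at y) b) \<le> C" for b
  proof -
    have "continuous_on (cball x \<delta>) (\<lambda>y. frechet_derivative f (at y) b)"
      using smooth_on_continuous[OF smooth_on_derivative[OF f]] \<delta>(2) continuous_on_subset by blast
    then have "bounded ((\<lambda>y. frechet_derivative f (at y) b) ` cball x \<delta>)"
      by (intro compact_imp_bounded compact_continuous_image) auto
    then show ?thesis by (auto simp: bounded_iff)
  qed
  then obtain C where C: "\<And>b y. y \<in> cball x \<delta> \<Longrightarrow> norm (frechet_derivative f (at y) b) \<le> C b"
    by metis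
  define K where "K = \<bar>sum C Basis\<bar> + 1"
  have der: "(f has_derivative frechet_derivative f (at y)) (at y)" if "y \<in> cball x \<delta>" for y
    using smooth_on_has_derivative[OF f] that \<delta> by blast
  have le: "norm (frechet_derivative f (at y) v) \<le> K * norm v" if "y \<in> cball x \<delta>" for y v
  proof -
    have "norm (frechet_derivative f (at y) v) \<le> sum C Basis * norm v"
      using has_derivative_linear[OF der[OF that]] C[OF that] by (intro norm_linear_Basis_le) auto
    also have "\<dots> \<le> K * norm v" unfolding K_def by (intro mult_right_mono) auto
    finally show ?thesis .
  qed
  have "norm (f y - f z) \<le> K * norm (y - z)" if "y \<in> cball x \<delta>" "z \<in> cball x \<delta>" for y z
  proof (rule differentiable_bound[OF convex_cball _ _ that])
    show "onorm (frechet_derivative f (at y)) \<le> K" if "y \<in> cball x \<delta>" for y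
      using le[OF that] by (intro onorm_bound) (auto simp: K_def)
  qed (use der has_derivative_at_withinI in blast)
  then have "K-lipschitz_on (cball x \<delta>) f"
    by (intro lipschitz_onI) (auto simp: dist_norm K_def)
  with le \<delta> show ?thesis by (intro that[of \<delta> K]) (auto simp: K_def)
qed

text \<open>Applied to the partial derivatives, the previous lemma makes the differential itself Lipschitz:
  this is how second order smoothness enters the study of conic points.\<close>

lemma smooth_on_derivative_locally_Lipschitz:
  fixes f :: "'a::euclidean_space \<Rightarrow> 'b::euclidean_space"
  assumes S: "open S" "x \<in> S" and f: "smooth_on S f"
  obtains \<delta> K where "\<delta> > 0" "K > 0" "cball x \<delta> \<subseteq> S"
    "\<And>y v. y \<in> cball x \<delta> \<Longrightarrow> norm (frechet_derivative f (at y) v) \<le> K * norm v"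
    "K-lipschitz_on (cball x \<delta>) f"
    "\<And>y z v. y \<in> cball x \<delta> \<Longrightarrow> z \<in> cball x \<delta> \<Longrightarrow>
       norm (frechet_derivative f (at y) v - frechet_derivative f (at z) v) \<le> K * dist y z * norm v"
proof -
  obtain \<delta>0 K0 where 0: "\<delta>0 > 0" "K0 > 0" "cball x \<delta>0 \<subseteq> S"
    "\<And>y v. y \<in> cball x \<delta>0 \<Longrightarrow> norm (frechet_derivative f (at y) v) \<le> K0 * norm v"
    "K0-lipschitz_on (cball x \<delta>0) f"
    using smooth_on_locally_Lipschitz[OF assms] by metis
  have "\<exists>\<delta> K. \<delta> > 0 \<and> K > 0 \<and> K-lipschitz_on (cball x \<delta>) (\<lambda>y. frechet_derivative f (at y) b)" for b
    using smooth_on_locally_Lipschitz[OF S smooth_on_derivative[OF f, of b]] by metis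
  then obtain d L where dL: "\<And>b. d b > 0" "\<And>b. L b > 0"
    "\<And>b. (L b)-lipschitz_on (cball x (d b)) (\<lambda>y. frechet_derivative f (at y) b)" by metis
  define \<delta> where "\<delta> = Min (insert \<delta>0 (d ` Basis))"
  define K where "K = K0 + sum L Basis"
  have \<delta>: "\<delta> > 0" "\<delta> \<le> \<delta>0" "\<And>b. b \<in> Basis \<Longrightarrow> \<delta> \<le> d b"
    using 0(1) dL(1) unfolding \<delta>_def by (auto simp del: Min_insert intro!: Min_le)
  have Lpos: "sum L Basis \<ge> 0" by (intro sum_nonneg less_imp_le dL(2))
  have K: "K0 \<le> K" "sum L Basis \<le> K" using 0(2) Lpos by (auto simp: K_def)
  have diff: "norm (frechet_derivative f (at y) v - frechet_derivative f (at z) v) \<le> K * dist y z * norm v"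
    if yz: "y \<in> cball x \<delta>" "z \<in> cball x \<delta>" for y z v
  proof -
    have "y \<in> S" "z \<in> S" using yz \<delta> 0(3) by (auto simp: subset_iff)
    then have lin: "linear (frechet_derivative f (at y))" "linear (frechet_derivative f (at z))"
      using smooth_on_has_derivative[OF f] has_derivative_linear by blast+
    have "norm ((\<lambda>v. frechet_derivative f (at y) v - frechet_derivative f (at z) v) v)
      \<le> (\<Sum>b\<in>Basis. L b * dist y z) * norm v"
    proof (rule norm_linear_Basis_le)
      show "norm (frechet_derivative f (at y) b - frechet_derivative f (at z) b) \<le> L b * dist y z"
        if "b \<in> Basis" for b
        using lipschitz_onD[OF dL(3)[of b], of y z] \<delta>(3)[OF that] yz by (auto simp: dist_norm)
    qed (rule linear_compose_sub[OF lin])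
    also have "(\<Sum>b\<in>Basis. L b * dist y z) = sum L Basis * dist y z" by (simp add: sum_distrib_right)
    also have "\<dots> * norm v \<le> K * dist y z * norm v" using K by (intro mult_right_mono) auto
    finally show ?thesis .
  qed
  have sub: "cball x \<delta> \<subseteq> cball x \<delta>0" using \<delta>(2) by auto
  show ?thesis
  proof (rule that[of \<delta> K])
    show "norm (frechet_derivative f (at y) v) \<le> K * norm v" if "y \<in> cball x \<delta>" for y v
      using 0(4)[of y v] sub that mult_right_mono[OF K(1), of "norm v"] by auto
    show "K-lipschitz_on (cball x \<delta>) f" using lipschitz_on_mono[OF 0(5)] sub K by blast
    show "cball x \<delta> \<subseteq> S" using sub 0(3) by blast
    show "0 < K" using K(1) 0(2) by linarith
    show "norm (frechet_derivative f (at y) v - frechet_derivative f (at z) v) \<le> K * dist y z * norm v"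
      if "y \<in> cball x \<delta>" "z \<in> cball x \<delta>" for y z v by (rule diff[OF that])
  qed (rule \<delta>(1))
qed

section \<open>Distances in a cone over a boundary chart\<close>

lemma smooth_on_line_derivative:
  fixes h :: "'a::real_normed_vector \<Rightarrow> real \<times> 'b::real_normed_vector"
  assumes "smooth_on Q h" "z + s *\<^sub>R w \<in> Q"
  shows "((\<lambda>s. fst (h (z + s *\<^sub>R w))) has_real_derivative
    fst (frechet_derivative h (at (z + s *\<^sub>R w)) w)) (at s)"
proof -
  let ?D = "frechet_derivative h (at (z + s *\<^sub>R w))"
  have h: "(h has_derivative ?D) (at (z + s *\<^sub>R w))"
    by (rule smooth_on_has_derivative[OF assms])
  have "((\<lambda>s. z + s *\<^sub>R w) has_derivative (\<lambda>t. t *\<^sub>R w)) (at s)"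
    by (auto intro!: derivative_eq_intros)
  from has_derivative_compose[OF this h]
  have "((\<lambda>s. fst (h (z + s *\<^sub>R w))) has_derivative (\<lambda>t. fst (?D (t *\<^sub>R w)))) (at s)"
    by (rule has_derivative_fst)
  moreover have "?D (t *\<^sub>R w) = t *\<^sub>R ?D w" for t
    using has_derivative_linear[OF h] by (rule linear_scale)
  ultimately show ?thesis
    by (simp add: has_field_derivative_def mult.commute[of _ "fst (?D w)"])
qed

lemma open_line_nbhd:
  fixes z w :: "'a::real_normed_vector"
  assumes "open Q" "z \<in> Q"
  obtains d :: real where "d > 0" "\<And>s. \<bar>s\<bar> < d \<Longrightarrow> z + s *\<^sub>R w \<in> Q"
proof -
  have "isCont (\<lambda>s::real. z + s *\<^sub>R w) 0" by (intro continuous_intros)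
  then have "\<forall>\<^sub>F s in nhds 0. z + s *\<^sub>R w \<in> Q"
    using assms unfolding isCont_def tendsto_def eventually_at_filter
    by (force elim!: allE[of _ Q] eventually_mono)
  then show ?thesis using that by (auto simp: eventually_nhds_metric)
qed

text \<open>Two unit vectors span a cone over which the Euclidean distance controls both the difference of
  the radii and the angular distance weighted by the radii.\<close>

lemma cone_distance_bounds:
  fixes u v :: "'b::real_inner"
  assumes "norm u = 1" "norm v = 1" "a \<ge> 0" "b \<ge> 0"
  shows "\<bar>a - b\<bar> \<le> norm (a *\<^sub>R u - b *\<^sub>R v)"
    and "(a + b) * norm (u - v) \<le> 2 * norm (a *\<^sub>R u - b *\<^sub>R v)"
    and "norm (a *\<^sub>R u - b *\<^sub>R v) \<le> \<bar>a - b\<bar> + b * norm (u - v)"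
proof -
  show "\<bar>a - b\<bar> \<le> norm (a *\<^sub>R u - b *\<^sub>R v)"
    using norm_triangle_ineq3[of "a *\<^sub>R u" "b *\<^sub>R v"] assms by simp
  have "a *\<^sub>R u - b *\<^sub>R v = (a - b) *\<^sub>R u + b *\<^sub>R (u - v)" by (simp add: algebra_simps)
  then show "norm (a *\<^sub>R u - b *\<^sub>R v) \<le> \<bar>a - b\<bar> + b * norm (u - v)"
    using norm_triangle_ineq[of "(a - b) *\<^sub>R u" "b *\<^sub>R (u - v)"] assms by simp
  have uu: "u \<bullet> u = 1" "v \<bullet> v = 1" using assms by (simp_all add: dot_square_norm)
  \<comment> \<open>With \<open>c = u \<bullet> v\<close>, the right side squared minus the left side squared is
    \<open>2 (a - b)\<^sup>2 (1 + c)\<close>.\<close>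
  have le: "u \<bullet> v \<ge> - 1" using Cauchy_Schwarz_ineq2[of u v] assms by simp
  have n1: "(norm (u - v))\<^sup>2 = 2 - 2 * (u \<bullet> v)"
    unfolding power2_norm_eq_inner by (simp add: inner_diff inner_commute[of v u] uu)
  have n2: "(norm (a *\<^sub>R u - b *\<^sub>R v))\<^sup>2 = a\<^sup>2 + b\<^sup>2 - 2 * a * b * (u \<bullet> v)"
    unfolding power2_norm_eq_inner
    by (simp add: inner_diff inner_commute[of v u] uu power2_eq_square algebra_simps)
  have "0 \<le> 2 * (a - b)\<^sup>2 * (1 + u \<bullet> v)" using le by simp
  also have "\<dots> = (2 * norm (a *\<^sub>R u - b *\<^sub>R v))\<^sup>2 - ((a + b) * norm (u - v))\<^sup>2"
    unfolding power_mult_distrib n1 n2 by (simp add: power2_eq_square algebra_simps)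
  finally have "((a + b) * norm (u - v))\<^sup>2 \<le> (2 * norm (a *\<^sub>R u - b *\<^sub>R v))\<^sup>2"
    by (simp only: diff_ge_0_iff_ge)
  then show "(a + b) * norm (u - v) \<le> 2 * norm (a *\<^sub>R u - b *\<^sub>R v)"
    by (rule power2_le_imp_le) simp
qed

lemma norm_orthogonal_part_le:
  fixes x e :: "'a::real_inner"
  assumes "norm e = 1"
  shows "norm (x - (x \<bullet> e) *\<^sub>R e) \<le> norm x"
proof (rule power2_le_imp_le)
  have "e \<bullet> e = 1" using assms by (simp add: dot_square_norm)
  then have "(norm (x - (x \<bullet> e) *\<^sub>R e))\<^sup>2 = (norm x)\<^sup>2 - (x \<bullet> e)\<^sup>2"
    unfolding power2_norm_eq_inner
    by (simp add: inner_diff_left inner_diff_right inner_commute[of e x] power2_eq_square)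
  then show "(norm (x - (x \<bullet> e) *\<^sub>R e))\<^sup>2 \<le> (norm x)\<^sup>2" by simp
qed simp

lemma half_space_convex: "subspace F \<Longrightarrow> convex (half_space F e)"
  unfolding half_space_def convex_alt
  by (auto simp: subspace_add subspace_scale inner_add_left)

lemma half_space_foot:
  fixes y e :: "'a::euclidean_space"
  assumes F: "subspace F" "e \<in> F" "norm e = 1" and y: "y \<bullet> e = 0"
    and z: "z \<in> ball y \<delta> \<inter> half_space F e"
  shows "z - (z \<bullet> e) *\<^sub>R e \<in> ball y \<delta> \<inter> half_space F e \<and> (z - (z \<bullet> e) *\<^sub>R e) \<bullet> e = 0"
proof -
  have ee: "e \<bullet> e = 1" using F(3) by (simp add: dot_square_norm)
  have "(z - y) - ((z - y) \<bullet> e) *\<^sub>R e = - (y - (z - (z \<bullet> e) *\<^sub>R e))"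
    using y by (simp add: inner_diff_left)
  then have "norm (y - (z - (z \<bullet> e) *\<^sub>R e)) \<le> norm (y - z)"
    using norm_orthogonal_part_le[OF F(3), of "z - y"] by (metis norm_minus_cancel norm_minus_commute)
  then show ?thesis
    using z F ee by (auto simp: half_space_def dist_norm subspace_diff subspace_scale inner_diff_left)
qed

text \<open>Pulled back by a boundary chart of the strict transform, with \<open>e\<close> the inward unit normal of the
  half-space, the distance of \<open>\<real>\<^sup>n\<close> becomes comparable to the following quantity: near the
  cone point, a tangential displacement counts in proportion to the distance to the boundary.\<close>

definition cone_gauge :: "'a::euclidean_space \<Rightarrow> 'a \<Rightarrow> 'a \<Rightarrow> real" where
  "cone_gauge e z z' = \<bar>(z - z') \<bullet> e\<bar> + max (z \<bullet> e) (z' \<bullet> e) * norm (z - z')"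

text \<open>Here \<open>h\<close> parametrises a set in the cylinder \<open>[0, \<infinity>) \<times> S\<close> by the half-space \<open>z \<bullet> e \<ge> 0\<close> of
  \<open>F\<close>, with boundary going to boundary; \<open>f0\<close> witnesses transversality. As the radius \<open>\<rho>\<close> vanishes on the
  face \<open>z \<bullet> e = 0\<close>, transversality means that its normal derivative is positive, so \<open>\<rho>\<close> is comparable to
  \<open>z \<bullet> e\<close>. The upper estimate follows from the mean value theorem, as a tangential displacement \<open>w\<close> changes
  \<open>\<rho>\<close> by \<open>O((z \<bullet> e) \<bar>w\<bar>)\<close> only. For the lower one, \<open>h\<close> is an immersion, so \<open>\<bar>z - z'\<bar>\<close> is
  bounded by the differences of radii and of angles. Multiplied by \<open>max (z \<bullet> e) (z' \<bullet> e)\<close>, both are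
  controlled by the distance in the cone; this bounds the second summand of the gauge, and then also the
  first one, again by the mean value theorem.\<close>

lemma cone_chart_estimates:
  fixes h :: "'a::euclidean_space \<Rightarrow> real \<times> 'b::euclidean_space" and centre :: 'b
  assumes F: "subspace F" "e \<in> F" "norm e = 1" and Q: "open Q" "y \<in> Q" "y \<in> F" "y \<bullet> e = 0"
    and h: "smooth_on Q h" and inj: "inj_on (frechet_derivative h (at y)) F"
    and cyl: "\<And>z. z \<in> Q \<inter> half_space F e \<Longrightarrow> fst (h z) \<ge> 0 \<and> norm (snd (h z)) = 1"
    and bd: "\<And>z. z \<in> Q \<inter> half_space F e \<Longrightarrow> z \<bullet> e = 0 \<Longrightarrow> fst (h z) = 0"
    and f0: "f0 \<in> F" "fst (frechet_derivative h (at y) f0) \<noteq> 0"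
  obtains \<delta> C where "\<delta> > 0" "C > 0" "ball y \<delta> \<subseteq> Q"
    "\<And>z z'. z \<in> ball y \<delta> \<inter> half_space F e \<Longrightarrow> z' \<in> ball y \<delta> \<inter> half_space F e \<Longrightarrow>
       norm (blowup_map centre (h z) - blowup_map centre (h z')) \<le> C * cone_gauge e z z' \<and>
       cone_gauge e z z' \<le> C * norm (blowup_map centre (h z) - blowup_map centre (h z'))"
proof -
  let ?H = "half_space F e"
  define D where "D z = frechet_derivative h (at z)" for z
  have der: "(h has_derivative D z) (at z)" if "z \<in> Q" for z
    unfolding D_def by (rule smooth_on_has_derivative[OF h that])
  have lin: "linear (D z)" if "z \<in> Q" for z using der[OF that] has_derivative_linear by blast
  obtain \<delta>0 K where K: "\<delta>0 > 0" "K > 0" "cball y \<delta>0 \<subseteq> Q"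
    "\<And>z v. z \<in> cball y \<delta>0 \<Longrightarrow> norm (D z v) \<le> K * norm v"
    "K-lipschitz_on (cball y \<delta>0) h"
    "\<And>z z' v. z \<in> cball y \<delta>0 \<Longrightarrow> z' \<in> cball y \<delta>0 \<Longrightarrow> norm (D z v - D z' v) \<le> K * dist z z' * norm v"
    unfolding D_def by (rule smooth_on_derivative_locally_Lipschitz[OF Q(1,2) h]) blast
  have ee: "e \<bullet> e = 1" using F(3) by (simp add: dot_square_norm)
  have tangential0: "fst (D z w) = 0" if z: "z \<in> Q \<inter> ?H" "z \<bullet> e = 0" and w: "w \<in> F" "w \<bullet> e = 0" for z w
  proof -
    obtain d where d: "d > 0" "\<And>s. \<bar>s\<bar> < d \<Longrightarrow> z + s *\<^sub>R w \<in> Q"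
      using open_line_nbhd[OF Q(1), of z w] z by auto
    have "z \<in> F" using z by (simp add: half_space_def)
    then have "fst (h (z + s *\<^sub>R w)) = 0" if "\<bar>s\<bar> < d" for s
      using d(2)[OF that] w z F(1) by (intro bd) (auto simp: half_space_def inner_add_left subspace_add subspace_scale)
    moreover from this[of 0] d(1) have "fst (h z) = 0" by simp
    ultimately show ?thesis
      using smooth_on_line_derivative[OF h, of z 0 w] z d(1) unfolding D_def
      by (intro DERIV_local_const[of "\<lambda>s. fst (h (z + s *\<^sub>R w))" _ 0 d]) auto
  qed
  define \<kappa> where "\<kappa> = fst (D y e)"
  have yH: "y \<in> Q \<inter> ?H" using Q by (simp add: half_space_def)
  have "\<kappa> \<noteq> 0"
  proof
    assume k: "\<kappa> = 0"
    let ?w = "f0 - (f0 \<bullet> e) *\<^sub>R e"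
    have "?w \<in> F" "?w \<bullet> e = 0"
      using F f0(1) ee by (auto simp: subspace_diff subspace_scale inner_diff_left)
    then have "fst (D y ?w) = 0" using tangential0[OF yH Q(4)] by blast
    moreover have "D y ?w = D y f0 - (f0 \<bullet> e) *\<^sub>R D y e"
      using lin[OF Q(2)] by (simp add: linear_diff linear_scale)
    ultimately have "fst (D y f0) = 0" using k by (simp add: \<kappa>_def)
    then show False using f0(2) by (simp add: D_def)
  qed
  moreover have "\<kappa> \<ge> 0"
  proof (rule ccontr)
    assume "\<not> 0 \<le> \<kappa>"
    then have "fst (frechet_derivative h (at y) e) < 0" by (simp add: \<kappa>_def D_def)
    then obtain d1 where d1: "d1 > 0" "\<And>s. 0 < s \<Longrightarrow> s < d1 \<Longrightarrow> fst (h (y + s *\<^sub>R e)) < fst (h y)"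
      using DERIV_neg_dec_right[OF smooth_on_line_derivative[OF h, of y 0 e]] Q(2) by auto
    obtain d where d: "d > 0" "\<And>s. \<bar>s\<bar> < d \<Longrightarrow> y + s *\<^sub>R e \<in> Q"
      using open_line_nbhd[OF Q(1), of y e] Q(2) by auto
    define s where "s = min d d1 / 2"
    have s: "0 < s" "s < d1" "\<bar>s\<bar> < d" using d d1 by (auto simp: s_def min_def)
    have "y + s *\<^sub>R e \<in> Q \<inter> ?H" using d(2)[OF s(3)] Q F ee s(1)
      by (auto simp: half_space_def subspace_add subspace_scale inner_add_left)
    from cyl[OF this] d1(2)[OF s(1,2)] bd[OF yH Q(4)] show False by simp
  qed
  ultimately have \<kappa>: "\<kappa> > 0" by simp
  have "\<exists>c>0. \<forall>x\<in>F. norm (D y x) \<ge> c * norm x"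
  proof (rule injective_imp_isometric)
    show "\<forall>x\<in>F. D y x = 0 \<longrightarrow> x = 0"
      using inj linear_0[OF lin[OF Q(2)]] subspace_0[OF F(1)] unfolding inj_on_def D_def by metis
    show "bounded_linear (D y)" using der[OF Q(2)] by (rule has_derivative_bounded_linear)
  qed (use F(1) closed_subspace in auto)
  then obtain c where c: "c > 0" "\<And>x. x \<in> F \<Longrightarrow> norm (D y x) \<ge> c * norm x" by auto
  define \<delta> where "\<delta> = min (min \<delta>0 1) (min (c / (2 * K)) (\<kappa> / (2 * K)))"
  have \<delta>: "\<delta> > 0" "\<delta> \<le> \<delta>0" "\<delta> \<le> 1" "\<delta> \<le> c / (2 * K)" "\<delta> \<le> \<kappa> / (2 * K)"
    using K(1,2) c(1) \<kappa> by (auto simp: \<delta>_def)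
  then have \<delta>: "\<delta> > 0" "\<delta> \<le> \<delta>0" "\<delta> \<le> 1" "K * \<delta> \<le> c / 2" "K * \<delta> \<le> \<kappa> / 2"
    using K(2) by (auto simp: field_simps)
  let ?B = "ball y \<delta> \<inter> ?H"
  have BQ: "ball y \<delta> \<subseteq> Q" and BK: "ball y \<delta> \<subseteq> cball y \<delta>0" using K(3) \<delta>(2) by auto
  have BD: "z \<in> Q \<and> z \<in> F \<and> z \<bullet> e \<ge> 0 \<and> z \<bullet> e \<le> 1 \<and> z \<in> cball y \<delta>0" if "z \<in> ?B" for z
  proof -
    have "z \<bullet> e = (z - y) \<bullet> e" using Q(4) by (simp add: inner_diff_left)
    also have "\<dots> \<le> norm (z - y)" using norm_cauchy_schwarz[of "z - y" e] F(3) by simp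
    also have "\<dots> \<le> 1" using that \<delta>(3) by (auto simp: dist_norm norm_minus_commute)
    finally show ?thesis using that BQ BK by (auto simp: half_space_def)
  qed
  have foot: "z - (z \<bullet> e) *\<^sub>R e \<in> ?B" if "z \<in> ?B" for z
    using half_space_foot[OF F Q(4) that] by blast
  \<comment> \<open>The radius vanishes on the face \<open>z \<bullet> e = 0\<close>, so its tangential derivative is zero there; as the
    differential is Lipschitz, it is at most of the order of the distance to this face elsewhere.\<close>
  have tangential: "\<bar>fst (D z w)\<bar> \<le> K * (z \<bullet> e) * norm w" if z: "z \<in> ?B" and w: "w \<in> F" "w \<bullet> e = 0" for z w
  proof -
    let ?z = "z - (z \<bullet> e) *\<^sub>R e"
    have z0: "?z \<in> Q \<inter> ?H" "?z \<bullet> e = 0" using foot[OF z] BQ ee by (auto simp: inner_diff_left)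
    have "fst (D z w) = fst (D z w - D ?z w)" using tangential0[OF z0 w] by simp
    also have "\<bar>\<dots>\<bar> \<le> norm (D z w - D ?z w)" using norm_fst_le by (metis real_norm_def prod.collapse)
    also have "\<dots> \<le> K * dist z ?z * norm w" using BD[OF z] BD[OF foot[OF z]] by (intro K(6)) auto
    also have "dist z ?z = z \<bullet> e" using BD[OF z] F(3) by (simp add: dist_norm)
    finally show ?thesis .
  qed
  have normal: "fst (D z e) \<ge> \<kappa> / 2" "\<bar>fst (D z e)\<bar> \<le> K" if z: "z \<in> ?B" for z
  proof -
    have "\<bar>fst (D z e - D y e)\<bar> \<le> norm (D z e - D y e)" using norm_fst_le by (metis real_norm_def prod.collapse)
    also have "\<dots> \<le> K * dist z y * norm e" using BD[OF z] K(1) by (intro K(6)) auto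
    also have "\<dots> \<le> K * \<delta>" using z F(3) K(2) by (auto simp: dist_commute)
    finally show "fst (D z e) \<ge> \<kappa> / 2" using \<delta>(5) unfolding \<kappa>_def by simp
    have "\<bar>fst (D z e)\<bar> \<le> norm (D z e)" using norm_fst_le by (metis real_norm_def prod.collapse)
    also have "\<dots> \<le> K" using K(4)[of z e] BD[OF z] F(3) by simp
    finally show "\<bar>fst (D z e)\<bar> \<le> K" .
  qed
  have convB: "convex ?B" using half_space_convex[OF F(1)] by (intro convex_Int) auto
  have mean_value: "\<exists>a. \<kappa> / 2 \<le> a \<and> a \<le> K \<and>
      \<bar>fst (h z') - fst (h z) - ((z' - z) \<bullet> e) * a\<bar> \<le>
        K * max (z \<bullet> e) (z' \<bullet> e) * norm ((z' - z) - ((z' - z) \<bullet> e) *\<^sub>R e)"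
    if z: "z \<in> ?B" "z' \<in> ?B" for z z'
  proof -
    let ?d = "z' - z"
    have on: "z + s *\<^sub>R ?d \<in> ?B" if "0 \<le> s" "s \<le> 1" for s
      using convexD_alt[OF convB z that] by (simp add: algebra_simps)
    have "((\<lambda>s. fst (h (z + s *\<^sub>R ?d))) has_real_derivative fst (D (z + s *\<^sub>R ?d) ?d)) (at s)"
      if "0 \<le> s" "s \<le> 1" for s
      unfolding D_def using BD[OF on[OF that]] by (intro smooth_on_line_derivative[OF h]) auto
    from MVT2[of 0 1, OF _ this] obtain s where s: "0 < s" "s < 1"
      "fst (h z') - fst (h z) = fst (D (z + s *\<^sub>R ?d) ?d)" by auto
    let ?\<xi> = "z + s *\<^sub>R ?d" let ?w = "?d - (?d \<bullet> e) *\<^sub>R e"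
    have \<xi>: "?\<xi> \<in> ?B" using on s by simp
    have w: "?w \<in> F" "?w \<bullet> e = 0"
      using BD[OF z(1)] BD[OF z(2)] F ee by (auto simp: subspace_diff subspace_scale inner_diff_left)
    have "D ?\<xi> ?w = D ?\<xi> ?d - (?d \<bullet> e) *\<^sub>R D ?\<xi> e"
      using lin[of ?\<xi>] BD[OF \<xi>] by (simp add: linear_diff linear_scale)
    then have "fst (h z') - fst (h z) - (?d \<bullet> e) * fst (D ?\<xi> e) = fst (D ?\<xi> ?w)"
      using s(3) by simp
    also have "\<bar>\<dots>\<bar> \<le> K * (?\<xi> \<bullet> e) * norm ?w" by (rule tangential[OF \<xi> w])
    also have "\<dots> \<le> K * max (z \<bullet> e) (z' \<bullet> e) * norm ?w"
    proof (intro mult_right_mono mult_left_mono)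
      have "?\<xi> \<bullet> e = (1 - s) * (z \<bullet> e) + s * (z' \<bullet> e)" by (simp add: inner_add_left inner_diff_left algebra_simps)
      also have "\<dots> \<le> max (z \<bullet> e) (z' \<bullet> e)" using s by (intro convex_bound_le) auto
      finally show "?\<xi> \<bullet> e \<le> max (z \<bullet> e) (z' \<bullet> e)" .
    qed (use K in auto)
    finally show ?thesis using normal[OF \<xi>] by (intro exI[of _ "fst (D ?\<xi> e)"]) auto
  qed
  have radius: "\<kappa> / 2 * (z \<bullet> e) \<le> fst (h z)" "fst (h z) \<le> K * (z \<bullet> e)" if z: "z \<in> ?B" for z
  proof -
    let ?z = "z - (z \<bullet> e) *\<^sub>R e"
    have "fst (h ?z) = 0" using foot[OF z] BQ ee by (intro bd) (auto simp: inner_diff_left)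
    then obtain a where "\<kappa> / 2 \<le> a" "a \<le> K" "fst (h z) = (z \<bullet> e) * a"
      using mean_value[OF foot[OF z] z] ee by auto
    then show "\<kappa> / 2 * (z \<bullet> e) \<le> fst (h z)" "fst (h z) \<le> K * (z \<bullet> e)"
      using BD[OF z] mult_left_mono[of "\<kappa> / 2" a "z \<bullet> e"] mult_left_mono[of a K "z \<bullet> e"]
      by (simp_all add: mult.commute)
  qed
  have immersion: "c / 2 * norm (z' - z) \<le> norm (h z' - h z)" if z: "z \<in> ?B" "z' \<in> ?B" for z z'
  proof -
    have blD: "bounded_linear (D y)" using der[OF Q(2)] by (rule has_derivative_bounded_linear)
    have "norm ((h z' - D y z') - (h z - D y z)) \<le> c / 2 * norm (z' - z)"
    proof (rule differentiable_bound[OF convex_ball])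
      fix x assume x: "x \<in> ball y \<delta>"
      show "((\<lambda>z. h z - D y z) has_derivative (\<lambda>v. D x v - D y v)) (at x within ball y \<delta>)"
        using der[of x] x BQ bounded_linear_imp_has_derivative[OF blD]
        by (blast intro: has_derivative_at_withinI has_derivative_diff)
      show "onorm (\<lambda>v. D x v - D y v) \<le> c / 2"
      proof (rule onorm_bound)
        fix v
        have "norm (D x v - D y v) \<le> K * dist x y * norm v" using x BK K(1) by (intro K(6)) auto
        also have "\<dots> \<le> K * \<delta> * norm v" using x K(2) by (intro mult_right_mono) (auto simp: dist_commute)
        also have "\<dots> \<le> c / 2 * norm v" using \<delta>(4) by (intro mult_right_mono) auto
        finally show "norm (D x v - D y v) \<le> c / 2 * norm v" .
      qed (use c in simp)
    qed (use z in auto)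
    moreover have "(h z' - D y z') - (h z - D y z) = (h z' - h z) - D y (z' - z)"
      using lin[OF Q(2)] by (simp add: linear_diff)
    moreover have "c * norm (z' - z) \<le> norm (D y (z' - z))"
      using BD[OF z(1)] BD[OF z(2)] F(1) by (intro c(2)) (auto simp: subspace_diff)
    ultimately show ?thesis
      using norm_triangle_ineq2[of "D y (z' - z)" "h z' - h z"] by (simp add: norm_minus_commute)
  qed
  define \<alpha> where "\<alpha> = (1 + 4 / \<kappa>) / (c / 2)"
  define C where "C = (K + K + K * K) + (2 / \<kappa> * (1 + K * \<alpha>) + \<alpha>)"
  have \<alpha>: "\<alpha> > 0" using \<kappa> c by (auto simp: \<alpha>_def field_simps add_pos_pos)
  have est: "norm (blowup_map centre (h z) - blowup_map centre (h z')) \<le> C * cone_gauge e z z' \<and>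
       cone_gauge e z z' \<le> C * norm (blowup_map centre (h z) - blowup_map centre (h z'))"
    if z: "z \<in> ?B" "z' \<in> ?B" for z z'
  proof -
    define T where "T = max (z \<bullet> e) (z' \<bullet> e)"
    define A where "A = \<bar>(z' - z) \<bullet> e\<bar>"
    define d where "d = norm (z' - z)"
    define R where "R = norm (blowup_map centre (h z) - blowup_map centre (h z'))"
    define \<rho> where "\<rho> = fst (h z)" define \<rho>' where "\<rho>' = fst (h z')"
    define \<eta> where "\<eta> = norm (snd (h z) - snd (h z'))"
    have T: "T \<ge> 0" "T \<le> 1" using BD[OF z(1)] BD[OF z(2)] by (auto simp: T_def)
    have pos: "A \<ge> 0" "d \<ge> 0" "R \<ge> 0" "\<eta> \<ge> 0" by (auto simp: A_def d_def R_def \<eta>_def)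
    have m: "cone_gauge e z z' = A + T * d"
      by (simp add: cone_gauge_def A_def T_def d_def norm_minus_commute abs_minus_commute inner_diff_left)
    have cz: "\<rho> \<ge> 0" "norm (snd (h z)) = 1" "\<rho>' \<ge> 0" "norm (snd (h z')) = 1"
      using cyl[of z] cyl[of z'] z BD[OF z(1)] BD[OF z(2)] by (auto simp: \<rho>_def \<rho>'_def)
    have R_eq: "R = norm (\<rho> *\<^sub>R snd (h z) - \<rho>' *\<^sub>R snd (h z'))"
      by (simp add: R_def blowup_map_def \<rho>_def \<rho>'_def case_prod_beta)
    have R1: "\<bar>\<rho> - \<rho>'\<bar> \<le> R" and R2: "(\<rho> + \<rho>') * \<eta> \<le> 2 * R" and R3: "R \<le> \<bar>\<rho> - \<rho>'\<bar> + \<rho>' * \<eta>"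
      unfolding R_eq \<eta>_def using cone_distance_bounds[OF cz(2,4,1,3)] by auto
    obtain a where a: "\<kappa> / 2 \<le> a" "a \<le> K" and mv: "\<bar>\<rho>' - \<rho> - ((z' - z) \<bullet> e) * a\<bar> \<le>
        K * T * norm ((z' - z) - ((z' - z) \<bullet> e) *\<^sub>R e)"
      using mean_value[OF z] by (auto simp: \<rho>_def \<rho>'_def T_def)
    have "norm ((z' - z) - ((z' - z) \<bullet> e) *\<^sub>R e) \<le> d"
      unfolding d_def by (rule norm_orthogonal_part_le[OF F(3)])
    then have "K * T * norm ((z' - z) - ((z' - z) \<bullet> e) *\<^sub>R e) \<le> K * T * d"
      using K T by (intro mult_left_mono) auto
    with mv have mv: "\<bar>\<rho>' - \<rho> - ((z' - z) \<bullet> e) * a\<bar> \<le> K * (T * d)" by (simp add: mult.assoc)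
    have Aa: "\<bar>((z' - z) \<bullet> e) * a\<bar> = A * a" using a \<kappa> by (simp add: A_def abs_mult)
    have Aa1: "A * a \<le> A * K" and Aa2: "A * (\<kappa> / 2) \<le> A * a" 
      by (rule mult_left_mono[OF a(2) pos(1)], rule mult_left_mono[OF a(1) pos(1)])
    have h_le: "\<eta> \<le> K * d"
    proof -
      have "\<eta> \<le> norm (h z - h z')" unfolding \<eta>_def
        by (metis norm_snd_le prod.collapse snd_diff)
      also have "\<dots> \<le> K * d" using lipschitz_onD[OF K(5), of z z'] BD[OF z(1)] BD[OF z(2)]
        by (simp add: dist_norm d_def norm_minus_commute)
      finally show ?thesis .
    qed
    have h_ge: "c / 2 * d \<le> \<bar>\<rho> - \<rho>'\<bar> + \<eta>"
    proof -
      have "c / 2 * d \<le> norm (h z' - h z)" unfolding d_def by (rule immersion[OF z])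
      also have "\<dots> \<le> norm (fst (h z' - h z)) + norm (snd (h z' - h z))"
        by (metis norm_Pair_le prod.collapse)
      also have "\<dots> \<le> \<bar>\<rho> - \<rho>'\<bar> + \<eta>"
        by (simp add: \<rho>_def \<rho>'_def \<eta>_def norm_minus_commute abs_minus_commute)
      finally show ?thesis .
    qed
    have rT: "\<kappa> / 2 * T \<le> \<rho> + \<rho>'" "\<rho>' \<le> K * T"
    proof -
      have "\<kappa> / 2 * (z \<bullet> e) \<le> \<rho> + \<rho>'" "\<kappa> / 2 * (z' \<bullet> e) \<le> \<rho> + \<rho>'"
        using radius(1)[OF z(1)] radius(1)[OF z(2)] cz by (auto simp: \<rho>_def \<rho>'_def)
      then show "\<kappa> / 2 * T \<le> \<rho> + \<rho>'" unfolding T_def max_def by auto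
      have "\<rho>' \<le> K * (z' \<bullet> e)" using radius(2)[OF z(2)] by (simp add: \<rho>'_def)
      also have "\<dots> \<le> K * T" using K by (simp add: T_def)
      finally show "\<rho>' \<le> K * T" .
    qed
    have Td: "T * d \<ge> 0" using T pos by simp
    have "R \<le> (K + K + K * K) * (A + T * d)"
    proof -
      have "\<rho>' * \<eta> \<le> (K * T) * (K * d)" using rT(2) h_le cz pos K T by (intro mult_mono) auto
      moreover have "\<bar>\<rho> - \<rho>'\<bar> \<le> A * K + K * (T * d)" using mv Aa Aa1 by linarith
      moreover have "0 \<le> K * A" "0 \<le> K * K * A" "0 \<le> K * (T * d)" using K pos Td by auto
      ultimately show ?thesis using R3 by (simp add: algebra_simps)
    qed
    also have "\<dots> \<le> C * (A + T * d)" using pos Td \<kappa> \<alpha> K by (intro mult_right_mono) (auto simp: C_def)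
    finally have 1: "R \<le> C * (A + T * d)" .
    have T\<eta>: "T * \<eta> \<le> 4 / \<kappa> * R"
    proof -
      have "\<kappa> / 2 * T * \<eta> \<le> (\<rho> + \<rho>') * \<eta>" using rT(1) pos by (intro mult_right_mono) auto
      then show ?thesis using R2 \<kappa> by (simp add: field_simps)
    qed
    have "c / 2 * (T * d) \<le> T * (\<bar>\<rho> - \<rho>'\<bar> + \<eta>)" using h_ge T mult_left_mono[OF h_ge T(1)] by (simp add: algebra_simps)
    also have "\<dots> \<le> R + 4 / \<kappa> * R"
      using mult_mono[OF T(2) R1] T\<eta> T pos by (simp add: algebra_simps)
    finally have Tdle: "T * d \<le> \<alpha> * R" using c by (simp add: \<alpha>_def field_simps)
    have "A * (\<kappa> / 2) \<le> R + K * (T * d)" using mv Aa Aa2 R1 by linarith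
    also have "\<dots> \<le> R + K * (\<alpha> * R)" using Tdle K by simp
    finally have "A \<le> 2 / \<kappa> * (1 + K * \<alpha>) * R" using \<kappa> by (simp add: field_simps)
    with Tdle have "A + T * d \<le> (2 / \<kappa> * (1 + K * \<alpha>) + \<alpha>) * R" by (simp add: algebra_simps)
    also have "\<dots> \<le> C * R" using pos K by (intro mult_right_mono) (auto simp: C_def)
    finally show ?thesis using 1 unfolding m R_def by blast
  qed
  show ?thesis
    by (rule that[OF \<delta>(1) _ BQ est]) (use \<kappa> \<alpha> K in \<open>auto simp: C_def intro!: add_pos_pos mult_pos_pos divide_pos_pos\<close>)
qed

section \<open>The tangent space of the cylinder\<close>

lemma homeomorphism_inv_into:
  assumes "continuous_on S h" "continuous_on (h ` S) k" "\<And>x. x \<in> S \<Longrightarrow> k (h x) = x"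
  shows "homeomorphism S (h ` S) h (inv_into S h)"
proof -
  have "inj_on h S" using assms(3) by (metis inj_onI)
  then have "inv_into S h y = k y" if "y \<in> h ` S" for y using assms(3) that by auto
  then have "continuous_on (h ` S) (inv_into S h)" using assms(2) by (simp cong: continuous_on_cong)
  with assms(1) \<open>inj_on h S\<close> show ?thesis
    by (auto simp: homeomorphism_def inv_into_into f_inv_into_f image_image)
qed

text \<open>Inverse stereographic projection from the antipode of \<open>u\<close>, in the second factor; written as a combination
  of linear maps and products to which the closure properties of smooth maps apply.\<close>

definition stereographic_inverse :: "'b::real_inner \<Rightarrow> real \<times> 'b \<Rightarrow> real \<times> 'b" where
  "stereographic_inverse u p = (fst p, 0) +
     inverse (1 + snd p \<bullet> snd p) *\<^sub>R ((0, 2 *\<^sub>R snd p) + (1 - snd p \<bullet> snd p) *\<^sub>R (0, u))"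

text \<open>The inverse of the previous map, on the unit sphere without the antipode of \<open>u\<close>.\<close>

definition stereographic :: "'b::real_inner \<Rightarrow> real \<times> 'b \<Rightarrow> real \<times> 'b" where
  "stereographic u p = (fst p, 0) +
     inverse (1 + snd p \<bullet> u) *\<^sub>R ((0, snd p) + (- (snd p \<bullet> u)) *\<^sub>R (0, u))"

lemma Ck_on_stereographic_inverse: "open S \<Longrightarrow> Ck_on k S (stereographic_inverse u)"
proof -
  assume S: "open S"
  have lin: "bounded_linear (\<lambda>p::real \<times> 'a. (fst p, 0::'a))" "bounded_linear (\<lambda>p::real \<times> 'a. (0::real, 2 *\<^sub>R snd p))"
    by (intro bounded_linear_Pair bounded_linear_zero bounded_linear_fst
        bounded_linear_compose[OF bounded_linear_scaleR_right bounded_linear_snd])+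
  have sq: "Ck_on k S (\<lambda>p. snd p \<bullet> snd p)"
    by (intro Ck_on_bilinear[OF S bounded_bilinear_inner] Ck_on_bounded_linear bounded_linear_snd)
  have "Ck_on k S (\<lambda>p. 1 + (- 1) * (snd p \<bullet> snd p))"
    by (intro Ck_on_add S Ck_on_const Ck_on_bilinear[OF S bounded_bilinear_mult] sq)
  then have m: "Ck_on k S (\<lambda>p. 1 - snd p \<bullet> snd p)" by simp
  have "1 + snd p \<bullet> snd p \<noteq> 0" for p :: "real \<times> 'a"
    using inner_ge_zero[of "snd p"] by linarith
  then show ?thesis unfolding stereographic_inverse_def
    by (intro Ck_on_add Ck_on_bilinear[OF S bounded_bilinear_scaleR] Ck_on_inverse
        Ck_on_bounded_linear[OF lin(1)] Ck_on_bounded_linear[OF lin(2)] Ck_on_const S sq m)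
qed

lemma Ck_on_stereographic:
  assumes "open S" "\<And>p. p \<in> S \<Longrightarrow> snd p \<bullet> u \<noteq> - 1"
  shows "Ck_on k S (stereographic u)"
proof -
  have lin: "bounded_linear (\<lambda>p::real \<times> 'a. (fst p, 0::'a))" "bounded_linear (\<lambda>p::real \<times> 'a. (0::real, snd p))"
    by (intro bounded_linear_Pair bounded_linear_zero bounded_linear_fst bounded_linear_snd)+
  have sq: "Ck_on k S (\<lambda>p. snd p \<bullet> u)"
    by (intro Ck_on_bilinear[OF assms(1) bounded_bilinear_inner] Ck_on_bounded_linear bounded_linear_snd Ck_on_const)
  have "Ck_on k S (\<lambda>p. (- 1) * (snd p \<bullet> u))"
    by (intro assms(1) Ck_on_const Ck_on_bilinear[OF assms(1) bounded_bilinear_mult] sq)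
  then have m: "Ck_on k S (\<lambda>p. - (snd p \<bullet> u))" by simp
  have "1 + snd p \<bullet> u \<noteq> 0" if "p \<in> S" for p using assms(2)[OF that] by linarith
  then show ?thesis unfolding stereographic_def
    by (intro Ck_on_add Ck_on_bilinear[OF assms(1) bounded_bilinear_scaleR] Ck_on_inverse
        Ck_on_bounded_linear[OF lin(1)] Ck_on_bounded_linear[OF lin(2)] Ck_on_const assms(1) sq m)
qed

lemma inverse_two_over_cancel: "(x::real) \<noteq> 0 \<Longrightarrow> inverse (2 / x) * (2 / x) = 1"
  by simp

lemma stereographic_inverse_properties:
  fixes u :: "'b::real_inner"
  assumes u: "norm u = 1" and p: "snd p \<bullet> u = 0"
  shows "stereographic u (stereographic_inverse u p) = p"
    and "norm (snd (stereographic_inverse u p)) = 1"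
    and "snd (stereographic_inverse u p) \<bullet> u \<noteq> - 1"
    and "fst (stereographic_inverse u p) = fst p"
proof -
  obtain s w where pw: "p = (s, w)" by (cases p)
  have uu: "u \<bullet> u = 1" using u by (simp add: dot_square_norm)
  have wu: "w \<bullet> u = 0" "u \<bullet> w = 0" using p pw by (auto simp: inner_commute)
  define q where "q = w \<bullet> w"
  have q: "q \<ge> 0" "1 + q \<noteq> 0" "1 + q > 0" using inner_ge_zero[of w] unfolding q_def by linarith+
  define v where "v = inverse (1 + q) *\<^sub>R (2 *\<^sub>R w + (1 - q) *\<^sub>R u)"
  have h: "stereographic_inverse u p = (s, v)"
    by (simp add: stereographic_inverse_def pw v_def q_def)
  have vu: "v \<bullet> u = (1 - q) / (1 + q)"
    by (simp add: v_def inner_add_left wu uu divide_inverse)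
  have vu1: "1 + v \<bullet> u = 2 / (1 + q)" unfolding vu using q by (simp add: field_simps)
  show "fst (stereographic_inverse u p) = fst p" unfolding h by (simp add: pw)
  show ne: "snd (stereographic_inverse u p) \<bullet> u \<noteq> - 1" using vu1 q by (auto simp: h)
  have "v \<bullet> v = (inverse (1 + q))\<^sup>2 * (4 * q + (1 - q)\<^sup>2)"
    by (simp add: v_def inner_add_left inner_add_right wu uu q_def[symmetric] power2_eq_square algebra_simps)
  also have "4 * q + (1 - q)\<^sup>2 = (1 + q)\<^sup>2" by (simp add: power2_eq_square algebra_simps)
  finally have "v \<bullet> v = 1" using q by (simp flip: power_mult_distrib)
  then show "norm (snd (stereographic_inverse u p)) = 1" by (simp add: h norm_eq_sqrt_inner)
  have "v - (v \<bullet> u) *\<^sub>R u = (2 / (1 + q)) *\<^sub>R w"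
  proof -
    have "v = (2 / (1 + q)) *\<^sub>R w + ((1 - q) / (1 + q)) *\<^sub>R u"
      by (simp add: v_def scaleR_add_right divide_inverse mult.commute)
    with vu show ?thesis by simp
  qed
  then have "inverse (1 + v \<bullet> u) *\<^sub>R (v - (v \<bullet> u) *\<^sub>R u) = w"
    using inverse_two_over_cancel[OF q(2)] by (simp only: vu1 scaleR_scaleR scaleR_one)
  then show "stereographic u (stereographic_inverse u p) = p"
    unfolding h by (simp add: stereographic_def pw)
qed

lemma stereographic_properties:
  fixes u :: "'b::real_inner"
  assumes u: "norm u = 1" and p: "norm (snd p) = 1" "snd p \<bullet> u \<noteq> - 1"
  shows "stereographic_inverse u (stereographic u p) = p"
    and "snd (stereographic u p) \<bullet> u = 0"
    and "fst (stereographic u p) = fst p"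
proof -
  obtain s v where pv: "p = (s, v)" by (cases p)
  have uu: "u \<bullet> u = 1" "v \<bullet> v = 1" using u p pv by (simp_all add: dot_square_norm)
  define c where "c = v \<bullet> u"
  have c: "1 + c \<noteq> 0" "u \<bullet> v = c" using p pv by (auto simp: c_def inner_commute)
  define w where "w = inverse (1 + c) *\<^sub>R (v - c *\<^sub>R u)"
  have k: "stereographic u p = (s, w)" by (simp add: stereographic_def pv w_def c_def)
  show "fst (stereographic u p) = fst p" unfolding k by (simp add: pv)
  show "snd (stereographic u p) \<bullet> u = 0"
    by (simp add: k w_def inner_diff_left uu flip: c_def)
  have "w \<bullet> w = (inverse (1 + c))\<^sup>2 * ((1 - c) * (1 + c))"
    by (simp add: w_def inner_diff_left inner_diff_right uu c c_def[symmetric] power2_eq_square algebra_simps)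
  also have "\<dots> = (1 - c) * inverse (1 + c) * (inverse (1 + c) * (1 + c))"
    by (simp only: power2_eq_square ac_simps)
  finally have ww: "w \<bullet> w = (1 - c) / (1 + c)" using c by (simp add: divide_inverse)
  have ww1: "1 + w \<bullet> w = 2 / (1 + c)" "1 - w \<bullet> w = 2 * c / (1 + c)"
    unfolding ww using c by (simp_all add: field_simps)
  have "2 *\<^sub>R w + (2 * c / (1 + c)) *\<^sub>R u = (2 / (1 + c)) *\<^sub>R v"
    by (simp add: w_def scaleR_diff_right divide_inverse mult.commute)
  then have "inverse (1 + w \<bullet> w) *\<^sub>R (2 *\<^sub>R w + (1 - w \<bullet> w) *\<^sub>R u) = v"
    using inverse_two_over_cancel[OF c(1)] by (simp only: ww1 scaleR_scaleR scaleR_one)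
  then show "stereographic_inverse u (stereographic u p) = p"
    unfolding k by (simp add: stereographic_inverse_def pv)
qed

text \<open>The tangent space of the cylinder \<open>[0, r) \<times> S\<close> at a boundary point contains the radial
  direction. A parametrisation witnessing this is the inverse stereographic projection from the
  antipode; being rational, it is smooth by the closure properties of smooth maps.\<close>

lemma radial_tangent_cylinder:
  fixes u :: "'b::euclidean_space"
  assumes u: "norm u = 1" and r: "(r::real) > 0"
  shows "(1, 0) \<in> tangent_space ({0..<r} \<times> sphere 0 1) (0, u)"
proof -
  let ?h = "stereographic_inverse u" and ?k = "stereographic u"
  define F :: "(real \<times> 'b) set" where "F = UNIV \<times> {w. w \<bullet> u = 0}"
  define Q :: "(real \<times> 'b) set" where "Q = {-r<..<r} \<times> UNIV"
  define e :: "real \<times> 'b" where "e = (1, 0)"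
  define S where "S = Q \<inter> half_space F e"
  have S: "S = {0..<r} \<times> {w. w \<bullet> u = 0}"
    by (auto simp: S_def Q_def half_space_def F_def e_def)
  have F: "subspace F" by (auto simp: F_def subspace_def inner_add_left zero_prod_def)
  have smooth: "smooth_on X ?h" if "open X" for X
    unfolding smooth_on_def using Ck_on_stereographic_inverse[OF that] by blast
  have hk: "?k (?h p) = p" if "snd p \<bullet> u = 0" for p
    by (rule stereographic_inverse_properties(1)[OF u that])
  define P where "P = {0..<r} \<times> (sphere 0 1 :: 'b set)"
  define R where "R = {p::real \<times> 'b. snd p \<bullet> u \<noteq> - 1}"
  have R: "open R" unfolding R_def by (intro open_Collect_neq continuous_intros)
  have image: "?h ` S = P \<inter> R"
  proof (rule set_eqI, rule iffI)
    fix p assume "p \<in> ?h ` S"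
    then obtain q where "p = ?h q" "snd q \<bullet> u = 0" "0 \<le> fst q" "fst q < r" by (auto simp: S)
    then show "p \<in> P \<inter> R" using stereographic_inverse_properties[OF u, of q]
      by (simp add: P_def R_def mem_Times_iff)
  next
    fix p assume "p \<in> P \<inter> R"
    then have p: "norm (snd p) = 1" "snd p \<bullet> u \<noteq> - 1" "0 \<le> fst p" "fst p < r" by (auto simp: P_def R_def)
    then show "p \<in> ?h ` S"
      using stereographic_properties[OF u p(1,2)] by (intro image_eqI[of _ _ "?k p"]) (auto simp: S mem_Times_iff)
  qed
  have kR: "Ck_on k R ?k" for k by (rule Ck_on_stereographic[OF R]) (simp add: R_def)
  have "continuous_on (?h ` S) ?k" using kR[of 0] image continuous_on_subset by fastforce
  moreover have "continuous_on S ?h" using smooth_on_continuous[OF smooth[OF open_UNIV]] continuous_on_subset by blast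
  ultimately have homeo: "homeomorphism S (?h ` S) ?h (inv_into S ?h)"
    by (intro homeomorphism_inv_into[of S ?h ?k]) (auto simp: S hk)
  have inj: "inj_on (frechet_derivative ?h (at z)) F" if z: "z \<in> S" for z
  proof (rule inj_onI)
    have hz: "?h z \<in> R" using z image by blast
    have der: "(?h has_derivative frechet_derivative ?h (at z)) (at z)"
      by (rule smooth_on_has_derivative[OF smooth[OF open_UNIV]]) simp
    have "?k differentiable (at (?h z))" using kR[of 1] hz by simp
    then have derk: "(?k has_derivative frechet_derivative ?k (at (?h z))) (at (?h z))"
      by (simp add: frechet_derivative_works)
    have id: "frechet_derivative ?k (at (?h z)) (frechet_derivative ?h (at z) f) = f" if f: "f \<in> F" for f
    proof -
      let ?l = "\<lambda>s::real. z + s *\<^sub>R f"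
      have l: "(?l has_derivative (\<lambda>t. t *\<^sub>R f)) (at 0)" by (auto intro!: derivative_eq_intros)
      have "((\<lambda>s. ?h (?l s)) has_derivative (\<lambda>t. frechet_derivative ?h (at z) (t *\<^sub>R f))) (at 0)"
        by (rule has_derivative_compose[OF l]) (simp add: der)
      then have "((\<lambda>s. ?k (?h (?l s))) has_derivative
          (\<lambda>t. frechet_derivative ?k (at (?h z)) (frechet_derivative ?h (at z) (t *\<^sub>R f)))) (at 0)"
        by (rule has_derivative_compose) (simp add: derk)
      moreover have "(\<lambda>s. ?k (?h (?l s))) = ?l"
        using z f by (intro ext hk) (auto simp: S F_def inner_add_left)
      ultimately have "(\<lambda>t. frechet_derivative ?k (at (?h z)) (frechet_derivative ?h (at z) (t *\<^sub>R f))) = (\<lambda>t. t *\<^sub>R f)"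
        using has_derivative_unique[OF _ l] by simp
      from fun_cong[OF this, of 1] show ?thesis by simp
    qed
    show "f = f'" if "f \<in> F" "f' \<in> F" "frechet_derivative ?h (at z) f = frechet_derivative ?h (at z) f'" for f f'
      using id[OF that(1)] id[OF that(2)] unfolding that(3) by (rule trans[OF sym])
  qed
  have h0: "?h (0, 0) = (0, u)" by (simp add: stereographic_inverse_def)
  have Q: "open Q" unfolding Q_def by (intro open_Times) auto
  have lp: "local_param P (0, u) F e Q ?h (0, 0)"
    unfolding local_param_def
  proof (intro conjI)
    show "openin (top_of_set P) (?h ` (Q \<inter> half_space F e))"
      using image R by (auto simp: S_def openin_open)
    show "\<forall>z\<in>Q \<inter> half_space F e. inj_on (frechet_derivative ?h (at z)) F" using inj by (simp add: S_def)
    show "homeomorphism (Q \<inter> half_space F e) (?h ` (Q \<inter> half_space F e)) ?h (inv_into (Q \<inter> half_space F e) ?h)"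
      using homeo by (simp add: S_def)
    show "(0, 0) \<in> Q \<inter> half_space F e" using r S unfolding S_def[symmetric] by auto
  qed (use F Q h0 smooth in \<open>auto simp: e_def F_def\<close>)
  have l: "((\<lambda>s::real. s *\<^sub>R (1, 0::'b)) has_derivative (\<lambda>t. t *\<^sub>R (1, 0))) (at 0)"
    by (auto intro!: derivative_eq_intros)
  have "(?h has_derivative frechet_derivative ?h (at (0, 0))) (at (0 *\<^sub>R (1, 0)))"
    using smooth_on_has_derivative[OF smooth[OF open_UNIV], of "(0, 0)"] by simp
  from has_derivative_compose[OF l this]
  have "((\<lambda>s::real. ?h (s *\<^sub>R (1, 0))) has_derivative (\<lambda>t. frechet_derivative ?h (at (0, 0)) (t *\<^sub>R (1, 0)))) (at 0)" .
  moreover have "(\<lambda>s::real. ?h (s *\<^sub>R (1, 0))) = (\<lambda>s. (s, u))" by (simp add: stereographic_inverse_def)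
  moreover have "((\<lambda>s::real. (s, u)) has_derivative (\<lambda>t. (t, 0))) (at 0)"
    by (auto intro!: derivative_eq_intros)
  ultimately have "(\<lambda>t::real. frechet_derivative ?h (at (0, 0)) (t *\<^sub>R (1, 0))) = (\<lambda>t. (t, 0))"
    using has_derivative_unique by simp
  from fun_cong[OF this, of 1] have "frechet_derivative ?h (at (0, 0)) (1, 0) = (1, 0)" by simp
  moreover have "(1, 0) \<in> F" by (simp add: F_def)
  ultimately have "(1, 0) \<in> frechet_derivative ?h (at (0, 0)) ` F" by force
  with lp show ?thesis unfolding tangent_space_def P_def by blast
qed

section \<open>Paths in a set with a conic point\<close>

text \<open>A compactness principle: a monotone family of properties that holds locally with some
  constant holds globally with one constant.\<close>

lemma compact_uniform_constant:
  fixes P :: "real \<Rightarrow> 'a::topological_space \<Rightarrow> bool"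
  assumes K: "compact K" and mono: "\<And>C C' x. P C x \<Longrightarrow> C \<le> C' \<Longrightarrow> P C' x"
    and loc: "\<And>x. x \<in> K \<Longrightarrow> \<exists>C U. open U \<and> x \<in> U \<and> (\<forall>y\<in>K \<inter> U. P C y)"
  shows "\<exists>C. \<forall>x\<in>K. P C x"
proof -
  obtain C U where CU: "\<And>x. x \<in> K \<Longrightarrow> open (U x) \<and> x \<in> U x \<and> (\<forall>y\<in>K \<inter> U x. P (C x) y)"
    using loc by metis
  obtain D where D: "D \<subseteq> K" "finite D" "K \<subseteq> (\<Union>x\<in>D. U x)"
    using compactE_image[OF K, of K U] CU by blast
  have "P (Max (insert 0 (C ` D))) y" if y: "y \<in> K" for y
  proof -
    obtain x where x: "x \<in> D" "y \<in> U x" using D(3) y by blast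
    then have "P (C x) y" using CU[of x] D(1) y by blast
    moreover have "C x \<le> Max (insert 0 (C ` D))" using D(2) x(1) by (intro Max_ge) auto
    ultimately show ?thesis by (rule mono)
  qed
  then show ?thesis by blast
qed

text \<open>A variant for neighbourhoods of the zero set of \<open>f\<close>, later the boundary of a strict transform. It is
  the principle above for the property \<open>f x * C < 1 \<longrightarrow> P C x\<close>, which holds for trivial reasons near
  a point with \<open>f x > 0\<close> when \<open>C\<close> is large.\<close>

lemma compact_uniform_near_zero_set:
  fixes P :: "real \<Rightarrow> 'a::topological_space \<Rightarrow> bool" and f :: "'a \<Rightarrow> real"
  assumes K: "compact K" and mono: "\<And>C C' x. P C x \<Longrightarrow> C \<le> C' \<Longrightarrow> P C' x"
    and f: "continuous_on UNIV f" "\<And>x. x \<in> K \<Longrightarrow> f x \<ge> 0"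
    and loc: "\<And>x. x \<in> K \<Longrightarrow> f x = 0 \<Longrightarrow> \<exists>C U. open U \<and> x \<in> U \<and> (\<forall>y\<in>K \<inter> U. P C y)"
  obtains C s where "C > 0" "s > 0" "\<And>x. x \<in> K \<Longrightarrow> f x < s \<Longrightarrow> P C x"
proof -
  have "\<exists>C. \<forall>x\<in>K. C > 0 \<and> (f x * C < 1 \<longrightarrow> P C x)"
  proof (rule compact_uniform_constant[OF K])
    show "C' > 0 \<and> (f x * C' < 1 \<longrightarrow> P C' x)" if "C > 0 \<and> (f x * C < 1 \<longrightarrow> P C x)" "C \<le> C'" for C C' x
    proof (cases "f x \<ge> 0")
      case True
      then have "f x * C \<le> f x * C'" using that(2) by (rule mult_left_mono[rotated])
      then show ?thesis using that mono[of C x C'] by auto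
    next
      case False
      then have "f x * C < 1" using that(1) mult_neg_pos[of "f x" C] by linarith
      then show ?thesis using that mono[of C x C'] by auto
    qed
    fix x assume x: "x \<in> K"
    show "\<exists>C U. open U \<and> x \<in> U \<and> (\<forall>y\<in>K \<inter> U. C > 0 \<and> (f y * C < 1 \<longrightarrow> P C y))"
    proof (cases "f x = 0")
      case True
      then obtain C U where U: "open U" "x \<in> U" "\<forall>y\<in>K \<inter> U. P C y" using loc[OF x] by blast
      show ?thesis
        using U mono[of C _ "max C 1"] by (intro exI[of _ "max C 1"] exI[of _ U]) auto
    next
      case False
      then have "f x > 0" using f(2)[OF x] by simp
      then show ?thesis using open_Collect_less[OF continuous_on_const f(1), of "f x / 2"]
        by (intro exI[of _ "2 / f x"] exI[of _ "{y. f x / 2 < f y}"]) (auto simp: field_simps)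
    qed
  qed
  then obtain C where C: "\<And>x. x \<in> K \<Longrightarrow> C > 0 \<and> (f x * C < 1 \<longrightarrow> P C x)" by blast
  show ?thesis
  proof (cases "K = {}")
    case True
    then show ?thesis using that[of 1 1] by simp
  next
    case False
    then have "C > 0" using C by blast
    with C show ?thesis by (intro that[of C "1 / C"]) (auto simp: field_simps)
  qed
qed

definition lipschitz_joined :: "'a::metric_space set \<Rightarrow> real \<Rightarrow> 'a \<Rightarrow> 'a \<Rightarrow> bool" where
  "lipschitz_joined X K x y \<longleftrightarrow> (\<exists>\<gamma>::real \<Rightarrow> 'a. K-lipschitz_on {0..1} \<gamma> \<and> \<gamma> ` {0..1} \<subseteq> X \<and> \<gamma> 0 = x \<and> \<gamma> 1 = y)"

lemma lipschitz_joined_mono: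
  "lipschitz_joined X K x y \<Longrightarrow> K \<le> K' \<Longrightarrow> lipschitz_joined X K' x y"
  unfolding lipschitz_joined_def by (metis lipschitz_on_mono order_refl)

lemma lipschitz_joined_refl: "x \<in> X \<Longrightarrow> K \<ge> 0 \<Longrightarrow> lipschitz_joined X K x x"
  unfolding lipschitz_joined_def by (intro exI[of _ "\<lambda>_. x"]) (auto simp: lipschitz_on_def)

lemma lipschitz_joined_sym:
  fixes x :: "'a::metric_space"
  assumes "lipschitz_joined X K x y"
  shows "lipschitz_joined X K y x"
proof -
  obtain \<gamma> :: "real \<Rightarrow> 'a" where g: "K-lipschitz_on {0..1} \<gamma>" "\<gamma> ` {0..1} \<subseteq> X" "\<gamma> 0 = x" "\<gamma> 1 = y"
    using assms unfolding lipschitz_joined_def by blast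
  have "K-lipschitz_on {0..1} (\<lambda>t::real. \<gamma> (1 - t))"
  proof (rule lipschitz_onI)
    show "dist (\<gamma> (1 - s)) (\<gamma> (1 - t)) \<le> K * dist s t" if "s \<in> {0..1}" "t \<in> {0..1}" for s t
      using lipschitz_onD[OF g(1), of "1 - s" "1 - t"] that by (simp add: dist_real_def abs_minus_commute)
  qed (rule lipschitz_on_nonneg[OF g(1)])
  then show ?thesis using g unfolding lipschitz_joined_def
    by (intro exI[of _ "\<lambda>t. \<gamma> (1 - t)"]) auto
qed

lemma lipschitz_joined_trans:
  fixes x :: "'a::metric_space"
  assumes "lipschitz_joined X K x y" "lipschitz_joined X K y z"
  shows "lipschitz_joined X (2 * K) x z"
proof -
  obtain \<gamma>1 \<gamma>2 :: "real \<Rightarrow> 'a" where g: "K-lipschitz_on {0..1} \<gamma>1" "\<gamma>1 ` {0..1} \<subseteq> X" "\<gamma>1 0 = x" "\<gamma>1 1 = y"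
    "K-lipschitz_on {0..1} \<gamma>2" "\<gamma>2 ` {0..1} \<subseteq> X" "\<gamma>2 0 = y" "\<gamma>2 1 = z"
    using assms unfolding lipschitz_joined_def by blast
  let ?\<gamma> = "\<lambda>t::real. if t \<le> 1/2 then \<gamma>1 (2 * t) else \<gamma>2 (2 * t - 1)"
  have 1: "(2 * K)-lipschitz_on {0..1/2} (\<lambda>t. \<gamma>1 (2 * t))"
  proof (rule lipschitz_onI)
    show "dist (\<gamma>1 (2 * s)) (\<gamma>1 (2 * t)) \<le> 2 * K * dist s t" if "s \<in> {0..1/2}" "t \<in> {0..1/2}" for s t
    proof -
      have "dist (2 * s) (2 * t) = 2 * dist s t" by (simp add: dist_real_def abs_if)
      then show ?thesis using lipschitz_onD[OF g(1), of "2 * s" "2 * t"] that by simp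
    qed
  qed (use lipschitz_on_nonneg[OF g(1)] in simp)
  have 2: "(2 * K)-lipschitz_on {1/2..1} (\<lambda>t. \<gamma>2 (2 * t - 1))"
  proof (rule lipschitz_onI)
    show "dist (\<gamma>2 (2 * s - 1)) (\<gamma>2 (2 * t - 1)) \<le> 2 * K * dist s t" if "s \<in> {1/2..1}" "t \<in> {1/2..1}" for s t
    proof -
      have "dist (2 * s - 1) (2 * t - 1) = 2 * dist s t" by (simp add: dist_real_def abs_if)
      then show ?thesis using lipschitz_onD[OF g(5), of "2 * s - 1" "2 * t - 1"] that by simp
    qed
  qed (use lipschitz_on_nonneg[OF g(1)] in simp)
  have "(2 * K)-lipschitz_on {0..1} ?\<gamma>" using g by (intro lipschitz_on_concat[OF 1 2]) simp
  moreover have "?\<gamma> ` {0..1} \<subseteq> X" using g(2,6) by (auto simp: image_subset_iff)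
  ultimately show ?thesis using g unfolding lipschitz_joined_def by (intro exI[of _ ?\<gamma>]) auto
qed

lemma dist_blowup_map: "dist (blowup_map a p) (blowup_map a q) =
    norm (fst p *\<^sub>R snd p - fst q *\<^sub>R snd q)"
  by (simp add: blowup_map_def case_prod_beta dist_norm)

lemma dist_blowup_centre: "0 \<le> fst p \<Longrightarrow> norm (snd p) = 1 \<Longrightarrow> dist (blowup_map a p) a = fst p"
  by (simp add: blowup_map_def case_prod_beta dist_norm)

text \<open>In a boundary chart of the strict transform, straight segments are efficient for the pulled back
  distance. As they stay in the half-space, they blow down to efficient paths in the cone; and
  the projection to the boundary of the half-space leads every point to the cone point.\<close>

lemma strict_transform_local_paths:
  fixes N :: "(real \<times> 'b::euclidean_space) set"
  assumes cyl: "N \<subseteq> {0..} \<times> sphere 0 1" and lp: "local_param N q F e Q h y" and q: "fst q = 0"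
    and bdN: "\<And>p. p \<in> manifold_boundary N \<Longrightarrow> fst p = 0"
    and f0: "f0 \<in> F" "fst (frechet_derivative h (at y) f0) \<noteq> 0"
  obtains U C where "open U" "q \<in> U" "C > 0"
    "\<And>p p'. p \<in> N \<inter> U \<Longrightarrow> p' \<in> N \<inter> U \<Longrightarrow>
       lipschitz_joined (blowup_map a ` N) (C * dist (blowup_map a p) (blowup_map a p'))
         (blowup_map a p) (blowup_map a p')"
    "\<And>p. p \<in> N \<inter> U \<Longrightarrow> lipschitz_joined (blowup_map a ` N) (C * fst p) (blowup_map a p) a"
proof -
  have F: "subspace F" "e \<in> F" and Q: "open Q" "y \<in> Q" "y \<in> half_space F e" "h y = q"
    and h: "smooth_on Q h" and opn: "openin (top_of_set N) (h ` (Q \<inter> half_space F e))"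
    and homeo: "homeomorphism (Q \<inter> half_space F e) (h ` (Q \<inter> half_space F e)) h
       (inv_into (Q \<inter> half_space F e) h)"
    and inj: "\<And>z. z \<in> Q \<inter> half_space F e \<Longrightarrow> inj_on (frechet_derivative h (at z)) F"
    using lp unfolding local_param_def by auto
  have imN: "h z \<in> N" if "z \<in> Q \<inter> half_space F e" for z
    using openin_imp_subset[OF opn] that by blast
  have cylh: "fst (h z) \<ge> 0 \<and> norm (snd (h z)) = 1" if "z \<in> Q \<inter> half_space F e" for z
    using subsetD[OF cyl imN[OF that]] by (simp add: mem_Times_iff)
  \<comment> \<open>The point \<open>y\<close> lies on the boundary of the half-space: otherwise the radius would have an interior
    minimum at \<open>y\<close> and hence a vanishing derivative.\<close>
  have e0: "e \<noteq> 0 \<and> y \<bullet> e = 0"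
  proof (rule ccontr)
    assume neg: "\<not> (e \<noteq> 0 \<and> y \<bullet> e = 0)"
    obtain d where d: "d > 0" "\<And>s. \<bar>s\<bar> < d \<Longrightarrow> y + s *\<^sub>R f0 \<in> Q"
      using open_line_nbhd[OF Q(1,2)] by blast
    have "\<exists>d'>0. \<forall>s. \<bar>s\<bar> < d' \<longrightarrow> (y + s *\<^sub>R f0) \<bullet> e \<ge> 0"
    proof (cases "e = 0")
      case False
      then have "y \<bullet> e > 0" using neg Q(3) by (auto simp: half_space_def less_le)
      moreover have "open {x. x \<bullet> e > 0}" by (intro open_Collect_less continuous_intros)
      ultimately obtain d' where "d' > 0" "\<And>s. \<bar>s\<bar> < d' \<Longrightarrow> y + s *\<^sub>R f0 \<in> {x. x \<bullet> e > 0}"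
        using open_line_nbhd[of "{x. x \<bullet> e > 0}" y f0] by blast
      then show ?thesis by (intro exI[of _ d']) (auto intro: less_imp_le)
    qed (auto intro: exI[of _ 1])
    then obtain d' where d': "d' > 0" "\<And>s. \<bar>s\<bar> < d' \<Longrightarrow> (y + s *\<^sub>R f0) \<bullet> e \<ge> 0" by blast
    have "fst (frechet_derivative h (at y) f0) = 0"
    proof (rule DERIV_local_min)
      show "((\<lambda>s. fst (h (y + s *\<^sub>R f0))) has_real_derivative fst (frechet_derivative h (at y) f0)) (at 0)"
        using smooth_on_line_derivative[OF h, of y 0 f0] Q(2) by simp
      show "0 < min d d'" using d d' by simp
      have yF: "y \<in> F" using Q(3) by (simp add: half_space_def)
      have "fst (h (y + s *\<^sub>R f0)) \<ge> 0" if "\<bar>s\<bar> < min d d'" for s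
        using cylh[of "y + s *\<^sub>R f0"] d(2)[of s] d'(2)[of s] that F f0(1) yF
        by (auto simp: half_space_def subspace_add subspace_scale)
      then show "\<forall>s. \<bar>0 - s\<bar> < min d d' \<longrightarrow> fst (h (y + 0 *\<^sub>R f0)) \<le> fst (h (y + s *\<^sub>R f0))"
        using Q(4) q by auto
    qed
    with f0(2) show False by simp
  qed
  define e' where "e' = e /\<^sub>R norm e"
  have e': "norm e' = 1" "e' \<in> F" "y \<bullet> e' = 0" using e0 F by (auto simp: e'_def subspace_scale)
  have half: "half_space F e' = half_space F e"
    using e0 by (auto simp: half_space_def e'_def zero_le_mult_iff)
  have bd: "fst (h z) = 0" if z: "z \<in> Q \<inter> half_space F e'" "z \<bullet> e' = 0" for z
  proof -
    have "z \<bullet> e = 0" using z(2) e0 by (simp add: e'_def)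
    moreover have "local_param N (h z) F e Q h z" using lp z(1) unfolding local_param_def half by auto
    ultimately have "h z \<in> manifold_boundary N"
      using imN z(1) e0 unfolding manifold_boundary_def half by blast
    then show ?thesis by (rule bdN)
  qed
  have yF: "y \<in> F" using Q(3) by (simp add: half_space_def)
  have injy: "inj_on (frechet_derivative h (at y)) F" using inj Q(2,3) by blast
  have cylh': "fst (h z) \<ge> 0 \<and> norm (snd (h z)) = 1" if "z \<in> Q \<inter> half_space F e'" for z
    using cylh that half by simp
  obtain \<delta> C where \<delta>: "\<delta> > 0" "C > 0" "ball y \<delta> \<subseteq> Q"
    and est: "\<And>z z'. z \<in> ball y \<delta> \<inter> half_space F e' \<Longrightarrow> z' \<in> ball y \<delta> \<inter> half_space F e' \<Longrightarrow>
       norm (blowup_map a (h z) - blowup_map a (h z')) \<le> C * cone_gauge e' z z' \<and>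
       cone_gauge e' z z' \<le> C * norm (blowup_map a (h z) - blowup_map a (h z'))"
    by (rule cone_chart_estimates[OF F(1) e'(2,1) Q(1,2) yF e'(3) h injy _ _ f0, where centre = a])
      (rule cylh', assumption, rule bd, assumption, assumption, blast)
  let ?B = "ball y \<delta> \<inter> half_space F e'"
  have convB: "convex ?B" using half_space_convex[OF F(1)] by (intro convex_Int) auto
  have BQ: "?B \<subseteq> Q \<inter> half_space F e" using \<delta>(3) half by auto
  have segment: "lipschitz_joined (blowup_map a ` N)
      (C * C * dist (blowup_map a (h z)) (blowup_map a (h z'))) (blowup_map a (h z)) (blowup_map a (h z'))"
    if z: "z \<in> ?B" "z' \<in> ?B" for z z'
  proof -
    let ?l = "\<lambda>s. z + s *\<^sub>R (z' - z)"
    have l: "?l s \<in> ?B" if "s \<in> {0..1}" for s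
      using convexD_alt[OF convB z, of s] that by (simp add: algebra_simps)
    have m: "cone_gauge e' (?l s) (?l t) \<le> \<bar>s - t\<bar> * cone_gauge e' z z'" if "s \<in> {0..1}" "t \<in> {0..1}" for s t
    proof -
      have d: "?l s - ?l t = (s - t) *\<^sub>R (z' - z)" by (simp add: algebra_simps)
      have "?l r \<bullet> e' \<le> max (z \<bullet> e') (z' \<bullet> e')" if "r \<in> {0..1}" for r
      proof -
        have "?l r \<bullet> e' = (1 - r) * (z \<bullet> e') + r * (z' \<bullet> e')"
          by (simp add: inner_add_left inner_diff_left algebra_simps)
        also have "\<dots> \<le> max (z \<bullet> e') (z' \<bullet> e')" using that by (intro convex_bound_le) auto
        finally show ?thesis .
      qed
      then have "max (?l s \<bullet> e') (?l t \<bullet> e') \<le> max (z \<bullet> e') (z' \<bullet> e')"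
        using that by (intro max.boundedI) blast+
      then have "max (?l s \<bullet> e') (?l t \<bullet> e') * (\<bar>s - t\<bar> * norm (z - z')) \<le>
          max (z \<bullet> e') (z' \<bullet> e') * (\<bar>s - t\<bar> * norm (z - z'))"
        by (intro mult_right_mono) auto
      also have "\<dots> = \<bar>s - t\<bar> * (max (z \<bullet> e') (z' \<bullet> e') * norm (z - z'))" by (rule mult.left_commute)
      finally have T: "max (?l s \<bullet> e') (?l t \<bullet> e') * (\<bar>s - t\<bar> * norm (z - z')) \<le>
          \<bar>s - t\<bar> * (max (z \<bullet> e') (z' \<bullet> e') * norm (z - z'))" .
      have A: "\<bar>((s - t) *\<^sub>R (z' - z)) \<bullet> e'\<bar> = \<bar>s - t\<bar> * \<bar>(z - z') \<bullet> e'\<bar>"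
        by (simp only: inner_scaleR_left abs_mult) (simp add: inner_diff_left abs_minus_commute)
      have B: "norm ((s - t) *\<^sub>R (z' - z)) = \<bar>s - t\<bar> * norm (z - z')"
        by (simp add: norm_minus_commute)
      show ?thesis unfolding cone_gauge_def d A B distrib_left by (rule add_left_mono[OF T])
    qed
    have "(C * C * dist (blowup_map a (h z)) (blowup_map a (h z')))-lipschitz_on {0..1}
        (\<lambda>s. blowup_map a (h (?l s)))"
    proof (rule lipschitz_onI)
      fix s t :: real assume st: "s \<in> {0..1}" "t \<in> {0..1}"
      have "dist (blowup_map a (h (?l s))) (blowup_map a (h (?l t))) \<le> C * cone_gauge e' (?l s) (?l t)"
        using est[OF l[OF st(1)] l[OF st(2)]] by (simp add: dist_norm)
      also have "\<dots> \<le> C * (\<bar>s - t\<bar> * cone_gauge e' z z')"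
        using m[OF st] \<delta>(2) by (intro mult_left_mono) auto
      also have "\<dots> \<le> C * (\<bar>s - t\<bar> * (C * dist (blowup_map a (h z)) (blowup_map a (h z'))))"
        using est[OF z] \<delta>(2) by (intro mult_left_mono) (auto simp: dist_norm)
      finally show "dist (blowup_map a (h (?l s))) (blowup_map a (h (?l t)))
          \<le> C * C * dist (blowup_map a (h z)) (blowup_map a (h z')) * dist s t"
        by (simp add: dist_real_def mult.commute mult.left_commute)
    qed (use \<delta>(2) in auto)
    moreover have "(\<lambda>s. blowup_map a (h (?l s))) ` {0..1} \<subseteq> blowup_map a ` N"
      using l imN BQ by blast
    ultimately show ?thesis unfolding lipschitz_joined_def by (intro exI[of _ "\<lambda>s. blowup_map a (h (?l s))"]) auto
  qed
  have "openin (top_of_set (Q \<inter> half_space F e)) ?B"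
    using \<delta>(3) half by (auto simp: openin_open intro!: exI[of _ "ball y \<delta>"])
  then have "openin (top_of_set (h ` (Q \<inter> half_space F e))) (h ` ?B)"
    by (rule homeomorphism_imp_open_map[OF homeo])
  then have "openin (top_of_set N) (h ` ?B)" using opn by (rule openin_trans)
  then obtain U where U: "open U" "h ` ?B = N \<inter> U" by (auto simp: openin_open)
  have yB: "y \<in> ?B" using Q(3) \<delta>(1) half by auto
  show ?thesis
  proof (rule that[OF U(1)])
    show "q \<in> U" using U(2) yB Q(4) by blast
    show "C * C > 0" using \<delta>(2) by simp
    show "lipschitz_joined (blowup_map a ` N) (C * C * dist (blowup_map a p) (blowup_map a p'))
         (blowup_map a p) (blowup_map a p')" if "p \<in> N \<inter> U" "p' \<in> N \<inter> U" for p p'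
      using that segment unfolding U(2)[symmetric] by blast
    show "lipschitz_joined (blowup_map a ` N) (C * C * fst p) (blowup_map a p) a" if "p \<in> N \<inter> U" for p
    proof -
      have "p \<in> h ` ?B" using that by (simp only: U(2))
      then obtain z where z: "z \<in> ?B" "p = h z" by (rule imageE)
      let ?z = "z - (z \<bullet> e') *\<^sub>R e'"
      have z0: "?z \<in> ?B" "?z \<bullet> e' = 0" using half_space_foot[OF F(1) e'(2,1,3) z(1)] by auto
      have "?z \<in> Q \<inter> half_space F e'" using z0(1) BQ by blast
      then have "fst (h ?z) = 0" by (rule bd[OF _ z0(2)])
      then have "blowup_map a (h ?z) = a" by (simp add: blowup_map_def case_prod_beta)
      moreover have "dist (blowup_map a p) a = fst p"
        using cylh[OF subsetD[OF BQ z(1)]] z(2) by (intro dist_blowup_centre) auto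
      ultimately show ?thesis using segment[OF z(1) z0(1)] z(2) by simp
    qed
  qed
qed

text \<open>The radius vanishes along every parametrisation of a set in the boundary of the cylinder, hence so does
  its differential. If the parameter domain is a half-space, this is clear only for directions pointing
  into it, and follows for the others by linearity.\<close>

lemma tangent_space_zero_boundary:
  fixes D :: "(real \<times> 'b::euclidean_space) set"
  assumes D: "\<And>p. p \<in> D \<Longrightarrow> fst p = 0" and v: "v \<in> tangent_space D q"
  shows "fst v = 0"
proof -
  obtain F e Q h y f where lp: "local_param D q F e Q h y" and f: "f \<in> F" "v = frechet_derivative h (at y) f"
    using v unfolding tangent_space_def by blast
  have F: "subspace F" "e \<in> F" and Q: "open Q" "y \<in> Q" "y \<in> half_space F e"
    and h: "smooth_on Q h" and opn: "openin (top_of_set D) (h ` (Q \<inter> half_space F e))"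
    using lp unfolding local_param_def by auto
  have h0: "fst (h z) = 0" if "z \<in> Q \<inter> half_space F e" for z
    using openin_imp_subset[OF opn] that D by blast
  have y: "y \<in> F" "0 \<le> y \<bullet> e" using Q(3) by (auto simp: half_space_def)
  \<comment> \<open>At least one of the two rays from \<open>y\<close> in the directions \<open>f\<close> and \<open>- f\<close> starts inside the half-space.\<close>
  have zero: "fst (frechet_derivative h (at y) g) = 0" if g: "g \<in> F" "g \<bullet> e \<ge> 0" for g
  proof -
    obtain d where d: "d > 0" "\<And>s. \<bar>s\<bar> < d \<Longrightarrow> y + s *\<^sub>R g \<in> Q"
      using open_line_nbhd[OF Q(1,2)] by blast
    let ?\<phi> = "\<lambda>s::real. fst (h (y + s *\<^sub>R g))"
    have der: "(?\<phi> has_real_derivative fst (frechet_derivative h (at y) g)) (at 0)"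
      using smooth_on_line_derivative[OF h, of y 0 g] Q(2) by simp
    have \<phi>: "?\<phi> s = 0" if "0 \<le> s" "s < d" for s
      using that d(2)[of s] g y F by (intro h0) (auto simp: half_space_def subspace_add subspace_scale inner_add_left)
    have "\<not> fst (frechet_derivative h (at y) g) < 0"
    proof
      assume "fst (frechet_derivative h (at y) g) < 0"
      from DERIV_neg_dec_right[OF der this] obtain d' where
        "d' > 0" "\<And>s. 0 < s \<Longrightarrow> s < d' \<Longrightarrow> ?\<phi> (0 + s) < ?\<phi> 0" by blast
      then have "0 < min d d' / 2" "min d d' / 2 < d" "min d d' / 2 < d'"
        and "\<And>s. 0 < s \<Longrightarrow> s < d' \<Longrightarrow> ?\<phi> (0 + s) < ?\<phi> 0"
        using d(1) by (auto simp: min_def)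
      from this(4)[OF this(1,3)] \<phi>[of 0] \<phi>[of "min d d' / 2"] this(1,2) d(1) show False by auto
    qed
    moreover have "\<not> fst (frechet_derivative h (at y) g) > 0"
    proof
      assume "fst (frechet_derivative h (at y) g) > 0"
      from DERIV_pos_inc_right[OF der this] obtain d' where
        "d' > 0" "\<And>s. 0 < s \<Longrightarrow> s < d' \<Longrightarrow> ?\<phi> (0 + s) > ?\<phi> 0" by blast
      then have "0 < min d d' / 2" "min d d' / 2 < d" "min d d' / 2 < d'"
        and "\<And>s. 0 < s \<Longrightarrow> s < d' \<Longrightarrow> ?\<phi> (0 + s) > ?\<phi> 0"
        using d(1) by (auto simp: min_def)
      from this(4)[OF this(1,3)] \<phi>[of 0] \<phi>[of "min d d' / 2"] this(1,2) d(1) show False by auto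
    qed
    ultimately show ?thesis by simp
  qed
  have lin: "linear (frechet_derivative h (at y))"
    using has_derivative_linear[OF smooth_on_has_derivative[OF h Q(2)]] .
  show ?thesis
  proof (cases "f \<bullet> e \<ge> 0")
    case True
    then show ?thesis using zero[of f] f by simp
  next
    case False
    then have "fst (frechet_derivative h (at y) (- f)) = 0" using f F by (intro zero) (auto simp: subspace_neg)
    then show ?thesis using f linear_neg[OF lin, of f] by simp
  qed
qed

text \<open>Transversality of the strict transform to the boundary of the cylinder provides a
  parametrisation along which the radius has non-zero differential.\<close>

lemma p_submanifold_transversal_param:
  fixes N :: "(real \<times> 'b::euclidean_space) set"
  assumes p: "p_submanifold ({0..<r} \<times> sphere 0 1) ({0} \<times> sphere 0 1) N" and r: "r > 0"
    and q: "q \<in> N" "fst q = 0"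
  obtains F e Q h y f where "local_param N q F e Q h y" "f \<in> F" "fst (frechet_derivative h (at y) f) \<noteq> 0"
proof -
  let ?P = "{0..<r} \<times> (sphere 0 1 :: 'b set)" and ?dP = "{0} \<times> (sphere 0 1 :: 'b set)"
  have qP: "q \<in> ?P" "q \<in> ?dP" using p q by (auto simp: p_submanifold_def)
  then have q_eq: "q = (0, snd q)" "norm (snd q) = 1" by (auto simp: mem_Times_iff prod_eq_iff)
  have "q \<in> manifold_boundary N" using p q qP by (auto simp: p_submanifold_def)
  then have "{u + v | u v. u \<in> tangent_space N q \<and> v \<in> tangent_space ?dP q} = tangent_space ?P q"
    using p by (auto simp: p_submanifold_def)
  moreover have "(1, 0) \<in> tangent_space ?P q"
    using radial_tangent_cylinder[OF q_eq(2) r] q_eq(1) by simp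
  ultimately obtain u v where uv: "(1, 0) = u + v" "u \<in> tangent_space N q" "v \<in> tangent_space ?dP q"
    by blast
  have "fst v = 0" by (rule tangent_space_zero_boundary[OF _ uv(3)]) auto
  then have "fst u \<noteq> 0" using uv(1) by (metis add.right_neutral fst_add fst_conv zero_neq_one)
  then show ?thesis using uv(2) that unfolding tangent_space_def by blast
qed

text \<open>Near a conic point, two points at nearby angles lie in one boundary chart of the strict
  transform. If their angles are apart, their distance dominates the sum of their radii, and one
  joins them through the cone point. Compactness of the link makes the constants uniform.\<close>

lemma strict_transform_paths:
  fixes N :: "(real \<times> 'b::euclidean_space) set"
  assumes p: "p_submanifold ({0..<r} \<times> sphere 0 1) ({0} \<times> sphere 0 1) N" and r: "r > 0"
    and cl: "closedin (top_of_set ({0..<r} \<times> sphere 0 1)) N"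
  obtains C s where "C > 0" "s > 0"
    "\<And>p p'. p \<in> N \<Longrightarrow> p' \<in> N \<Longrightarrow> fst p < s \<Longrightarrow> fst p' < s \<Longrightarrow>
       lipschitz_joined (blowup_map a ` N) (C * dist (blowup_map a p) (blowup_map a p'))
         (blowup_map a p) (blowup_map a p')"
    "\<And>p. p \<in> N \<Longrightarrow> fst p < s \<Longrightarrow> lipschitz_joined (blowup_map a ` N) (C * fst p) (blowup_map a p) a"
proof -
  let ?J = "lipschitz_joined (blowup_map a ` N)" and ?b = "blowup_map a"
  have cyl: "N \<subseteq> {0..} \<times> sphere 0 1" and NP: "N \<subseteq> {0..<r} \<times> sphere 0 1" using p by (auto simp: p_submanifold_def)
  have N: "fst p \<ge> 0" "norm (snd p) = 1" if "p \<in> N" for p using subsetD[OF cyl that] by (simp_all add: mem_Times_iff)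
  have bdN: "fst p = 0" if "p \<in> manifold_boundary N" for p
    using p that by (auto simp: p_submanifold_def)
  define K where "K = N \<inter> {p. fst p \<le> r / 2}"
  have "compact K"
  proof -
    obtain T where T: "closed T" "N = ({0..<r} \<times> sphere 0 1) \<inter> T" using cl by (auto simp: closedin_closed)
    have "K = ({0..r/2} \<times> sphere 0 1) \<inter> T" using r by (auto simp: K_def T(2))
    then show ?thesis using T(1) by (auto intro!: compact_Int_closed compact_Times)
  qed
  have local: "\<exists>U C. open U \<and> q \<in> U \<and> C > 0 \<and>
      (\<forall>p\<in>N \<inter> U. \<forall>p'\<in>N \<inter> U. ?J (C * dist (?b p) (?b p')) (?b p) (?b p')) \<and>
      (\<forall>p\<in>N \<inter> U. ?J (C * fst p) (?b p) a)" if q: "q \<in> N" "fst q = 0" for q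
  proof -
    obtain F e Q h y f where *: "local_param N q F e Q h y" "f \<in> F" "fst (frechet_derivative h (at y) f) \<noteq> 0"
      by (rule p_submanifold_transversal_param[OF p r q])
    show ?thesis
      by (rule strict_transform_local_paths[OF cyl *(1) q(2) bdN *(2,3), where a = a]) blast+
  qed
  obtain C1 s1 where 1: "C1 > 0" "s1 > 0" "\<And>p. p \<in> K \<Longrightarrow> fst p < s1 \<Longrightarrow> ?J (C1 * fst p) (?b p) a"
  proof (rule compact_uniform_near_zero_set[OF \<open>compact K\<close>, of "\<lambda>C p. ?J (C * \<bar>fst p\<bar>) (?b p) a" fst])
    show "?J (C' * \<bar>fst p\<bar>) (?b p) a" if "?J (C * \<bar>fst p\<bar>) (?b p) a" "C \<le> C'" for C C' p
      using that by (meson lipschitz_joined_mono mult_right_mono abs_ge_zero)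
    show "\<exists>C U. open U \<and> q \<in> U \<and> (\<forall>p\<in>K \<inter> U. ?J (C * \<bar>fst p\<bar>) (?b p) a)" if q: "q \<in> K" "fst q = 0" for q
    proof -
      obtain U C where "open U" "q \<in> U" "\<forall>p\<in>N \<inter> U. ?J (C * fst p) (?b p) a"
        using local[of q] q by (auto simp: K_def)
      then show ?thesis using N by (intro exI[of _ C] exI[of _ U]) (auto simp: K_def)
    qed
  qed (use N in \<open>auto simp: K_def intro: continuous_intros\<close>)
  obtain C2 s2 where 2: "C2 > 0" "s2 > 0"
    "\<And>pp. pp \<in> K \<times> K \<Longrightarrow> max (fst (fst pp)) (fst (snd pp)) < s2 \<Longrightarrow>
       ?J (C2 * dist (?b (fst pp)) (?b (snd pp))) (?b (fst pp)) (?b (snd pp))"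
  proof (rule compact_uniform_near_zero_set[OF compact_Times[OF \<open>compact K\<close> \<open>compact K\<close>],
        of "\<lambda>C pp. ?J (C * dist (?b (fst pp)) (?b (snd pp))) (?b (fst pp)) (?b (snd pp))"
        "\<lambda>pp. max (fst (fst pp)) (fst (snd pp))"])
    show "?J (C' * dist (?b (fst pp)) (?b (snd pp))) (?b (fst pp)) (?b (snd pp))"
      if "?J (C * dist (?b (fst pp)) (?b (snd pp))) (?b (fst pp)) (?b (snd pp))" "C \<le> C'" for C C' pp
      using that by (meson lipschitz_joined_mono mult_right_mono zero_le_dist)
    show "continuous_on UNIV (\<lambda>pp::(real \<times> 'b) \<times> real \<times> 'b. max (fst (fst pp)) (fst (snd pp)))"
      by (intro continuous_intros)
    show "0 \<le> max (fst (fst pp)) (fst (snd pp))" if "pp \<in> K \<times> K" for pp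
      using that N by (auto simp: K_def mem_Times_iff le_max_iff_disj)
    fix qq assume qq: "qq \<in> K \<times> K" "max (fst (fst qq)) (fst (snd qq)) = 0"
    obtain q q' where q: "qq = (q, q')" "q \<in> N" "q' \<in> N" "fst q = 0" "fst q' = 0"
      using qq N by (cases qq) (fastforce simp: K_def max_def split: if_splits)
    obtain U C where U: "open U" "q \<in> U" "C > 0"
      "\<forall>p\<in>N \<inter> U. \<forall>p'\<in>N \<inter> U. ?J (C * dist (?b p) (?b p')) (?b p) (?b p')"
      "\<forall>p\<in>N \<inter> U. ?J (C * fst p) (?b p) a"
      using local[OF q(2,4)] by blast
    obtain U' C' where U': "open U'" "q' \<in> U'" "C' > 0" "\<forall>p\<in>N \<inter> U'. ?J (C' * fst p) (?b p) a"
      using local[OF q(3,5)] by blast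
    show "\<exists>C V. open V \<and> qq \<in> V \<and> (\<forall>pp\<in>K \<times> K \<inter> V.
        ?J (C * dist (?b (fst pp)) (?b (snd pp))) (?b (fst pp)) (?b (snd pp)))"
    proof (cases "q = q'")
      case True
      then show ?thesis using U q(1) by (intro exI[of _ C] exI[of _ "U \<times> U"]) (auto simp: open_Times K_def)
    next
      case False
      define \<eta> where "\<eta> = norm (snd q - snd q') / 2"
      have \<eta>: "\<eta> > 0" using False q by (auto simp: \<eta>_def prod_eq_iff)
      define V where "V = (U \<times> U') \<inter> {pp. \<eta> < norm (snd (fst pp) - snd (snd pp))}"
      define M where "M = max C C'"
      have "open V" unfolding V_def
        by (intro open_Int open_Times U U' open_Collect_less continuous_intros)
      moreover have "qq \<in> V" using U U' \<eta> q(1) by (auto simp: V_def \<eta>_def)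
      moreover have "?J (4 * M / \<eta> * dist (?b p) (?b p')) (?b p) (?b p')"
        if pp: "p \<in> K" "p' \<in> K" "(p, p') \<in> V" for p p'
      proof -
        have pN: "p \<in> N \<inter> U" "p' \<in> N \<inter> U'" "\<eta> < norm (snd p - snd p')" using pp by (auto simp: K_def V_def)
        have pos: "fst p \<ge> 0" "norm (snd p) = 1" "fst p' \<ge> 0" "norm (snd p') = 1" using N pN by auto
        have "?J (M * (fst p + fst p')) (?b p) a"
        proof (rule lipschitz_joined_mono)
          show "?J (C * fst p) (?b p) a" using U(5) pN by blast
          show "C * fst p \<le> M * (fst p + fst p')" using U(3) pos by (intro mult_mono) (auto simp: M_def)
        qed
        moreover have "?J (M * (fst p + fst p')) a (?b p')"
        proof (rule lipschitz_joined_mono[OF lipschitz_joined_sym])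
          show "?J (C' * fst p') (?b p') a" using U'(4) pN by blast
          show "C' * fst p' \<le> M * (fst p + fst p')" using U'(3) pos by (intro mult_mono) (auto simp: M_def)
        qed
        ultimately have "?J (2 * (M * (fst p + fst p'))) (?b p) (?b p')" by (rule lipschitz_joined_trans)
        moreover have "2 * (M * (fst p + fst p')) \<le> 4 * M / \<eta> * dist (?b p) (?b p')"
        proof -
          have "(fst p + fst p') * \<eta> \<le> (fst p + fst p') * norm (snd p - snd p')"
            using pN(3) pos by (intro mult_left_mono) auto
          also have "\<dots> \<le> 2 * dist (?b p) (?b p')"
            unfolding dist_blowup_map by (rule cone_distance_bounds(2)[OF pos(2,4,1,3)])
          finally have "M * ((fst p + fst p') * \<eta>) \<le> M * (2 * dist (?b p) (?b p'))"
            using U(3) by (intro mult_left_mono) (auto simp: M_def)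
          then show ?thesis using \<eta> by (simp add: field_simps)
        qed
        ultimately show ?thesis by (rule lipschitz_joined_mono)
      qed
      ultimately show ?thesis by (intro exI[of _ "4 * M / \<eta>"] exI[of _ V]) auto
    qed
  qed blast
  define C where "C = max C1 C2"
  define s where "s = min (min s1 s2) (r / 2)"
  have inK: "p \<in> K" if "p \<in> N" "fst p < s" for p using that by (auto simp: K_def s_def)
  show ?thesis
  proof (rule that[of C s])
    show "C > 0" "s > 0" using 1 2 r by (auto simp: C_def s_def)
    show "?J (C * dist (?b p) (?b p')) (?b p) (?b p')"
      if "p \<in> N" "p' \<in> N" "fst p < s" "fst p' < s" for p p'
    proof (rule lipschitz_joined_mono)
      show "?J (C2 * dist (?b p) (?b p')) (?b p) (?b p')"
        using 2(3)[of "(p, p')"] inK that by (auto simp: s_def)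
    qed (auto simp: C_def intro: mult_right_mono)
    show "?J (C * fst p) (?b p) a" if "p \<in> N" "fst p < s" for p
    proof (rule lipschitz_joined_mono)
      show "?J (C1 * fst p) (?b p) a" using 1(3)[of p] inK that by (auto simp: s_def)
      show "C1 * fst p \<le> C * fst p" using N(1)[OF that(1)] by (intro mult_right_mono) (simp_all add: C_def)
    qed
  qed
qed

lemma closed_germ_closure:
  fixes X :: "'a::metric_space set"
  assumes "closedin (top_of_set (ball a \<rho>)) (X \<inter> ball a \<rho>)"
  shows "ball a \<rho> \<inter> closure X \<subseteq> X"
proof -
  obtain T where T: "closed T" "X \<inter> ball a \<rho> = ball a \<rho> \<inter> T"
    using assms by (auto simp: closedin_closed)
  have "ball a \<rho> \<inter> X \<subseteq> T" using T(2) by blast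
  then have "closure (ball a \<rho> \<inter> X) \<subseteq> T" using T(1) by (rule closure_minimal)
  then have "ball a \<rho> \<inter> closure X \<subseteq> ball a \<rho> \<inter> T"
    using open_Int_closure_subset[OF open_ball, of a \<rho> X] by blast
  then show ?thesis unfolding T(2)[symmetric] by blast
qed

text \<open>Away from the boundary, the strict transform of a set with closed germ is just its preimage: the
  blow-down is continuous, so the closure adds no points there.\<close>

lemma strict_transform_iff:
  assumes cl: "closedin (top_of_set (ball a \<rho>)) (X \<inter> ball a \<rho>)"
    and p: "norm (snd p) = 1" "0 < fst p" "fst p < r" "fst p < \<rho>"
  shows "p \<in> strict_transform a (X \<inter> ball a r) \<longleftrightarrow> blowup_map a p \<in> X"
proof -
  let ?S = "{p \<in> blowup_space. blowup_map a p \<in> X \<inter> ball a r - {a}}"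
  have st: "strict_transform a (X \<inter> ball a r) = blowup_space \<inter> closure ?S"
    unfolding strict_transform_def closure_of_subtopology euclidean_closure_of
    by (simp add: Int_absorb2 Collect_conj_eq Int_left_absorb)
  have pB: "p \<in> blowup_space" using p by (auto simp: blowup_space_def mem_Times_iff)
  have d: "dist (blowup_map a p) a = fst p" using p by (intro dist_blowup_centre) auto
  show ?thesis
  proof
    assume "p \<in> strict_transform a (X \<inter> ball a r)"
    then have "p \<in> closure ?S" by (simp add: st)
    moreover have "continuous_on UNIV (blowup_map a)"
      unfolding blowup_map_def case_prod_beta by (intro continuous_intros)
    then have "blowup_map a ` closure ?S \<subseteq> closure (blowup_map a ` ?S)"
      by (rule image_closure_subset[OF continuous_on_subset]) (auto intro: closure_subset[THEN subsetD])
    ultimately have "blowup_map a p \<in> closure (blowup_map a ` ?S)" by blast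
    moreover have "blowup_map a ` ?S \<subseteq> X" by auto
    ultimately have "blowup_map a p \<in> closure X" using closure_mono by blast
    moreover have "blowup_map a p \<in> ball a \<rho>" using d p by (simp add: dist_commute)
    ultimately show "blowup_map a p \<in> X" using closed_germ_closure[OF cl] by blast
  next
    assume "blowup_map a p \<in> X"
    then have "p \<in> ?S" using pB d p by (auto simp: dist_commute)
    then have "p \<in> closure ?S" using closure_subset[of ?S] by blast
    then show "p \<in> strict_transform a (X \<inter> ball a r)" using pB st by blast
  qed
qed

text \<open>The estimates in the strict transform descend to the set itself. A path of length at most
  \<open>C \<bar>x - x'\<bar>\<close> starting near \<open>a\<close> stays near \<open>a\<close>, where the blow-down of the strict transform is
  contained in \<open>X\<close>; this is also how the path can be confined to any given ball.\<close>

proposition conic_point_locally_joined: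
  fixes X :: "'b::euclidean_space set"
  assumes "conic_point X a"
  obtains C where "C > 0"
    "\<And>\<epsilon>. \<epsilon> > 0 \<Longrightarrow> \<exists>s>0. \<forall>x\<in>X \<inter> ball a s. \<forall>x'\<in>X \<inter> ball a s.
       lipschitz_joined (X \<inter> ball a \<epsilon>) (C * dist x x') x x'"
proof -
  obtain \<rho> r where \<rho>: "\<rho> > 0" "closedin (top_of_set (ball a \<rho>)) (X \<inter> ball a \<rho>)" and acl: "a \<in> closure X"
    and r: "r > 0"
    "closedin (top_of_set ({0..<r} \<times> sphere 0 1)) (strict_transform a (X \<inter> ball a r) \<inter> ({0..<r} \<times> sphere 0 1))"
    "p_submanifold ({0..<r} \<times> sphere 0 1) ({0} \<times> sphere 0 1)
      (strict_transform a (X \<inter> ball a r) \<inter> ({0..<r} \<times> sphere 0 1))"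
    using assms unfolding conic_point_def Let_def by blast
  define N where "N = strict_transform a (X \<inter> ball a r) \<inter> ({0..<r} \<times> sphere 0 1)"
  let ?b = "blowup_map a"
  obtain C s0 where C: "C > 0" "s0 > 0"
    "\<And>p p'. p \<in> N \<Longrightarrow> p' \<in> N \<Longrightarrow> fst p < s0 \<Longrightarrow> fst p' < s0 \<Longrightarrow>
       lipschitz_joined (?b ` N) (C * dist (?b p) (?b p')) (?b p) (?b p')"
    "\<And>p. p \<in> N \<Longrightarrow> fst p < s0 \<Longrightarrow> lipschitz_joined (?b ` N) (C * fst p) (?b p) a"
    by (rule strict_transform_paths[OF r(3,1,2), where a = a]) (unfold N_def[symmetric], blast)
  have aX: "a \<in> X" using closed_germ_closure[OF \<rho>(2)] acl \<rho>(1) by auto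
  define r0 where "r0 = min r \<rho>"
  have r0: "r0 > 0" using r \<rho> by (simp add: r0_def)
  have NX: "?b p \<in> X" if p: "p \<in> N" "dist (?b p) a < r0" for p
  proof -
    have n: "norm (snd p) = 1" "0 \<le> fst p" using p by (auto simp: N_def mem_Times_iff)
    then have d: "dist (?b p) a = fst p" by (intro dist_blowup_centre)
    show ?thesis
    proof (cases "fst p = 0")
      case True
      then show ?thesis using aX by (simp add: blowup_map_def case_prod_beta)
    next
      case False
      then show ?thesis using strict_transform_iff[OF \<rho>(2) n(1), of r] n d p
        by (auto simp: N_def r0_def)
    qed
  qed
  have polar: "\<exists>p\<in>N. fst p = dist x a \<and> ?b p = x" if x: "x \<in> X" "x \<noteq> a" "dist x a < r0" for x
  proof -
    let ?p = "(dist x a, (x - a) /\<^sub>R dist x a)"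
    have b: "?b ?p = x" using x by (simp add: blowup_map_def)
    have n: "norm (snd ?p) = 1" using x by (simp add: dist_norm)
    then have "?p \<in> strict_transform a (X \<inter> ball a r)"
      using strict_transform_iff[OF \<rho>(2) n, of r] x b by (auto simp: r0_def)
    then have "?p \<in> N" using n x by (auto simp: N_def r0_def)
    with b show ?thesis by (intro bexI[of _ ?p]) auto
  qed
  have join: "lipschitz_joined (insert a (?b ` N)) (C * dist x x') x x'"
    if x: "x \<in> X" "x' \<in> X" "dist x a < min r0 s0" "dist x' a < min r0 s0" for x x'
  proof -
    have sub: "lipschitz_joined (insert a (?b ` N)) K y z" if "lipschitz_joined (?b ` N) K y z" for K y z
      using that unfolding lipschitz_joined_def by blast
    have through: "lipschitz_joined (?b ` N) (C * dist y a) y a"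
      if "y \<in> X" "y \<noteq> a" "dist y a < min r0 s0" for y
      using polar[of y] C(4) that by force
    consider "x = a" "x' = a" | "x = a" "x' \<noteq> a" | "x \<noteq> a" "x' = a" | "x \<noteq> a" "x' \<noteq> a" by blast
    then show ?thesis
    proof cases
      case 1
      then show ?thesis using C(1) by (auto intro!: lipschitz_joined_refl)
    next
      case 2
      then show ?thesis using lipschitz_joined_sym[OF through[of x']] x by (auto intro!: sub simp: dist_commute)
    next
      case 3
      then show ?thesis using through[of x] x by (auto intro!: sub)
    next
      case 4
      obtain p p' where "p \<in> N" "fst p = dist x a" "?b p = x" "p' \<in> N" "fst p' = dist x' a" "?b p' = x'"
        using polar[of x] polar[of x'] 4 x by auto
      then show ?thesis using C(3)[of p p'] x by (auto intro!: sub)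
    qed
  qed
  show ?thesis
  proof (rule that[OF C(1)])
    fix \<epsilon> :: real assume \<epsilon>: "\<epsilon> > 0"
    define s where "s = min (min r0 s0) (min r0 \<epsilon> / (1 + 2 * C))"
    have s: "s > 0" "s \<le> min r0 s0" "s * (1 + 2 * C) \<le> min r0 \<epsilon>"
    proof -
      show "s > 0" "s \<le> min r0 s0" using r0 C \<epsilon> by (auto simp: s_def)
      have "s \<le> min r0 \<epsilon> / (1 + 2 * C)" by (simp add: s_def)
      then show "s * (1 + 2 * C) \<le> min r0 \<epsilon>" using C(1) by (simp add: pos_le_divide_eq)
    qed
    have "lipschitz_joined (X \<inter> ball a \<epsilon>) (C * dist x x') x x'" if x: "x \<in> X \<inter> ball a s" "x' \<in> X \<inter> ball a s" for x x'
    proof -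
      have da: "dist x a < s" "dist x' a < s" using x by (auto simp: dist_commute)
      then obtain \<gamma> :: "real \<Rightarrow> 'b" where g: "(C * dist x x')-lipschitz_on {0..1} \<gamma>" "\<gamma> ` {0..1} \<subseteq> insert a (?b ` N)" "\<gamma> 0 = x" "\<gamma> 1 = x'"
        using join[of x x'] x s(2) unfolding lipschitz_joined_def by auto
      have "\<gamma> t \<in> X \<inter> ball a \<epsilon>" if t: "t \<in> {0..1}" for t
      proof -
        have "dist (\<gamma> t) x \<le> C * dist x x' * dist t 0" using lipschitz_onD[OF g(1) t, of 0] g(3) by simp
        also have "\<dots> \<le> C * dist x x'" using t C(1) by (simp add: mult_left_le)
        also have "\<dots> \<le> C * (2 * s)" using da dist_triangle2[of x x' a] C(1) by (intro mult_left_mono) auto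
        finally have "dist (\<gamma> t) a < s + C * (2 * s)" using dist_triangle[of "\<gamma> t" a x] da by linarith
        also have "\<dots> \<le> min r0 \<epsilon>" using s(3) by (simp add: algebra_simps)
        finally have "dist (\<gamma> t) a < r0" "dist (\<gamma> t) a < \<epsilon>" by auto
        moreover have "\<gamma> t \<in> insert a (?b ` N)" using g(2) t by blast
        ultimately have "\<gamma> t \<in> X" using NX aX by (elim insertE imageE) simp_all
        with \<open>dist (\<gamma> t) a < \<epsilon>\<close> show ?thesis by (simp add: dist_commute)
      qed
      then show ?thesis using g unfolding lipschitz_joined_def by blast
    qed
    then show "\<exists>s>0. \<forall>x\<in>X \<inter> ball a s. \<forall>x'\<in>X \<inter> ball a s. lipschitz_joined (X \<inter> ball a \<epsilon>) (C * dist x x') x x'"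
      using s(1) by blast
  qed
qed

section \<open>Riemannian lengths in charts\<close>

lemma is_chart_facts:
  assumes "is_chart c"
  shows "open (fst c)" "open (snd c ` fst c)" "continuous_on (fst c) (snd c)"
    "continuous_on (snd c ` fst c) (inv_into (fst c) (snd c))" "inj_on (snd c) (fst c)"
    "\<And>x. x \<in> fst c \<Longrightarrow> inv_into (fst c) (snd c) (snd c x) = x"
    "\<And>S. open S \<Longrightarrow> open (snd c ` (fst c \<inter> S))"
    "\<And>T. open T \<Longrightarrow> open {x \<in> fst c. snd c x \<in> T}"
proof -
  have c: "open (fst c)" "open (snd c ` fst c)"
    "homeomorphism (fst c) (snd c ` fst c) (snd c) (inv_into (fst c) (snd c))"
    using assms by (auto simp: is_chart_def split: prod.splits)
  show "open (fst c)" "open (snd c ` fst c)" by fact+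
  show cont: "continuous_on (fst c) (snd c)" "continuous_on (snd c ` fst c) (inv_into (fst c) (snd c))"
    using c(3) by (auto simp: homeomorphism_def)
  show inv: "inv_into (fst c) (snd c) (snd c x) = x" if "x \<in> fst c" for x
    using c(3) that by (auto simp: homeomorphism_def)
  then show "inj_on (snd c) (fst c)" by (metis inj_onI)
  show "open (snd c ` (fst c \<inter> S))" if "open S" for S
  proof -
    have "openin (top_of_set (snd c ` fst c)) (snd c ` (fst c \<inter> S))"
      using that by (intro homeomorphism_imp_open_map[OF c(3)]) (auto simp: openin_open)
    then show ?thesis using c(2) openin_open_trans by blast
  qed
  show "open {x \<in> fst c. snd c x \<in> T}" if "open T" for T
    using continuous_open_preimage[OF cont(1) c(1) that] by (simp add: vimage_def Int_def)
qed

lemma smooth_compatible_transition: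
  assumes "smooth_compatible c d"
  shows "smooth_on (snd c ` (fst c \<inter> fst d)) (transition c d)"
  using assms by (simp add: smooth_compatible_def)

lemma transition_apply: "is_chart c \<Longrightarrow> x \<in> fst c \<Longrightarrow> transition c d (snd c x) = snd d x"
  by (simp add: transition_def is_chart_facts(6))

lemma transition_comp_derivative:
  assumes c: "is_chart c" "is_chart d" and comp: "smooth_compatible c d"
    and \<gamma>: "isCont \<gamma> t" "\<gamma> t \<in> fst c" "\<gamma> t \<in> fst d" and v: "((snd c \<circ> \<gamma>) has_vector_derivative v) (at t)"
  shows "((snd d \<circ> \<gamma>) has_vector_derivative frechet_derivative (transition c d) (at (snd c (\<gamma> t))) v) (at t)"
proof -
  let ?D = "frechet_derivative (transition c d) (at (snd c (\<gamma> t)))"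
  have D: "(transition c d has_derivative ?D) (at ((snd c \<circ> \<gamma>) t))"
    using smooth_on_has_derivative[OF smooth_compatible_transition[OF comp]] \<gamma> by simp
  have "?D (r *\<^sub>R v) = r *\<^sub>R ?D v" for r
    using has_derivative_linear[OF D] by (rule linear_scale)
  with has_derivative_compose[OF v[unfolded has_vector_derivative_def] D]
  have der: "((\<lambda>s. transition c d ((snd c \<circ> \<gamma>) s)) has_vector_derivative ?D v) (at t)"
    by (simp add: has_vector_derivative_def)
  obtain S where S: "open S" "t \<in> S" "\<And>s. s \<in> S \<Longrightarrow> \<gamma> s \<in> fst c"
    using \<gamma>(1)[unfolded continuous_at_open, rule_format, OF conjI[OF is_chart_facts(1)[OF c(1)] \<gamma>(2)]]
    by auto
  show ?thesis
    by (rule has_vector_derivative_transform_within_open[OF der S(1,2)]) (simp add: transition_apply[OF c(1)] S(3))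
qed

locale riemannian_manifold =
  fixes A :: "('m::{t2_space, second_countable_topology}, 'b::euclidean_space) chart set"
    and g :: "('m, 'b) chart \<Rightarrow> 'm \<Rightarrow> 'b \<Rightarrow> 'b \<Rightarrow> real"
  assumes atlas: "smooth_atlas A" and metric: "riemannian_metric A g"
begin

lemma atlas_facts:
  shows "c \<in> A \<Longrightarrow> is_chart c" "\<exists>c\<in>A. x \<in> fst c" "c \<in> A \<Longrightarrow> d \<in> A \<Longrightarrow> smooth_compatible c d"
proof -
  have "x \<in> \<Union> (fst ` A)" using atlas by (simp add: smooth_atlas_def)
  then show "\<exists>c\<in>A. x \<in> fst c" by blast
qed (use atlas in \<open>auto simp: smooth_atlas_def\<close>)

lemma metric_facts:
  assumes "c \<in> A" "x \<in> fst c"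
  shows "bilinear (g c x)" "v \<noteq> 0 \<Longrightarrow> g c x v v > 0"
  using metric assms unfolding riemannian_metric_def by blast+

lemma metric_smooth:
  "c \<in> A \<Longrightarrow> smooth_on (snd c ` fst c) (\<lambda>y. g c (inv_into (fst c) (snd c) y) v w)"
  using metric unfolding riemannian_metric_def by blast

lemma metric_transform:
  "c \<in> A \<Longrightarrow> d \<in> A \<Longrightarrow> x \<in> fst c \<Longrightarrow> x \<in> fst d \<Longrightarrow>
    g c x v w = g d x (frechet_derivative (transition c d) (at (snd c x)) v)
                      (frechet_derivative (transition c d) (at (snd c x)) w)"
  using metric unfolding riemannian_metric_def by blast

lemma metric_scale:
  assumes "c \<in> A" "x \<in> fst c"
  shows "g c x (r *\<^sub>R v) (r *\<^sub>R v) = r\<^sup>2 * g c x v v"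
  using bilinear_lmul[OF metric_facts(1)[OF assms]] bilinear_rmul[OF metric_facts(1)[OF assms]]
  by (simp add: power2_eq_square)

text \<open>The speed is defined with an arbitrary chart; by the transformation law every chart of
  the atlas gives the same value.\<close>

lemma speed_eq:
  assumes c: "c \<in> A" "\<gamma> t \<in> fst c" and \<gamma>: "isCont \<gamma> t"
    and v: "((snd c \<circ> \<gamma>) has_vector_derivative v) (at t)"
  shows "speed A g \<gamma> t = sqrt (g c (\<gamma> t) v v)"
proof -
  define d where "d = (SOME d. d \<in> A \<and> \<gamma> t \<in> fst d)"
  have d: "d \<in> A" "\<gamma> t \<in> fst d"
    using someI[of "\<lambda>d. d \<in> A \<and> \<gamma> t \<in> fst d" c] c unfolding d_def by blast+
  have "((snd d \<circ> \<gamma>) has_vector_derivative frechet_derivative (transition c d) (at (snd c (\<gamma> t))) v) (at t)"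
    using atlas_facts c d by (intro transition_comp_derivative \<gamma> v) auto
  then have "vector_derivative (snd d \<circ> \<gamma>) (at t) = frechet_derivative (transition c d) (at (snd c (\<gamma> t))) v"
    by (rule vector_derivative_at)
  then show ?thesis
    using metric_transform[OF c(1) d(1) c(2) d(2), of v v] unfolding speed_def Let_def d_def[symmetric] by simp
qed

text \<open>The Gram matrix of the metric is continuous and positive definite; on a compact ball of a chart
  and on the unit sphere it has a positive minimum and a finite maximum.\<close>

lemma metric_comparison:
  assumes c: "c \<in> A" "p \<in> fst c"
  obtains R \<kappa> C where "R > 0" "\<kappa> > 0" "C > 0" "cball (snd c p) R \<subseteq> snd c ` fst c"
    "\<And>x v. x \<in> fst c \<Longrightarrow> snd c x \<in> cball (snd c p) R \<Longrightarrow>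
      \<kappa> * norm v \<le> sqrt (g c x v v) \<and> sqrt (g c x v v) \<le> C * norm v"
proof -
  let ?inv = "inv_into (fst c) (snd c)"
  have ch: "is_chart c" using atlas_facts c by blast
  obtain R where R: "R > 0" "cball (snd c p) R \<subseteq> snd c ` fst c"
    using is_chart_facts(2)[OF ch] c(2) open_contains_cball by blast
  define K where "K = cball (snd c p) R \<times> sphere (0::'b) 1"
  have "compact K" by (auto simp: K_def intro: compact_Times)
  obtain b :: 'b where "b \<in> Basis" using nonempty_Basis by blast
  then have "K \<noteq> {}" using R(1) by (auto simp: K_def)
  have inv: "?inv y \<in> fst c" if "y \<in> cball (snd c p) R" for y
    using that R(2) by (intro inv_into_into) blast
  let ?f = "\<lambda>z::'b \<times> 'b. g c (?inv (fst z)) (snd z) (snd z)"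
  have contf: "continuous_on K ?f"
  proof -
    have exp: "?f z = (\<Sum>(i, j)\<in>Basis \<times> Basis. (snd z \<bullet> i) * ((snd z \<bullet> j) * g c (?inv (fst z)) i j))"
      if "z \<in> K" for z
    proof -
      have bil: "bilinear (g c (?inv (fst z)))"
        using that inv by (intro metric_facts(1) c) (auto simp: K_def)
      have "?f z = g c (?inv (fst z)) (\<Sum>i\<in>Basis. (snd z \<bullet> i) *\<^sub>R i) (\<Sum>i\<in>Basis. (snd z \<bullet> i) *\<^sub>R i)"
        by (simp add: euclidean_representation)
      also have "\<dots> = (\<Sum>(i, j)\<in>Basis \<times> Basis. (snd z \<bullet> i) * ((snd z \<bullet> j) * g c (?inv (fst z)) i j))"
        unfolding bilinear_sum[OF bil] by (simp add: bilinear_lmul[OF bil] bilinear_rmul[OF bil] mult.left_commute)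
      finally show ?thesis .
    qed
    have cont: "continuous_on K (\<lambda>z. g c (?inv (fst z)) i j)" for i j
    proof (rule continuous_on_compose2[OF smooth_on_continuous[OF metric_smooth[OF c(1)]]])
      show "continuous_on K fst" by (intro continuous_intros)
      show "fst ` K \<subseteq> snd c ` fst c" using R(2) by (auto simp: K_def)
    qed
    have "continuous_on K (\<lambda>z. \<Sum>(i, j)\<in>Basis \<times> Basis. (snd z \<bullet> i) * ((snd z \<bullet> j) * g c (?inv (fst z)) i j))"
      unfolding case_prod_beta by (intro continuous_intros cont)
    then show ?thesis by (rule continuous_on_eq) (simp add: exp)
  qed
  obtain z1 where z1: "z1 \<in> K" "\<forall>z\<in>K. ?f z1 \<le> ?f z"
    using continuous_attains_inf[OF \<open>compact K\<close> \<open>K \<noteq> {}\<close> contf] by (rule bexE)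
  obtain z2 where z2: "z2 \<in> K" "\<forall>z\<in>K. ?f z \<le> ?f z2"
    using continuous_attains_sup[OF \<open>compact K\<close> \<open>K \<noteq> {}\<close> contf] by (rule bexE)
  have pos: "?f z > 0" if "z \<in> K" for z
    using that inv by (intro metric_facts(2) c) (auto simp: K_def)
  show ?thesis
  proof (rule that[of R "sqrt (?f z1)" "sqrt (?f z2)"])
    fix x v assume x: "x \<in> fst c" "snd c x \<in> cball (snd c p) R"
    show "sqrt (?f z1) * norm v \<le> sqrt (g c x v v) \<and> sqrt (g c x v v) \<le> sqrt (?f z2) * norm v"
    proof (cases "v = 0")
      case True
      have "g c x 0 0 = 0" using metric_scale[OF c(1) x(1), of 0 0] by simp
      with True show ?thesis by simp
    next
      case False
      let ?u = "v /\<^sub>R norm v"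
      have u: "(snd c x, ?u) \<in> K" using x False by (simp add: K_def)
      have "v = norm v *\<^sub>R ?u" using False by simp
      then have "g c x v v = (norm v)\<^sup>2 * g c x ?u ?u" using metric_scale[OF c(1) x(1), of "norm v" ?u] by simp
      then have "sqrt (g c x v v) = norm v * sqrt (g c x ?u ?u)"
        by (simp add: real_sqrt_mult)
      moreover have "?f z1 \<le> g c x ?u ?u" "g c x ?u ?u \<le> ?f z2"
        using bspec[OF z1(2) u] bspec[OF z2(2) u] is_chart_facts(6)[OF ch x(1)] by simp_all
      ultimately show ?thesis by (simp add: mult.commute mult_left_mono)
    qed
  qed (use R pos[OF z1(1)] pos[OF z2(1)] in simp_all)
qed

lemma C1_dist_le:
  assumes "piecewise_C1_path A \<gamma>" "\<gamma> 0 = x" "\<gamma> 1 = y"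
  shows "C1_dist A g x y \<le> (\<integral>\<^sup>+t\<in>{0..1}. ennreal (speed A g \<gamma> t) \<partial>lborel)"
  unfolding C1_dist_def using assms by (intro INF_lower) (auto simp: pathstart_def pathfinish_def)

lemma C1_dist_ge:
  assumes "\<And>\<gamma>. piecewise_C1_path A \<gamma> \<Longrightarrow> \<gamma> 0 = x \<Longrightarrow> \<gamma> 1 = y \<Longrightarrow>
    L \<le> (\<integral>\<^sup>+t\<in>{0..1}. ennreal (speed A g \<gamma> t) \<partial>lborel)"
  shows "L \<le> C1_dist A g x y"
  unfolding C1_dist_def using assms by (intro INF_greatest) (auto simp: pathstart_def pathfinish_def)

lemma path_isCont: "path \<gamma> \<Longrightarrow> 0 < t \<Longrightarrow> t < 1 \<Longrightarrow> isCont \<gamma> t"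
  unfolding path_def by (rule continuous_on_interior) (auto simp: interior_atLeastAtMost_real)

text \<open>The straight segment in the chart is an admissible curve, smooth also in all other charts, and the
  metric bounds its speed.\<close>

lemma C1_dist_segment_le:
  assumes c: "c \<in> A" and B: "convex B" "B \<subseteq> snd c ` fst c"
    and C: "C \<ge> 0" "\<And>x v. x \<in> fst c \<Longrightarrow> snd c x \<in> B \<Longrightarrow> sqrt (g c x v v) \<le> C * norm v"
    and x: "x \<in> fst c" "snd c x \<in> B" and y: "y \<in> fst c" "snd c y \<in> B"
  shows "C1_dist A g x y \<le> ennreal (C * dist (snd c x) (snd c y))"
proof -
  let ?inv = "inv_into (fst c) (snd c)"
  have ch: "is_chart c" using atlas_facts c by blast
  note ch_facts = is_chart_facts[OF ch]
  define w where "w = snd c y - snd c x"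
  define l where "l t = snd c x + t *\<^sub>R w" for t :: real
  define \<gamma> where "\<gamma> t = ?inv (l t)" for t
  have l: "l t \<in> B" if "0 \<le> t" "t \<le> 1" for t
    using convexD_alt[OF B(1) x(2) y(2) that] by (simp add: l_def w_def algebra_simps)
  have \<gamma>: "\<gamma> t \<in> fst c" "snd c (\<gamma> t) = l t" if "0 \<le> t" "t \<le> 1" for t
    using l[OF that] B(2) by (auto simp: \<gamma>_def intro: inv_into_into f_inv_into_f)
  have contl: "continuous_on S l" for S unfolding l_def by (intro continuous_intros)
  have path: "path \<gamma>" unfolding path_def \<gamma>_def
    by (rule continuous_on_compose2[OF ch_facts(4) contl]) (use l B(2) in auto)
  have derl: "(l has_vector_derivative w) (at t)" for t
    unfolding l_def by (auto intro!: derivative_eq_intros)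
  have der: "((snd c \<circ> \<gamma>) has_vector_derivative w) (at t)" if "0 < t" "t < 1" for t
    by (rule has_vector_derivative_transform_within_open[OF derl, of "{0<..<1}"]) (use that \<gamma> in auto)
  have pw: "piecewise_C1_path A \<gamma>" unfolding piecewise_C1_path_def
  proof (intro conjI path exI[of _ "{}"] ballI)
    fix d assume d: "d \<in> A"
    let ?S = "({0<..<1} - {}) \<inter> \<gamma> -` fst d"
    let ?D = "\<lambda>t. frechet_derivative (transition c d) (at (l t)) w"
    have comp: "smooth_compatible c d" using atlas_facts c d by blast
    show "(snd d \<circ> \<gamma>) C1_differentiable_on ?S" unfolding C1_differentiable_on_def
    proof (intro exI[of _ ?D] conjI ballI)
      fix t assume t: "t \<in> ?S"
      then show "((snd d \<circ> \<gamma>) has_vector_derivative ?D t) (at t)"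
        using transition_comp_derivative[OF ch atlas_facts(1)[OF d] comp path_isCont[OF path], of t w]
          der[of t] \<gamma>[of t] by simp
    next
      show "continuous_on ?S ?D"
      proof (rule continuous_on_compose2[OF smooth_on_continuous[OF
              smooth_on_derivative[OF smooth_compatible_transition[OF comp]]] contl])
        show "l ` ?S \<subseteq> snd c ` (fst c \<inter> fst d)"
        proof
          fix z assume "z \<in> l ` ?S"
          then obtain t where t: "t \<in> ?S" "z = l t" by blast
          then show "z \<in> snd c ` (fst c \<inter> fst d)" using \<gamma>[of t] by (intro image_eqI[of _ _ "\<gamma> t"]) auto
        qed
      qed
    qed
  qed simp
  have sp: "speed A g \<gamma> t \<le> C * norm w" if "0 < t" "t < 1" for t
    using speed_eq[OF c _ path_isCont[OF path that] der[OF that]] \<gamma>[of t] that C(2)[of "\<gamma> t" w] l[of t] by simp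
  have "C1_dist A g x y \<le> (\<integral>\<^sup>+t\<in>{0..1}. ennreal (speed A g \<gamma> t) \<partial>lborel)"
    by (rule C1_dist_le[OF pw]) (use ch_facts(6) x y in \<open>auto simp: \<gamma>_def l_def w_def\<close>)
  also have "\<dots> \<le> (\<integral>\<^sup>+t\<in>{0..1::real}. ennreal (C * norm w) \<partial>lborel)"
  proof (rule nn_integral_mono_AE)
    show "AE t in lborel. ennreal (speed A g \<gamma> t) * indicator {0..1} t \<le> ennreal (C * norm w) * indicator {0..1} t"
      using AE_lborel_singleton[of 0] AE_lborel_singleton[of 1]
      by eventually_elim (auto simp: indicator_def intro!: ennreal_leI sp)
  qed
  also have "\<dots> = ennreal (C * dist (snd c x) (snd c y))"
    by (subst nn_integral_cmult_indicator) (auto simp: w_def dist_norm norm_minus_commute)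
  finally show ?thesis .
qed

end

section \<open>The distance given by piecewise smooth curves\<close>

text \<open>For functions that are not known to be measurable, upper bounds of the integral may be tested on
  measurable minorants, to which additivity and substitution apply.\<close>

lemma nn_integral_leI_measurable_minorants:
  fixes f :: "'a \<Rightarrow> ennreal"
  assumes "\<And>s. s \<in> borel_measurable M \<Longrightarrow> (\<And>x. s x \<le> f x) \<Longrightarrow> (\<integral>\<^sup>+x. s x \<partial>M) \<le> B"
  shows "(\<integral>\<^sup>+x. f x \<partial>M) \<le> B"
  unfolding nn_integral_def
proof (rule SUP_least)
  fix s assume "s \<in> {g. simple_function M g \<and> g \<le> f}"
  then have s: "simple_function M s" "s \<le> f" by auto
  have "(\<integral>\<^sup>+x. s x \<partial>M) \<le> B"
    using borel_measurable_simple_function[OF s(1)] s(2) by (intro assms) (auto simp: le_fun_def)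
  then show "integral\<^sup>S M s \<le> B" using nn_integral_eq_simple_integral[OF s(1)] by simp
qed

context riemannian_manifold
begin

text \<open>The fundamental theorem of calculus for a curve that is \<open>C\<^sup>1\<close> off a finite set. The derivative
  may be unbounded near this set, but finite length makes it absolutely integrable.\<close>

lemma length_in_chart_ge:
  assumes pw: "piecewise_C1_path A \<gamma>" and c: "c \<in> A" and s: "0 \<le> s" "s \<le> 1"
    and \<kappa>: "\<kappa> > 0" "\<And>x v. x \<in> fst c \<Longrightarrow> snd c x \<in> B \<Longrightarrow> \<kappa> * norm v \<le> sqrt (g c x v v)"
    and in_chart: "\<And>t. 0 \<le> t \<Longrightarrow> t \<le> s \<Longrightarrow> \<gamma> t \<in> fst c \<and> snd c (\<gamma> t) \<in> B"
  shows "ennreal (\<kappa> * dist (snd c (\<gamma> 0)) (snd c (\<gamma> s))) \<le> (\<integral>\<^sup>+t\<in>{0..1}. ennreal (speed A g \<gamma> t) \<partial>lborel)"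
proof -
  have ch: "is_chart c" using atlas_facts c by blast
  obtain F where path: "path \<gamma>" and F: "finite F"
    "(snd c \<circ> \<gamma>) C1_differentiable_on (({0<..<1} - F) \<inter> \<gamma> -` fst c)"
    using pw c unfolding piecewise_C1_path_def by blast
  then obtain D where D: "\<And>t. t \<in> ({0<..<1} - F) \<inter> \<gamma> -` fst c \<Longrightarrow> ((snd c \<circ> \<gamma>) has_vector_derivative D t) (at t)"
    "continuous_on (({0<..<1} - F) \<inter> \<gamma> -` fst c) D"
    unfolding C1_differentiable_on_def by blast
  define E where "E = {0<..<s} - F"
  have E: "E \<subseteq> ({0<..<1} - F) \<inter> \<gamma> -` fst c" using in_chart s(2) by (auto simp: E_def)
  have "open E" using F(1) by (auto simp: E_def intro: open_Diff finite_imp_closed)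
  define D' where "D' t = indicator E t *\<^sub>R D t" for t
  have meas: "D' \<in> borel_measurable borel"
    using \<open>open E\<close> continuous_on_subset[OF D(2) E] unfolding D'_def
    by (intro borel_measurable_continuous_on_indicator) auto
  have le: "ennreal \<kappa> * ennreal (norm (D' t)) \<le> ennreal (speed A g \<gamma> t) * indicator {0..1} t" for t
  proof (cases "t \<in> E")
    case True
    then have t: "0 < t" "t < 1" "t \<le> s" using s by (auto simp: E_def)
    have "\<kappa> * norm (D t) \<le> speed A g \<gamma> t"
      using speed_eq[OF c, of \<gamma> t "D t"] in_chart[of t] D(1)[of t] E True t path_isCont[OF path, of t] \<kappa>(2)[of "\<gamma> t" "D t"]
      by auto
    then show ?thesis using True t \<kappa>(1) by (simp add: D'_def ennreal_leI flip: ennreal_mult)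
  qed (simp add: D'_def)
  have mult: "ennreal \<kappa> * (\<integral>\<^sup>+t. ennreal (norm (D' t)) \<partial>lborel) \<le> (\<integral>\<^sup>+t\<in>{0..1}. ennreal (speed A g \<gamma> t) \<partial>lborel)"
    using meas by (subst nn_integral_cmult[symmetric]) (auto intro!: nn_integral_mono le)
  show ?thesis
  proof (cases "(\<integral>\<^sup>+t. ennreal (norm (D' t)) \<partial>lborel) = \<infinity>")
    case True
    then show ?thesis using mult \<kappa>(1) by (simp add: ennreal_mult_top top_unique)
  next
    case False
    then have int: "integrable lborel D'" using meas by (intro integrableI_bounded) (auto simp: less_top)
    have "(D' has_integral ((snd c \<circ> \<gamma>) s - (snd c \<circ> \<gamma>) 0)) {0..s}"
    proof (rule fundamental_theorem_of_calculus_interior_strong[OF F(1) s(1)])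
      show "((snd c \<circ> \<gamma>) has_vector_derivative D' t) (at t)" if "t \<in> {0<..<s} - F" for t
      proof -
        have "t \<in> E" using that by (simp add: E_def)
        then show ?thesis using D(1)[OF subsetD[OF E \<open>t \<in> E\<close>]] by (simp add: D'_def)
      qed
      show "continuous_on {0..s} (snd c \<circ> \<gamma>)"
      proof (rule continuous_on_compose)
        show "continuous_on {0..s} \<gamma>" using path s unfolding path_def by (rule_tac continuous_on_subset) auto
        show "continuous_on (\<gamma> ` {0..s}) (snd c)"
          using in_chart by (intro continuous_on_subset[OF is_chart_facts(3)[OF ch]]) auto
      qed
    qed
    then have "(D' has_integral ((snd c \<circ> \<gamma>) s - (snd c \<circ> \<gamma>) 0)) UNIV"
      by (rule has_integral_on_superset) (auto simp: D'_def E_def indicator_def)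
    then have "integral\<^sup>L lborel D' = (snd c \<circ> \<gamma>) s - (snd c \<circ> \<gamma>) 0"
      using has_integral_integral_lborel[OF int] has_integral_unique by blast
    then have "ennreal (dist (snd c (\<gamma> 0)) (snd c (\<gamma> s))) \<le> (\<integral>\<^sup>+t. ennreal (norm (D' t)) \<partial>lborel)"
      using integral_norm_bound_ennreal[OF int] by (simp add: dist_norm norm_minus_commute)
    then have "ennreal \<kappa> * ennreal (dist (snd c (\<gamma> 0)) (snd c (\<gamma> s))) \<le> ennreal \<kappa> * (\<integral>\<^sup>+t. ennreal (norm (D' t)) \<partial>lborel)"
      by (rule mult_left_mono) simp
    with mult show ?thesis using \<kappa>(1) by (simp add: ennreal_mult)
  qed
qed

text \<open>A curve that starts in a coordinate ball either stays there or has to reach its sphere; hence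
  the Riemannian distance is locally bounded below by a multiple of the Euclidean one, and it separates points.\<close>

lemma C1_dist_ge_in_chart:
  assumes c: "c \<in> A" and \<rho>: "cball q \<rho> \<subseteq> snd c ` fst c"
    and \<kappa>: "\<kappa> > 0" "\<And>x v. x \<in> fst c \<Longrightarrow> snd c x \<in> cball q \<rho> \<Longrightarrow> \<kappa> * norm v \<le> sqrt (g c x v v)"
    and x: "x \<in> fst c" "snd c x \<in> ball q \<rho>"
  shows "y \<in> fst c \<Longrightarrow> snd c y \<in> ball q \<rho> \<Longrightarrow>
      ennreal (\<kappa> * min (dist (snd c x) (snd c y)) (\<rho> - dist q (snd c x))) \<le> C1_dist A g x y"
    and "\<not> (y \<in> fst c \<and> snd c y \<in> ball q \<rho>) \<Longrightarrow>
      ennreal (\<kappa> * (\<rho> - dist q (snd c x))) \<le> C1_dist A g x y"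
proof -
  have ch: "is_chart c" using atlas_facts c by blast
  define V where "V = {z \<in> fst c. snd c z \<in> ball q \<rho>}"
  define K where "K = {z \<in> fst c. snd c z \<in> cball q \<rho>}"
  have VK: "V \<subseteq> K" by (auto simp: V_def K_def)
  have "open V" unfolding V_def by (rule is_chart_facts(8)[OF ch]) simp
  have "K = inv_into (fst c) (snd c) ` cball q \<rho>"
  proof
    show "K \<subseteq> inv_into (fst c) (snd c) ` cball q \<rho>"
      using is_chart_facts(6)[OF ch] by (force simp: K_def)
    show "inv_into (fst c) (snd c) ` cball q \<rho> \<subseteq> K"
    proof
      fix z assume "z \<in> inv_into (fst c) (snd c) ` cball q \<rho>"
      then obtain w where w: "w \<in> cball q \<rho>" "z = inv_into (fst c) (snd c) w" by blast
      then have "w \<in> snd c ` fst c" using \<rho> by blast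
      then show "z \<in> K" using w by (simp add: K_def inv_into_into f_inv_into_f)
    qed
  qed
  then have "compact K"
    using continuous_on_subset[OF is_chart_facts(4)[OF ch] \<rho>] by (simp add: compact_continuous_image)
  then have "closed K" by (rule compact_imp_closed)
  let ?L = "\<lambda>\<gamma>. \<integral>\<^sup>+t\<in>{0..1}. ennreal (speed A g \<gamma> t) \<partial>lborel"
  have inner: "ennreal (\<kappa> * dist (snd c (\<gamma> 0)) (snd c (\<gamma> s))) \<le> ?L \<gamma>"
    if "piecewise_C1_path A \<gamma>" "0 \<le> s" "s \<le> 1" "\<And>t. 0 \<le> t \<Longrightarrow> t \<le> s \<Longrightarrow> \<gamma> t \<in> K" for \<gamma> s
    using that \<kappa> c by (intro length_in_chart_ge[where B = "cball q \<rho>"]) (auto simp: K_def)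
  have exit: "ennreal (\<kappa> * (\<rho> - dist q (snd c x))) \<le> ?L \<gamma>"
    if \<gamma>: "piecewise_C1_path A \<gamma>" "\<gamma> 0 = x" and t: "t \<in> {0..1}" "\<gamma> t \<notin> V" for \<gamma> t
  proof -
    have path: "continuous_on {0..1} \<gamma>" using \<gamma>(1) by (simp add: piecewise_C1_path_def path_def)
    define T where "T = {0..1} \<inter> \<gamma> -` (- V)"
    have "closed T" unfolding T_def using path \<open>open V\<close> by (intro continuous_closed_preimage) auto
    then have "compact T" unfolding T_def by (metis compact_Icc compact_Int_closed inf.left_idem)
    moreover have "T \<noteq> {}" using t by (auto simp: T_def)
    ultimately have "\<exists>s\<in>T. \<forall>r\<in>T. s \<le> r" by (rule compact_attains_inf)
    then obtain s where s: "s \<in> T" "\<And>r. r \<in> T \<Longrightarrow> s \<le> r" by blast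
    have before: "\<gamma> r \<in> V" if "0 \<le> r" "r < s" for r
      using s(1) s(2)[of r] that by (force simp: T_def)
    have "s \<noteq> 0" using s(1) \<gamma>(2) x by (auto simp: T_def V_def)
    then have s01: "0 < s" "s \<le> 1" using s(1) by (auto simp: T_def)
    have "\<gamma> s \<in> K"
    proof -
      have cl: "closure {0..<s} = {0..s}" using s01 by simp
      have "\<gamma> ` closure {0..<s} \<subseteq> K"
      proof (rule image_closure_subset[OF _ \<open>closed K\<close>])
        show "continuous_on (closure {0..<s}) \<gamma>" unfolding cl using path s01 by (rule_tac continuous_on_subset) auto
        show "\<gamma> ` {0..<s} \<subseteq> K" using before VK by auto
      qed
      then show ?thesis unfolding cl using s01 by auto
    qed
    have le: "ennreal (\<kappa> * dist (snd c (\<gamma> 0)) (snd c (\<gamma> s))) \<le> ?L \<gamma>"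
    proof (rule inner[OF \<gamma>(1)])
      show "\<gamma> r \<in> K" if "0 \<le> r" "r \<le> s" for r
        using before[of r] VK \<open>\<gamma> s \<in> K\<close> that by (cases "r = s") auto
    qed (use s01 in auto)
    have "dist q (snd c (\<gamma> s)) = \<rho>" using \<open>\<gamma> s \<in> K\<close> s(1) by (auto simp: K_def V_def T_def)
    then have "\<rho> - dist q (snd c x) \<le> dist (snd c (\<gamma> 0)) (snd c (\<gamma> s))"
      using dist_triangle[of q "snd c (\<gamma> s)" "snd c x"] \<gamma>(2) by simp
    then have "\<kappa> * (\<rho> - dist q (snd c x)) \<le> \<kappa> * dist (snd c (\<gamma> 0)) (snd c (\<gamma> s))"
      using \<kappa>(1) by simp
    then show ?thesis using le ennreal_leI order_trans by blast
  qed
  show "ennreal (\<kappa> * min (dist (snd c x) (snd c y)) (\<rho> - dist q (snd c x))) \<le> C1_dist A g x y"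
    if y: "y \<in> fst c" "snd c y \<in> ball q \<rho>"
  proof (rule C1_dist_ge)
    fix \<gamma> assume \<gamma>: "piecewise_C1_path A \<gamma>" "\<gamma> 0 = x" "\<gamma> 1 = y"
    show "ennreal (\<kappa> * min (dist (snd c x) (snd c y)) (\<rho> - dist q (snd c x))) \<le> ?L \<gamma>"
    proof (cases "\<forall>t\<in>{0..1}. \<gamma> t \<in> V")
      case True
      then have "\<gamma> t \<in> K" if "0 \<le> t" "t \<le> 1" for t using VK that by auto
      then have "ennreal (\<kappa> * dist (snd c x) (snd c y)) \<le> ?L \<gamma>"
        using inner[OF \<gamma>(1), of 1] \<gamma>(2,3) by simp
      moreover have "\<kappa> * min (dist (snd c x) (snd c y)) (\<rho> - dist q (snd c x)) \<le> \<kappa> * dist (snd c x) (snd c y)"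
        using \<kappa>(1) by (intro mult_left_mono) auto
      ultimately show ?thesis using ennreal_leI order_trans by blast
    next
      case False
      then have "ennreal (\<kappa> * (\<rho> - dist q (snd c x))) \<le> ?L \<gamma>" using exit[OF \<gamma>(1,2)] by blast
      moreover have "\<kappa> * min (dist (snd c x) (snd c y)) (\<rho> - dist q (snd c x)) \<le> \<kappa> * (\<rho> - dist q (snd c x))"
        using \<kappa>(1) by (intro mult_left_mono) auto
      ultimately show ?thesis using ennreal_leI order_trans by blast
    qed
  qed
  show "ennreal (\<kappa> * (\<rho> - dist q (snd c x))) \<le> C1_dist A g x y"
    if y: "\<not> (y \<in> fst c \<and> snd c y \<in> ball q \<rho>)"
  proof (rule C1_dist_ge)
    fix \<gamma> assume "piecewise_C1_path A \<gamma>" "\<gamma> 0 = x" "\<gamma> 1 = y"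
    then show "ennreal (\<kappa> * (\<rho> - dist q (snd c x))) \<le> ?L \<gamma>"
      using exit[of \<gamma> 1] y by (auto simp: V_def)
  qed
qed

lemma has_vector_derivative_affine_comp:
  fixes f :: "real \<Rightarrow> 'c::real_normed_vector"
  assumes "(f has_vector_derivative v) (at (2 * t - b))"
  shows "((\<lambda>s. f (2 * s - b)) has_vector_derivative 2 *\<^sub>R v) (at t)"
proof -
  have "((\<lambda>s::real. 2 * s - b) has_vector_derivative 2) (at t)"
    by (auto intro!: derivative_eq_intros)
  from vector_diff_chain_at[OF this assms] show ?thesis by (simp add: o_def)
qed

text \<open>Both halves of a concatenation are, up to the affine parameter change \<open>s = 2 t - b\<close>,
  restrictions of the given curves.\<close>

lemma speed_affine_comp:
  assumes c: "c \<in> A" "\<gamma>' (2 * t - b) \<in> fst c" and \<gamma>': "isCont \<gamma>' (2 * t - b)"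
    and d: "(snd c \<circ> \<gamma>') differentiable (at (2 * t - b))"
    and S: "open S" "t \<in> S" "\<And>s. s \<in> S \<Longrightarrow> \<gamma> s = \<gamma>' (2 * s - b)"
  shows "speed A g \<gamma> t = 2 * speed A g \<gamma>' (2 * t - b)"
proof -
  obtain v where v: "((snd c \<circ> \<gamma>') has_vector_derivative v) (at (2 * t - b))"
    using d by (auto simp: vector_derivative_works)
  have "((\<lambda>s. (snd c \<circ> \<gamma>') (2 * s - b)) has_vector_derivative 2 *\<^sub>R v) (at t)"
    by (rule has_vector_derivative_affine_comp[OF v])
  then have w: "((snd c \<circ> \<gamma>) has_vector_derivative 2 *\<^sub>R v) (at t)"
    by (rule has_vector_derivative_transform_within_open[OF _ S(1,2)]) (simp add: S(3))
  have "isCont (\<lambda>s. \<gamma>' (2 * s - b)) t"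
    by (rule isCont_o2[where f = "\<lambda>s. 2 * s - b"]) (intro continuous_intros, rule \<gamma>')
  then have "isCont \<gamma> t"
    by (rule continuous_transform_within_openin[where S = S]) (use S in auto)
  then have "speed A g \<gamma> t = sqrt (g c (\<gamma> t) (2 *\<^sub>R v) (2 *\<^sub>R v))"
    using c S by (intro speed_eq w) auto
  also have "\<dots> = 2 * speed A g \<gamma>' (2 * t - b)"
    using speed_eq[OF c \<gamma>' v] metric_scale[OF c, of 2 v] S by (simp add: real_sqrt_mult)
  finally show ?thesis .
qed

lemma piecewise_C1_path_differentiable:
  assumes "piecewise_C1_path A \<gamma>"
  obtains F where "finite F"
    "\<And>c t. c \<in> A \<Longrightarrow> t \<in> {0<..<1} - F \<Longrightarrow> \<gamma> t \<in> fst c \<Longrightarrow> (snd c \<circ> \<gamma>) differentiable (at t)"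
    "\<And>c. c \<in> A \<Longrightarrow> (snd c \<circ> \<gamma>) C1_differentiable_on (({0<..<1} - F) \<inter> \<gamma> -` fst c)"
proof -
  obtain F where F: "finite F" "\<forall>c\<in>A. (snd c \<circ> \<gamma>) C1_differentiable_on (({0<..<1} - F) \<inter> \<gamma> -` fst c)"
    using assms unfolding piecewise_C1_path_def by blast
  then show ?thesis
  proof (intro that[of F])
    fix c t assume "c \<in> A" "t \<in> {0<..<1} - F" "\<gamma> t \<in> fst c"
    then have "t \<in> ({0<..<1} - F) \<inter> \<gamma> -` fst c" by simp
    then show "(snd c \<circ> \<gamma>) differentiable (at t)"
      using bspec[OF F(2) \<open>c \<in> A\<close>] unfolding C1_differentiable_on_def
      by (metis differentiableI_vector)
  qed auto
qed

lemma C1_differentiable_on_affine_comp: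
  fixes f :: "real \<Rightarrow> 'c::real_normed_vector"
  assumes f: "f C1_differentiable_on S" and T: "open I" "T \<subseteq> I" "\<And>t. t \<in> T \<Longrightarrow> 2 * t - b \<in> S"
    and eq: "\<And>t. t \<in> I \<Longrightarrow> h t = f (2 * t - b)"
  obtains D where "\<And>t. t \<in> T \<Longrightarrow> (h has_vector_derivative D t) (at t)" "continuous_on T D"
proof -
  obtain D where D: "\<And>t. t \<in> S \<Longrightarrow> (f has_vector_derivative D t) (at t)" "continuous_on S D"
    using f unfolding C1_differentiable_on_def by blast
  show ?thesis
  proof (rule that[of "\<lambda>t. 2 *\<^sub>R D (2 * t - b)"])
    fix t assume t: "t \<in> T"
    have "((\<lambda>s. f (2 * s - b)) has_vector_derivative 2 *\<^sub>R D (2 * t - b)) (at t)"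
      by (rule has_vector_derivative_affine_comp[OF D(1)[OF T(3)[OF t]]])
    then show "(h has_vector_derivative 2 *\<^sub>R D (2 * t - b)) (at t)"
      by (rule has_vector_derivative_transform_within_open[OF _ T(1)]) (use T(2) t eq in auto)
  next
    have "continuous_on T (\<lambda>t. D (2 * t - b))"
      by (rule continuous_on_compose2[OF D(2), of T "\<lambda>t. 2 * t - b"]) (use T(3) in \<open>auto intro!: continuous_intros\<close>)
    then show "continuous_on T (\<lambda>t. 2 *\<^sub>R D (2 * t - b))" by (intro continuous_intros)
  qed
qed

lemma joinpaths_left: "t \<in> {..<1/2} \<Longrightarrow> (\<gamma>1 +++ \<gamma>2) t = \<gamma>1 (2 * t - 0)"
  and joinpaths_right: "t \<in> {1/2<..} \<Longrightarrow> (\<gamma>1 +++ \<gamma>2) t = \<gamma>2 (2 * t - 1)"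
  by (auto simp: joinpaths_def)

lemma piecewise_C1_path_join:
  assumes \<gamma>: "piecewise_C1_path A \<gamma>1" "piecewise_C1_path A \<gamma>2" "\<gamma>1 1 = \<gamma>2 0"
  shows "piecewise_C1_path A (\<gamma>1 +++ \<gamma>2)"
proof -
  obtain F1 where F1: "finite F1"
    "\<And>c. c \<in> A \<Longrightarrow> (snd c \<circ> \<gamma>1) C1_differentiable_on (({0<..<1} - F1) \<inter> \<gamma>1 -` fst c)"
    using piecewise_C1_path_differentiable[OF \<gamma>(1)] by metis
  obtain F2 where F2: "finite F2"
    "\<And>c. c \<in> A \<Longrightarrow> (snd c \<circ> \<gamma>2) C1_differentiable_on (({0<..<1} - F2) \<inter> \<gamma>2 -` fst c)"
    using piecewise_C1_path_differentiable[OF \<gamma>(2)] by metis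
  define F where "F = insert (1/2) ((\<lambda>t. t / 2) ` F1 \<union> (\<lambda>t. (t + 1) / 2) ` F2)"
  let ?\<gamma> = "\<gamma>1 +++ \<gamma>2"
  show ?thesis unfolding piecewise_C1_path_def
  proof (intro conjI exI[of _ F] ballI)
    show "path ?\<gamma>" using \<gamma> by (intro path_join_imp) (auto simp: piecewise_C1_path_def pathfinish_def pathstart_def)
    show "finite F" using F1(1) F2(1) by (simp add: F_def)
    fix c assume c: "c \<in> A"
    define S1 where "S1 = ({0<..<1/2} - F) \<inter> ?\<gamma> -` fst c"
    define S2 where "S2 = ({1/2<..<1} - F) \<inter> ?\<gamma> -` fst c"
    have notF: "2 * t - 0 \<notin> F1" "2 * t - 1 \<notin> F2" if "t \<notin> F" for t
    proof -
      show "2 * t - 0 \<notin> F1" using that by (force simp: F_def intro: rev_image_eqI)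
      show "2 * t - 1 \<notin> F2" using that by (force simp: F_def intro: rev_image_eqI)
    qed
    have S: "({0<..<1} - F) \<inter> ?\<gamma> -` fst c = S1 \<union> S2"
      by (auto simp: S1_def S2_def F_def)
    obtain D1 where D1: "\<And>t. t \<in> S1 \<Longrightarrow> ((snd c \<circ> ?\<gamma>) has_vector_derivative D1 t) (at t)" "continuous_on S1 D1"
    proof (rule C1_differentiable_on_affine_comp[OF F1(2)[OF c], of "{..<1/2}" S1 0 "snd c \<circ> ?\<gamma>"])
      show "2 * t - 0 \<in> ({0<..<1} - F1) \<inter> \<gamma>1 -` fst c" if "t \<in> S1" for t
        using that notF(1)[of t] joinpaths_left[of t \<gamma>1 \<gamma>2] by (auto simp: S1_def)
    qed (auto simp: S1_def joinpaths_left)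
    obtain D2 where D2: "\<And>t. t \<in> S2 \<Longrightarrow> ((snd c \<circ> ?\<gamma>) has_vector_derivative D2 t) (at t)" "continuous_on S2 D2"
    proof (rule C1_differentiable_on_affine_comp[OF F2(2)[OF c], of "{1/2<..}" S2 1 "snd c \<circ> ?\<gamma>"])
      show "2 * t - 1 \<in> ({0<..<1} - F2) \<inter> \<gamma>2 -` fst c" if "t \<in> S2" for t
        using that notF(2)[of t] joinpaths_right[of t \<gamma>1 \<gamma>2] by (auto simp: S2_def)
    qed (auto simp: S2_def joinpaths_right)
    let ?D = "\<lambda>t. if t < 1/2 then D1 t else D2 t"
    show "(snd c \<circ> ?\<gamma>) C1_differentiable_on (({0<..<1} - F) \<inter> ?\<gamma> -` fst c)"
      unfolding S C1_differentiable_on_def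
    proof (intro exI[of _ ?D] conjI ballI)
      show "((snd c \<circ> ?\<gamma>) has_vector_derivative ?D t) (at t)" if "t \<in> S1 \<union> S2" for t
      proof (cases "t \<in> S1")
        case True
        then have "t < 1/2" by (simp add: S1_def)
        then show ?thesis using D1(1)[OF True] by simp
      next
        case False
        then have "t \<in> S2" "\<not> t < 1/2" using that by (auto simp: S2_def)
        then show ?thesis using D2(1)[of t] by simp
      qed
      show "continuous_on (S1 \<union> S2) ?D"
      proof (rule continuous_on_Un_local_open)
        have "S1 = (S1 \<union> S2) \<inter> {..<1/2}" "S2 = (S1 \<union> S2) \<inter> {1/2<..}" by (auto simp: S1_def S2_def)
        then show "openin (top_of_set (S1 \<union> S2)) S1" "openin (top_of_set (S1 \<union> S2)) S2"
          by (metis open_lessThan openin_open_Int, metis open_greaterThan openin_open_Int)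
        show "continuous_on S1 ?D" by (rule continuous_on_eq[OF D1(2)]) (auto simp: S1_def)
        show "continuous_on S2 ?D" by (rule continuous_on_eq[OF D2(2)]) (auto simp: S2_def)
      qed
    qed
  qed
qed

text \<open>The parameter interval is split in the middle and both halves are rescaled, at the level of measurable
  minorants of the speed.\<close>

lemma length_join_le:
  assumes \<gamma>: "piecewise_C1_path A \<gamma>1" "piecewise_C1_path A \<gamma>2"
  shows "(\<integral>\<^sup>+t\<in>{0..1}. ennreal (speed A g (\<gamma>1 +++ \<gamma>2) t) \<partial>lborel) \<le>
    (\<integral>\<^sup>+t\<in>{0..1}. ennreal (speed A g \<gamma>1 t) \<partial>lborel) + (\<integral>\<^sup>+t\<in>{0..1}. ennreal (speed A g \<gamma>2 t) \<partial>lborel)"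
proof (rule nn_integral_leI_measurable_minorants)
  fix s :: "real \<Rightarrow> ennreal" assume "s \<in> borel_measurable lborel"
    and s: "\<And>t. s t \<le> ennreal (speed A g (\<gamma>1 +++ \<gamma>2) t) * indicator {0..1} t"
  then have [measurable]: "s \<in> borel_measurable borel" by simp
  let ?\<gamma> = "\<gamma>1 +++ \<gamma>2"
  \<comment> \<open>Each half, with \<open>I\<close> its parameter interval and \<open>b = 0, 1\<close>, is handled alike.\<close>
  have half: "(\<integral>\<^sup>+t. s t * indicator I t \<partial>lborel) \<le> (\<integral>\<^sup>+t\<in>{0..1}. ennreal (speed A g \<gamma>' t) \<partial>lborel)"
    if \<gamma>': "piecewise_C1_path A \<gamma>'" and I: "I = {b / 2<..<(b + 1) / 2}" "open J" "I \<subseteq> J"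
      "\<And>t. t \<in> J \<Longrightarrow> ?\<gamma> t = \<gamma>' (2 * t - b)" for \<gamma>' I J b
  proof -
    have [measurable]: "I \<in> sets borel" by (simp add: I(1))
    obtain F where F: "finite F"
      "\<And>c t. c \<in> A \<Longrightarrow> t \<in> {0<..<1} - F \<Longrightarrow> \<gamma>' t \<in> fst c \<Longrightarrow> (snd c \<circ> \<gamma>') differentiable (at t)"
      using piecewise_C1_path_differentiable[OF \<gamma>'] by metis
    have path: "path \<gamma>'" using \<gamma>' by (simp add: piecewise_C1_path_def)
    have "(\<integral>\<^sup>+t. s t * indicator I t \<partial>lborel) =
        ennreal \<bar>1/2\<bar> * (\<integral>\<^sup>+t. s (b / 2 + 1/2 * t) * indicator I (b / 2 + 1/2 * t) \<partial>lborel)"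
      by (rule nn_integral_real_affine) auto
    also have "\<dots> = (\<integral>\<^sup>+t. ennreal (1/2) * (s (b / 2 + 1/2 * t) * indicator I (b / 2 + 1/2 * t)) \<partial>lborel)"
      by (subst nn_integral_cmult) auto
    also have "\<dots> \<le> (\<integral>\<^sup>+t\<in>{0..1}. ennreal (speed A g \<gamma>' t) \<partial>lborel)"
    proof (rule nn_integral_mono_AE)
      have "AE t in lborel. t \<notin> F"
        using F(1) by (intro AE_not_in) (rule finite_imp_null_set_lborel)
      then show "AE t in lborel. ennreal (1/2) * (s (b / 2 + 1/2 * t) * indicator I (b / 2 + 1/2 * t))
          \<le> ennreal (speed A g \<gamma>' t) * indicator {0..1} t"
      proof eventually_elim
        case (elim t)
        show ?case
        proof (cases "b / 2 + 1/2 * t \<in> I")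
          case True
          let ?t = "b / 2 + 1/2 * t"
          have t: "0 < t" "t < 1" "2 * ?t - b = t" using True by (auto simp: I(1) field_simps)
          obtain c where c: "c \<in> A" "\<gamma>' t \<in> fst c" using atlas_facts(2) by blast
          have "speed A g ?\<gamma> ?t = 2 * speed A g \<gamma>' (2 * ?t - b)"
          proof (rule speed_affine_comp[OF c(1)])
            show "\<gamma>' (2 * ?t - b) \<in> fst c" "isCont \<gamma>' (2 * ?t - b)" "(snd c \<circ> \<gamma>') differentiable (at (2 * ?t - b))"
              unfolding t(3) using c path_isCont[OF path t(1,2)] F(2) elim t(1,2) by auto
            show "open J" "?t \<in> J" "\<And>s. s \<in> J \<Longrightarrow> ?\<gamma> s = \<gamma>' (2 * s - b)" using I True by auto
          qed
          then have sp: "speed A g ?\<gamma> ?t = 2 * speed A g \<gamma>' t" unfolding t(3) .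
          have "s ?t \<le> ennreal (speed A g ?\<gamma> ?t) * 1"
            by (rule order_trans[OF s[of ?t]], rule mult_left_mono) (auto split: split_indicator)
          then have "s ?t \<le> ennreal (speed A g ?\<gamma> ?t)" by (simp only: mult_1_right)
          then have "ennreal (1/2) * s ?t \<le> ennreal (1/2) * ennreal (2 * speed A g \<gamma>' t)"
            unfolding sp by (rule mult_left_mono) simp
          also have "\<dots> = ennreal (speed A g \<gamma>' t)"
            by (subst ennreal_mult'[symmetric]) auto
          finally show ?thesis using True t by simp
        qed simp
      qed
    qed
    finally show ?thesis .
  qed
  have "(\<integral>\<^sup>+t. s t \<partial>lborel) = (\<integral>\<^sup>+t. s t * indicator {0<..<1/2} t + s t * indicator {1/2<..<1} t \<partial>lborel)"
  proof (rule nn_integral_cong_AE)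
    show "AE t in lborel. s t = s t * indicator {0<..<1/2} t + s t * indicator {1/2<..<1} t"
      using AE_lborel_singleton[of 0] AE_lborel_singleton[of "1/2"] AE_lborel_singleton[of 1]
    proof eventually_elim
      case (elim t)
      show ?case
      proof (cases "t \<in> {0..1}")
        case True
        with elim show ?thesis by (cases "t < 1/2") auto
      next
        case False
        then have "s t = 0" using s[of t] by simp
        then show ?thesis by simp
      qed
    qed
  qed
  also have "\<dots> = (\<integral>\<^sup>+t. s t * indicator {0<..<1/2} t \<partial>lborel) + (\<integral>\<^sup>+t. s t * indicator {1/2<..<1} t \<partial>lborel)"
    by (rule nn_integral_add) auto
  also have "\<dots> \<le> (\<integral>\<^sup>+t\<in>{0..1}. ennreal (speed A g \<gamma>1 t) \<partial>lborel) + (\<integral>\<^sup>+t\<in>{0..1}. ennreal (speed A g \<gamma>2 t) \<partial>lborel)"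
  proof (rule add_mono)
    show "(\<integral>\<^sup>+t. s t * indicator {0<..<1/2} t \<partial>lborel) \<le> (\<integral>\<^sup>+t\<in>{0..1}. ennreal (speed A g \<gamma>1 t) \<partial>lborel)"
      by (rule half[OF \<gamma>(1), of _ 0 "{..<1/2}"]) (auto simp: joinpaths_left)
    show "(\<integral>\<^sup>+t. s t * indicator {1/2<..<1} t \<partial>lborel) \<le> (\<integral>\<^sup>+t\<in>{0..1}. ennreal (speed A g \<gamma>2 t) \<partial>lborel)"
      by (rule half[OF \<gamma>(2), of _ 1 "{1/2<..}"]) (auto simp: joinpaths_right)
  qed
  finally show "(\<integral>\<^sup>+t. s t \<partial>lborel) \<le>
    (\<integral>\<^sup>+t\<in>{0..1}. ennreal (speed A g \<gamma>1 t) \<partial>lborel) + (\<integral>\<^sup>+t\<in>{0..1}. ennreal (speed A g \<gamma>2 t) \<partial>lborel)" .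
qed

text \<open>Nearly optimal curves are concatenated.\<close>

lemma C1_dist_triangle: "C1_dist A g x z \<le> C1_dist A g x y + C1_dist A g y z"
proof (cases "C1_dist A g x y + C1_dist A g y z = top")
  case False
  let ?L = "\<lambda>\<gamma>. \<integral>\<^sup>+t\<in>{0..1}. ennreal (speed A g \<gamma> t) \<partial>lborel"
  show ?thesis
  proof (rule ennreal_le_epsilon)
    fix e :: real assume e: "0 < e"
    have near: "\<exists>\<gamma>. piecewise_C1_path A \<gamma> \<and> \<gamma> 0 = p \<and> \<gamma> 1 = q \<and> ?L \<gamma> \<le> C1_dist A g p q + ennreal (e / 2)"
      if "C1_dist A g p q \<noteq> top" for p q
    proof (rule ccontr)
      assume no: "\<not> ?thesis"
      have "C1_dist A g p q + ennreal (e / 2) \<le> C1_dist A g p q"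
        by (rule C1_dist_ge) (use no in \<open>auto simp: not_le intro: less_imp_le\<close>)
      moreover have "C1_dist A g p q < C1_dist A g p q + ennreal (e / 2)"
        using ennreal_add_left_cancel_less[of "C1_dist A g p q" 0 "ennreal (e / 2)"] that e by simp
      ultimately show False by simp
    qed
    obtain \<gamma>1 \<gamma>2 where \<gamma>: "piecewise_C1_path A \<gamma>1" "\<gamma>1 0 = x" "\<gamma>1 1 = y" "?L \<gamma>1 \<le> C1_dist A g x y + ennreal (e / 2)"
      "piecewise_C1_path A \<gamma>2" "\<gamma>2 0 = y" "\<gamma>2 1 = z" "?L \<gamma>2 \<le> C1_dist A g y z + ennreal (e / 2)"
      using near[of x y] near[of y z] False by auto
    have "C1_dist A g x z \<le> ?L (\<gamma>1 +++ \<gamma>2)"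
      by (rule C1_dist_le[OF piecewise_C1_path_join]) (use \<gamma> in \<open>auto simp: joinpaths_def\<close>)
    also have "\<dots> \<le> ?L \<gamma>1 + ?L \<gamma>2" by (rule length_join_le[OF \<gamma>(1,5)])
    also have "\<dots> \<le> (C1_dist A g x y + ennreal (e / 2)) + (C1_dist A g y z + ennreal (e / 2))"
      by (rule add_mono[OF \<gamma>(4,8)])
    also have "\<dots> = C1_dist A g x y + C1_dist A g y z + (ennreal (e / 2) + ennreal (e / 2))"
      by (simp only: ac_simps)
    also have "ennreal (e / 2) + ennreal (e / 2) = ennreal e" using e by (simp flip: ennreal_plus)
    finally show "C1_dist A g x z \<le> C1_dist A g x y + C1_dist A g y z + ennreal e" .
  qed
qed (simp only: top_greatest)

end

section \<open>From local to global\<close>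

context riemannian_manifold
begin

text \<open>Distances may be measured in any chart of the maximal atlas, as transition maps are locally
  bi-Lipschitz.\<close>

lemma C1_dist_chart_comparison:
  assumes u: "(U, \<psi>) \<in> smooth_charts A" "z \<in> U"
  obtains V k K where "open V" "z \<in> V" "V \<subseteq> U" "k > 0" "K > 0"
    "\<And>x y. x \<in> V \<Longrightarrow> y \<in> V \<Longrightarrow> ennreal (k * dist (\<psi> x) (\<psi> y)) \<le> C1_dist A g x y"
    "\<And>x y. x \<in> V \<Longrightarrow> y \<in> V \<Longrightarrow> C1_dist A g x y \<le> ennreal (K * dist (\<psi> x) (\<psi> y))"
proof -
  obtain c where c: "c \<in> A" "z \<in> fst c" using atlas_facts(2) by blast
  let ?u = "(U, \<psi>)" and ?\<phi> = "snd c"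
  have ch: "is_chart ?u" "is_chart c" and comp: "smooth_compatible ?u c"
    using u(1) c(1) atlas_facts(1) by (auto simp: smooth_charts_def)
  have comp': "smooth_compatible c ?u" using comp by (simp add: smooth_compatible_def Int_commute)
  obtain R \<kappa> C where R: "R > 0" "\<kappa> > 0" "C > 0" "cball (?\<phi> z) R \<subseteq> ?\<phi> ` fst c"
    and bounds: "\<And>x v. x \<in> fst c \<Longrightarrow> ?\<phi> x \<in> cball (?\<phi> z) R \<Longrightarrow>
      \<kappa> * norm v \<le> sqrt (g c x v v) \<and> sqrt (g c x v v) \<le> C * norm v"
    by (rule metric_comparison[OF c]) blast
  have op: "open (\<psi> ` (U \<inter> fst c))" "open (?\<phi> ` (fst c \<inter> U))"
    using is_chart_facts(7)[OF ch(1) is_chart_facts(1)[OF ch(2)]]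
      is_chart_facts(7)[OF ch(2) is_chart_facts(1)[OF ch(1)]] by simp_all
  obtain \<delta>1 K1 where 1: "\<delta>1 > 0" "K1 > 0" "K1-lipschitz_on (cball (\<psi> z) \<delta>1) (transition ?u c)"
    using smooth_on_locally_Lipschitz[OF op(1), of "\<psi> z"] smooth_compatible_transition[OF comp] u(2) c(2)
    by (metis IntI fst_conv imageI snd_conv)
  obtain \<delta>2 K2 where 2: "\<delta>2 > 0" "K2 > 0" "K2-lipschitz_on (cball (?\<phi> z) \<delta>2) (transition c ?u)"
    using smooth_on_locally_Lipschitz[OF op(2), of "?\<phi> z"] smooth_compatible_transition[OF comp'] u(2) c(2)
    by (metis IntI fst_conv imageI)
  define V where "V = {x \<in> U. \<psi> x \<in> ball (\<psi> z) \<delta>1} \<inter> {x \<in> fst c. ?\<phi> x \<in> ball (?\<phi> z) (min (R / 3) \<delta>2)}"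
  have V: "x \<in> U" "x \<in> fst c" "\<psi> x \<in> cball (\<psi> z) \<delta>1" "?\<phi> x \<in> cball (?\<phi> z) \<delta>2" "dist (?\<phi> z) (?\<phi> x) < R / 3"
    if "x \<in> V" for x using that by (auto simp: V_def)
  have le1: "dist (?\<phi> x) (?\<phi> y) \<le> K1 * dist (\<psi> x) (\<psi> y)" if "x \<in> V" "y \<in> V" for x y
    using lipschitz_onD[OF 1(3) V(3)[OF that(1)] V(3)[OF that(2)]] transition_apply[OF ch(1), of _ c] V(1) that by simp
  have le2: "dist (\<psi> x) (\<psi> y) \<le> K2 * dist (?\<phi> x) (?\<phi> y)" if "x \<in> V" "y \<in> V" for x y
    using lipschitz_onD[OF 2(3) V(4)[OF that(1)] V(4)[OF that(2)]] transition_apply[OF ch(2), of _ ?u] V(2) that by simp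
  show ?thesis
  proof (rule that[of V "\<kappa> / K2" "C * K1"])
    have "open {x \<in> U. \<psi> x \<in> ball (\<psi> z) \<delta>1}"
      using is_chart_facts(8)[OF ch(1) open_ball] by (simp only: fst_conv snd_conv)
    then show "open V" unfolding V_def by (intro open_Int is_chart_facts(8)[OF ch(2)] open_ball)
    show "z \<in> V" using u c R 1 2 by (simp add: V_def)
    show "V \<subseteq> U" "\<kappa> / K2 > 0" "C * K1 > 0" using R 1 2 by (auto simp: V_def)
    fix x y assume xy: "x \<in> V" "y \<in> V"
    have R3: "?\<phi> x \<in> cball (?\<phi> z) R" "?\<phi> y \<in> cball (?\<phi> z) R" "?\<phi> x \<in> ball (?\<phi> z) R" "?\<phi> y \<in> ball (?\<phi> z) R"
      using V(5)[OF xy(1)] V(5)[OF xy(2)] R(1) by auto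
    have "C1_dist A g x y \<le> ennreal (C * dist (?\<phi> x) (?\<phi> y))"
      using bounds R(3) by (intro C1_dist_segment_le[OF c(1) convex_cball R(4)] V(2) xy R3) auto
    also have "\<dots> \<le> ennreal (C * K1 * dist (\<psi> x) (\<psi> y))"
      using le1[OF xy] R(3) by (intro ennreal_leI) (simp add: mult.assoc)
    finally show "C1_dist A g x y \<le> ennreal (C * K1 * dist (\<psi> x) (\<psi> y))" .
    have "dist (?\<phi> x) (?\<phi> y) \<le> R - dist (?\<phi> z) (?\<phi> x)"
      using V(5)[OF xy(1)] V(5)[OF xy(2)] dist_triangle3[of "?\<phi> x" "?\<phi> y" "?\<phi> z"] by linarith
    then have m: "min (dist (?\<phi> x) (?\<phi> y)) (R - dist (?\<phi> z) (?\<phi> x)) = dist (?\<phi> x) (?\<phi> y)" by simp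
    have "\<kappa> / K2 * dist (\<psi> x) (\<psi> y) \<le> \<kappa> * dist (?\<phi> x) (?\<phi> y)"
      using le2[OF xy] R(2) 2(2) by (simp add: field_simps)
    then have "ennreal (\<kappa> / K2 * dist (\<psi> x) (\<psi> y)) \<le>
        ennreal (\<kappa> * min (dist (?\<phi> x) (?\<phi> y)) (R - dist (?\<phi> z) (?\<phi> x)))"
      unfolding m by (rule ennreal_leI)
    also have "\<dots> \<le> C1_dist A g x y"
      by (rule C1_dist_ge_in_chart(1)[OF c(1) R(4,2)]) (use bounds V(2) xy R3 in auto)
    finally show "ennreal (\<kappa> / K2 * dist (\<psi> x) (\<psi> y)) \<le> C1_dist A g x y" .
  qed
qed

text \<open>Every curve from a point near \<open>p\<close> to a point near \<open>q\<close> has to leave a fixed coordinate ball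
  around \<open>p\<close>.\<close>

lemma C1_dist_separates:
  assumes "p \<noteq> q"
  obtains V1 V2 \<mu> where "open V1" "open V2" "p \<in> V1" "q \<in> V2" "\<mu> > 0"
    "\<And>x y. x \<in> V1 \<Longrightarrow> y \<in> V2 \<Longrightarrow> ennreal \<mu> \<le> C1_dist A g x y"
proof -
  obtain U1 U2 where U: "open U1" "open U2" "p \<in> U1" "q \<in> U2" "U1 \<inter> U2 = {}"
    using hausdorff[OF assms] by blast
  obtain c where c: "c \<in> A" "p \<in> fst c" using atlas_facts(2) by blast
  have ch: "is_chart c" using atlas_facts(1) c by blast
  let ?\<phi> = "snd c"
  obtain R \<kappa> C where R: "R > 0" "\<kappa> > 0" "cball (?\<phi> p) R \<subseteq> ?\<phi> ` fst c"
    and bounds: "\<And>x v. x \<in> fst c \<Longrightarrow> ?\<phi> x \<in> cball (?\<phi> p) R \<Longrightarrow>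
      \<kappa> * norm v \<le> sqrt (g c x v v) \<and> sqrt (g c x v v) \<le> C * norm v"
    by (rule metric_comparison[OF c]) blast
  have "open (?\<phi> ` (fst c \<inter> U1))" "?\<phi> p \<in> ?\<phi> ` (fst c \<inter> U1)"
    using is_chart_facts(7)[OF ch U(1)] c U(3) by auto
  then obtain \<rho>0 where \<rho>0: "\<rho>0 > 0" "ball (?\<phi> p) \<rho>0 \<subseteq> ?\<phi> ` (fst c \<inter> U1)"
    unfolding open_contains_ball by blast
  define \<rho> where "\<rho> = min R \<rho>0"
  have \<rho>: "\<rho> > 0" "\<rho> \<le> R" "\<rho> \<le> \<rho>0" using R \<rho>0 by (auto simp: \<rho>_def)
  have sub: "y \<in> U1" if "y \<in> fst c" "?\<phi> y \<in> ball (?\<phi> p) \<rho>" for y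
  proof -
    have "?\<phi> y \<in> ?\<phi> ` (fst c \<inter> U1)" using that \<rho>(3) \<rho>0(2) by (auto simp: subset_iff)
    then show ?thesis using is_chart_facts(5)[OF ch] that(1) by (auto dest: inj_onD)
  qed
  show ?thesis
  proof (rule that[of "{x \<in> fst c. ?\<phi> x \<in> ball (?\<phi> p) (\<rho> / 2)}" U2 "\<kappa> * (\<rho> / 2)"])
    show "open {x \<in> fst c. ?\<phi> x \<in> ball (?\<phi> p) (\<rho> / 2)}" by (rule is_chart_facts(8)[OF ch]) simp
    fix x y assume x: "x \<in> {x \<in> fst c. ?\<phi> x \<in> ball (?\<phi> p) (\<rho> / 2)}" and y: "y \<in> U2"
    have "\<kappa> * (\<rho> / 2) \<le> \<kappa> * (\<rho> - dist (?\<phi> p) (?\<phi> x))"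
      using x R(2) by (intro mult_left_mono) auto
    then have "ennreal (\<kappa> * (\<rho> / 2)) \<le> ennreal (\<kappa> * (\<rho> - dist (?\<phi> p) (?\<phi> x)))" by (rule ennreal_leI)
    also have "\<dots> \<le> C1_dist A g x y"
    proof (rule C1_dist_ge_in_chart(2)[OF c(1) _ R(2)])
      show "cball (?\<phi> p) \<rho> \<subseteq> ?\<phi> ` fst c" using R(3) \<rho>(2) by auto
      show "\<kappa> * norm v \<le> sqrt (g c x v v)" if "x \<in> fst c" "?\<phi> x \<in> cball (?\<phi> p) \<rho>" for x v
        using bounds[of x v] that \<rho>(2) by auto
      show "\<not> (y \<in> fst c \<and> ?\<phi> y \<in> ball (?\<phi> p) \<rho>)" using sub[of y] y U(5) by blast
    qed (use x \<rho>(1) in auto)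
    finally show "ennreal (\<kappa> * (\<rho> / 2)) \<le> C1_dist A g x y" .
  qed (use U c R \<rho> in auto)
qed

text \<open>The two endpoints of a path form a partition with a single summand.\<close>

lemma C1_dist_le_riemannian_dist: "C1_dist A g x y \<le> riemannian_dist A g x y"
  unfolding riemannian_dist_def inner_dist_def
proof (rule INF_greatest)
  fix \<gamma> assume "\<gamma> \<in> {\<gamma>. rectifiable A g \<gamma> \<and> path_image \<gamma> \<subseteq> UNIV \<and> pathstart \<gamma> = x \<and> pathfinish \<gamma> = y}"
  then have \<gamma>: "\<gamma> 0 = x" "\<gamma> 1 = y" by (auto simp: pathstart_def pathfinish_def)
  define t :: "nat \<Rightarrow> real" where "t i = (if i = 0 then 0 else 1)" for i
  have t: "(1, t) \<in> {(k, t). mono t \<and> range t \<subseteq> {0..1}}" by (auto simp: t_def mono_def)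
  have "C1_dist A g x y = (\<Sum>i<1. C1_dist A g (\<gamma> (t i)) (\<gamma> (t (Suc i))))" using \<gamma> by (simp add: t_def)
  also have "\<dots> \<le> path_length A g \<gamma>"
    unfolding path_length_def by (rule SUP_upper2[OF t]) simp
  finally show "C1_dist A g x y \<le> path_length A g \<gamma>" .
qed

text \<open>Paths with a Lipschitz constant for the distance \<open>C1_dist\<close>: this single condition bounds all
  sums in the definition of the length, and it is stable under concatenation.\<close>

definition C1_joined :: "'m set \<Rightarrow> real \<Rightarrow> 'm \<Rightarrow> 'm \<Rightarrow> bool" where
  "C1_joined S K x y \<longleftrightarrow> K \<ge> 0 \<and> (\<exists>\<gamma>. path \<gamma> \<and> path_image \<gamma> \<subseteq> S \<and> \<gamma> 0 = x \<and> \<gamma> 1 = y \<and>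
     (\<forall>s t. 0 \<le> s \<longrightarrow> s \<le> t \<longrightarrow> t \<le> 1 \<longrightarrow> C1_dist A g (\<gamma> s) (\<gamma> t) \<le> ennreal (K * (t - s))))"

lemma C1_joined_mono: "C1_joined S K x y \<Longrightarrow> K \<le> K' \<Longrightarrow> C1_joined S K' x y"
  unfolding C1_joined_def
proof (elim conjE exE, intro conjI exI allI impI)
  fix \<gamma> s t assume *: "K \<le> K'" "0 \<le> s" "s \<le> t" "t \<le> (1::real)"
    "\<forall>s t. 0 \<le> s \<longrightarrow> s \<le> t \<longrightarrow> t \<le> 1 \<longrightarrow> C1_dist A g (\<gamma> s) (\<gamma> t) \<le> ennreal (K * (t - s))"
  then have "C1_dist A g (\<gamma> s) (\<gamma> t) \<le> ennreal (K * (t - s))" by blast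
  also have "\<dots> \<le> ennreal (K' * (t - s))" using * by (intro ennreal_leI mult_right_mono) auto
  finally show "C1_dist A g (\<gamma> s) (\<gamma> t) \<le> ennreal (K' * (t - s))" .
qed auto

text \<open>Two parameters on different sides of the junction are compared through the junction point.\<close>

lemma C1_joined_trans:
  assumes "C1_joined S K x y" "C1_joined S K y z"
  shows "C1_joined S (2 * K) x z"
proof -
  obtain \<gamma>1 where 1: "path \<gamma>1" "path_image \<gamma>1 \<subseteq> S" "\<gamma>1 0 = x" "\<gamma>1 1 = y"
    and l1: "\<And>s t. 0 \<le> s \<Longrightarrow> s \<le> t \<Longrightarrow> t \<le> 1 \<Longrightarrow> C1_dist A g (\<gamma>1 s) (\<gamma>1 t) \<le> ennreal (K * (t - s))"
    using assms(1) unfolding C1_joined_def by blast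
  obtain \<gamma>2 where 2: "path \<gamma>2" "path_image \<gamma>2 \<subseteq> S" "\<gamma>2 0 = y" "\<gamma>2 1 = z"
    and l2: "\<And>s t. 0 \<le> s \<Longrightarrow> s \<le> t \<Longrightarrow> t \<le> 1 \<Longrightarrow> C1_dist A g (\<gamma>2 s) (\<gamma>2 t) \<le> ennreal (K * (t - s))"
    using assms(2) unfolding C1_joined_def by blast
  have K: "K \<ge> 0" using assms(1) by (simp add: C1_joined_def)
  let ?\<gamma> = "\<gamma>1 +++ \<gamma>2"
  have L: "C1_dist A g (?\<gamma> s) (?\<gamma> t) \<le> ennreal (2 * K * (t - s))" if st: "0 \<le> s" "s \<le> t" "t \<le> 1" for s t
  proof -
    consider "t \<le> 1/2" | "s \<le> 1/2" "t > 1/2" | "s > 1/2" by linarith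
    then show ?thesis
    proof cases
      case 1
      then show ?thesis using l1[of "2 * s" "2 * t"] st by (simp add: joinpaths_def algebra_simps)
    next
      case 2
      have "C1_dist A g (?\<gamma> s) (?\<gamma> t) \<le> C1_dist A g (\<gamma>1 (2 * s)) y + C1_dist A g y (\<gamma>2 (2 * t - 1))"
        using 2 C1_dist_triangle by (simp add: joinpaths_def)
      also have "\<dots> \<le> ennreal (K * (1 - 2 * s)) + ennreal (K * (2 * t - 1))"
        using l1[of "2 * s" 1] l2[of 0 "2 * t - 1"] 2 st \<open>\<gamma>1 1 = y\<close> \<open>\<gamma>2 0 = y\<close> by (intro add_mono) auto
      also have "\<dots> = ennreal (K * (1 - 2 * s) + K * (2 * t - 1))"
        using 2 K by (intro ennreal_plus[symmetric] mult_nonneg_nonneg) auto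
      also have "K * (1 - 2 * s) + K * (2 * t - 1) = 2 * K * (t - s)" by (simp add: algebra_simps)
      finally show ?thesis .
    next
      case 3
      then show ?thesis using l2[of "2 * s - 1" "2 * t - 1"] st by (simp add: joinpaths_def algebra_simps)
    qed
  qed
  have "path ?\<gamma>" using 1 2 by (intro path_join_imp) (auto simp: pathfinish_def pathstart_def)
  moreover have "path_image ?\<gamma> \<subseteq> S" using 1(2) 2(2) path_image_join_subset[of \<gamma>1 \<gamma>2] by blast
  moreover have "?\<gamma> 0 = x" "?\<gamma> 1 = z" using 1 2 by (auto simp: joinpaths_def)
  ultimately show ?thesis using L K unfolding C1_joined_def by (intro conjI exI[of _ ?\<gamma>]) auto
qed

lemma inner_dist_le_joined:
  assumes "C1_joined S K x y"
  shows "inner_dist A g S x y \<le> ennreal K"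
proof -
  obtain \<gamma> where \<gamma>: "path \<gamma>" "path_image \<gamma> \<subseteq> S" "\<gamma> 0 = x" "\<gamma> 1 = y"
    and l: "\<And>s t. 0 \<le> s \<Longrightarrow> s \<le> t \<Longrightarrow> t \<le> 1 \<Longrightarrow> C1_dist A g (\<gamma> s) (\<gamma> t) \<le> ennreal (K * (t - s))"
    using assms unfolding C1_joined_def by blast
  have K: "K \<ge> 0" using assms by (simp add: C1_joined_def)
  have len: "path_length A g \<gamma> \<le> ennreal K" unfolding path_length_def
  proof (rule SUP_least, clarify)
    fix k :: nat and t :: "nat \<Rightarrow> real" assume t: "mono t" "range t \<subseteq> {0..1}"
    have t01: "0 \<le> t i" "t i \<le> 1" "t i \<le> t (Suc i)" for i
      using t by (auto simp: mono_def image_subset_iff)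
    have "(\<Sum>i<k. C1_dist A g (\<gamma> (t i)) (\<gamma> (t (Suc i)))) \<le> (\<Sum>i<k. ennreal (K * (t (Suc i) - t i)))"
      using l t01 by (intro sum_mono) auto
    also have "\<dots> = ennreal (\<Sum>i<k. K * (t (Suc i) - t i))" using K t01 by (intro sum_ennreal) auto
    also have "(\<Sum>i<k. K * (t (Suc i) - t i)) = K * (t k - t 0)"
      by (simp add: sum_lessThan_telescope flip: sum_distrib_left)
    also have "\<dots> \<le> K" using K t01[of k] t01(1)[of 0] by (intro mult_left_le) auto
    finally show "(\<Sum>i<k. C1_dist A g (\<gamma> (t i)) (\<gamma> (t (Suc i)))) \<le> ennreal K" by (simp add: ennreal_leI)
  qed
  then have "rectifiable A g \<gamma>" using \<gamma>(1) by (auto simp: rectifiable_def le_less_trans)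
  then have "inner_dist A g S x y \<le> path_length A g \<gamma>"
    unfolding inner_dist_def using \<gamma> by (intro INF_lower) (auto simp: pathstart_def pathfinish_def)
  with len show ?thesis by simp
qed

text \<open>The Euclidean paths near a conic point are transported to the manifold by the chart. The bound of
  their constants \<open>K\<close> by a multiple of the distance is the local form of the theorem, the uniform bound
  \<open>K \<le> L\<close> serves to connect points that are far apart.\<close>

lemma conic_at_locally_LNE:
  assumes "conic_at A W z" "z \<in> W"
  obtains V L where "open V" "z \<in> V" "L \<ge> 0"
    "\<And>x x'. x \<in> W \<inter> V \<Longrightarrow> x' \<in> W \<inter> V \<Longrightarrow>
       \<exists>K\<le>L. C1_joined W K x x' \<and> ennreal K \<le> ennreal L * C1_dist A g x x'"
proof -
  obtain U \<psi> where u: "(U, \<psi>) \<in> smooth_charts A" "z \<in> U" and con: "conic_point (\<psi> ` (W \<inter> U)) (\<psi> z)"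
    using assms(1) unfolding conic_at_def by blast
  have ch: "is_chart (U, \<psi>)" using u(1) by (simp add: smooth_charts_def)
  note ch_facts = is_chart_facts[OF ch, simplified]
  let ?X = "\<psi> ` (W \<inter> U)" and ?inv = "inv_into U \<psi>"
  obtain V k K where V: "open V" "z \<in> V" "V \<subseteq> U" "k > 0" "K > 0"
    and lower: "\<And>x y. x \<in> V \<Longrightarrow> y \<in> V \<Longrightarrow> ennreal (k * dist (\<psi> x) (\<psi> y)) \<le> C1_dist A g x y"
    and upper: "\<And>x y. x \<in> V \<Longrightarrow> y \<in> V \<Longrightarrow> C1_dist A g x y \<le> ennreal (K * dist (\<psi> x) (\<psi> y))"
    by (rule C1_dist_chart_comparison[OF u]) blast
  have "open (\<psi> ` (U \<inter> V))" "\<psi> z \<in> \<psi> ` (U \<inter> V)" using ch_facts(7)[OF V(1)] V(2) u(2) by auto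
  then obtain \<epsilon> where \<epsilon>: "\<epsilon> > 0" "ball (\<psi> z) \<epsilon> \<subseteq> \<psi> ` (U \<inter> V)" unfolding open_contains_ball by blast
  obtain C where C: "C > 0" "\<And>\<epsilon>. \<epsilon> > 0 \<Longrightarrow> \<exists>s>0. \<forall>x\<in>?X \<inter> ball (\<psi> z) s. \<forall>x'\<in>?X \<inter> ball (\<psi> z) s.
       lipschitz_joined (?X \<inter> ball (\<psi> z) \<epsilon>) (C * dist x x') x x'"
    by (rule conic_point_locally_joined[OF con]) blast
  obtain s where s: "s > 0" "\<And>x x'. x \<in> ?X \<inter> ball (\<psi> z) s \<Longrightarrow> x' \<in> ?X \<inter> ball (\<psi> z) s \<Longrightarrow>
       lipschitz_joined (?X \<inter> ball (\<psi> z) \<epsilon>) (C * dist x x') x x'"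
    using C(2)[OF \<epsilon>(1)] by blast
  have preimage: "?inv w \<in> W \<inter> V \<and> \<psi> (?inv w) = w" if "w \<in> ?X \<inter> ball (\<psi> z) \<epsilon>" for w
  proof -
    have "w \<in> ?X" using that by (rule IntD1)
    then obtain y where y: "w = \<psi> y" "y \<in> W \<inter> U" by (rule imageE)
    have "w \<in> \<psi> ` (U \<inter> V)" using that \<epsilon>(2) by blast
    then obtain y' where y': "w = \<psi> y'" "y' \<in> U \<inter> V" by (rule imageE)
    have "y = y'" using y y' by (intro inj_onD[OF ch_facts(5)]) auto
    then show ?thesis using y y' ch_facts(6)[of y] by simp
  qed
  define L where "L = max (K * C * (2 * s)) (K * C / k)"
  have L: "K * C * (2 * s) \<le> L" "K * C / k \<le> L" "L \<ge> 0"
    using V C s by (auto simp: L_def le_max_iff_disj)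
  show ?thesis
  proof (rule that[of "{x \<in> U. \<psi> x \<in> ball (\<psi> z) s}" L])
    show "open {x \<in> U. \<psi> x \<in> ball (\<psi> z) s}" by (rule ch_facts(8)) simp
    fix x x' assume x: "x \<in> W \<inter> {x \<in> U. \<psi> x \<in> ball (\<psi> z) s}" "x' \<in> W \<inter> {x \<in> U. \<psi> x \<in> ball (\<psi> z) s}"
    have px: "\<psi> x \<in> ?X \<inter> ball (\<psi> z) s" "\<psi> x' \<in> ?X \<inter> ball (\<psi> z) s" using x by auto
    define d where "d = dist (\<psi> x) (\<psi> x')"
    obtain \<gamma> :: "real \<Rightarrow> 'b" where \<gamma>: "(C * d)-lipschitz_on {0..1} \<gamma>"
      "\<gamma> ` {0..1} \<subseteq> ?X \<inter> ball (\<psi> z) \<epsilon>" "\<gamma> 0 = \<psi> x" "\<gamma> 1 = \<psi> x'"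
      using s(2)[OF px] unfolding lipschitz_joined_def d_def by blast
    let ?\<eta> = "?inv \<circ> \<gamma>"
    have \<eta>: "?\<eta> t \<in> W \<inter> V \<and> \<psi> (?\<eta> t) = \<gamma> t" if "t \<in> {0..1}" for t
      unfolding o_def by (rule preimage[OF subsetD[OF \<gamma>(2) imageI[OF that]]])
    have ends: "?\<eta> 0 = x" "?\<eta> 1 = x'" using \<gamma>(3,4) ch_facts(6) x by auto
    have xV: "x \<in> V" "x' \<in> V" using \<eta>[of 0] \<eta>[of 1] ends by auto
    have "continuous_on {0..1} ?\<eta>"
    proof (rule continuous_on_compose)
      show "continuous_on {0..1} \<gamma>" using \<gamma>(1) by (rule lipschitz_on_continuous_on)
      show "continuous_on (\<gamma> ` {0..1}) ?inv" using \<gamma>(2) by (intro continuous_on_subset[OF ch_facts(4)]) auto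
    qed
    then have path: "path ?\<eta>" by (simp add: path_def)
    have d: "0 \<le> d" "d \<le> 2 * s"
      using px dist_triangle3[of "\<psi> x" "\<psi> x'" "\<psi> z"] by (auto simp: d_def)
    have speed: "C1_dist A g (?\<eta> r) (?\<eta> t) \<le> ennreal (K * C * d * (t - r))" if rt: "0 \<le> r" "r \<le> t" "t \<le> 1" for r t
    proof -
      have "C1_dist A g (?\<eta> r) (?\<eta> t) \<le> ennreal (K * dist (\<psi> (?\<eta> r)) (\<psi> (?\<eta> t)))"
        using \<eta>[of r] \<eta>[of t] rt by (intro upper) auto
      also have "\<dots> = ennreal (K * dist (\<gamma> r) (\<gamma> t))" using \<eta>[of r] \<eta>[of t] rt by simp
      also have "\<dots> \<le> ennreal (K * (C * d * dist r t))"
        using lipschitz_onD[OF \<gamma>(1), of r t] rt V(5) by (intro ennreal_leI mult_left_mono) auto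
      also have "K * (C * d * dist r t) = K * C * d * (t - r)" using rt by (simp add: dist_real_def)
      finally show ?thesis .
    qed
    have joined: "C1_joined W (K * C * d) x x'" unfolding C1_joined_def
      using path \<eta> ends speed V(5) C(1) d by (intro conjI exI[of _ ?\<eta>]) (auto simp: path_image_def)
    have "K * C * d \<le> K * C * (2 * s)" using d V C by (intro mult_left_mono) auto
    then have le: "K * C * d \<le> L" using L by simp
    have "ennreal (K * C * d) = ennreal (K * C / k) * ennreal (k * dist (\<psi> x) (\<psi> x'))"
      using V C by (simp add: d_def flip: ennreal_mult)
    also have "\<dots> \<le> ennreal L * C1_dist A g x x'"
      by (intro mult_mono ennreal_leI L(2) lower xV) auto
    finally show "\<exists>K\<le>L. C1_joined W K x x' \<and> ennreal K \<le> ennreal L * C1_dist A g x x'"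
      using joined le by blast
  qed (use u s L in auto)
qed

end

theorem theorem4p2:
  fixes A :: "('m::{t2_space, second_countable_topology}, 'b::euclidean_space) chart set"
    and g :: "('m, 'b) chart \<Rightarrow> 'm \<Rightarrow> 'b \<Rightarrow> 'b \<Rightarrow> real"
    and W :: "'m set"
  assumes "smooth_atlas A"
    and "riemannian_metric A g"
    and "conic_singular_submanifold A W"
    and "connected W"
    and "compact W"
  shows "lipschitz_normally_embedded A g W"
proof -
  interpret riemannian_manifold A g using assms(1,2) by unfold_locales
  have conic: "conic_at A W z" if "z \<in> W" for z
    using assms(3) that by (simp add: conic_singular_submanifold_def)
  have "\<exists>V L. open V \<and> z \<in> V \<and> L \<ge> 0 \<and> (\<forall>x\<in>W \<inter> V. \<forall>x'\<in>W \<inter> V.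
      \<exists>K\<le>L. C1_joined W K x x' \<and> ennreal K \<le> ennreal L * C1_dist A g x x')" if "z \<in> W" for z
    by (rule conic_at_locally_LNE[OF conic[OF that] that]) blast
  then obtain V L where V: "\<And>z. z \<in> W \<Longrightarrow> open (V z)" "\<And>z. z \<in> W \<Longrightarrow> z \<in> V z" "\<And>z. z \<in> W \<Longrightarrow> L z \<ge> 0"
    and loc: "\<And>z x x'. z \<in> W \<Longrightarrow> x \<in> W \<inter> V z \<Longrightarrow> x' \<in> W \<inter> V z \<Longrightarrow>
      \<exists>K\<le>L z. C1_joined W K x x' \<and> ennreal K \<le> ennreal (L z) * C1_dist A g x x'"
    by metis
  have near: "C1_joined W (L z) x x'" if "z \<in> W" "x \<in> W \<inter> V z" "x' \<in> W \<inter> V z" for z x x'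
    using loc[OF that] C1_joined_mono by blast
  \<comment> \<open>Being joined is a transitive relation that holds locally, and \<open>W\<close> is connected.\<close>
  have all: "\<exists>K. C1_joined W K p q" if pq: "p \<in> W" "q \<in> W" for p q
  proof (rule connected_equivalence_relation_gen[OF assms(4) pq, where P = "\<lambda>_. True"])
    fix x y z assume "\<exists>K. C1_joined W K x y" "\<exists>K. C1_joined W K y z"
    then obtain K K' where "C1_joined W K x y" "C1_joined W K' y z" by blast
    then have "C1_joined W (max K K') x y" "C1_joined W (max K K') y z"
      by (auto elim: C1_joined_mono)
    then show "\<exists>K. C1_joined W K x z" using C1_joined_trans by blast
  next
    fix a assume a: "a \<in> W"
    show "\<exists>T. openin (top_of_set W) T \<and> a \<in> T \<and> (\<forall>x\<in>T. \<forall>y\<in>T. True \<and> True \<longrightarrow> (\<exists>K. C1_joined W K x y))"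
      using near[OF a] V(1,2)[OF a] a by (intro exI[of _ "W \<inter> V a"]) (auto simp: openin_open_Int)
  qed auto
  have "\<exists>C. \<forall>xy\<in>W \<times> W. inner_dist A g W (fst xy) (snd xy) \<le> ennreal C * riemannian_dist A g (fst xy) (snd xy)"
  proof (rule compact_uniform_constant[OF compact_Times[OF assms(5,5)]])
    show "inner_dist A g W (fst xy) (snd xy) \<le> ennreal C' * riemannian_dist A g (fst xy) (snd xy)"
      if "inner_dist A g W (fst xy) (snd xy) \<le> ennreal C * riemannian_dist A g (fst xy) (snd xy)" "C \<le> C'" for C C' xy
      using that by (meson ennreal_leI mult_right_mono order_trans zero_le)
    fix pq assume "pq \<in> W \<times> W"
    then obtain p q where pq: "pq = (p, q)" "p \<in> W" "q \<in> W" by blast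
    show "\<exists>C U. open U \<and> pq \<in> U \<and> (\<forall>xy\<in>W \<times> W \<inter> U.
        inner_dist A g W (fst xy) (snd xy) \<le> ennreal C * riemannian_dist A g (fst xy) (snd xy))"
    proof (cases "p = q")
      case True
      have "inner_dist A g W x y \<le> ennreal (L p) * riemannian_dist A g x y"
        if xy: "x \<in> W \<inter> V p" "y \<in> W \<inter> V p" for x y
      proof -
        obtain K where K: "C1_joined W K x y" "ennreal K \<le> ennreal (L p) * C1_dist A g x y"
          using loc[OF pq(2) xy] by blast
        have "inner_dist A g W x y \<le> ennreal K" by (rule inner_dist_le_joined[OF K(1)])
        also note K(2)
        also have "ennreal (L p) * C1_dist A g x y \<le> ennreal (L p) * riemannian_dist A g x y"
          by (intro mult_left_mono C1_dist_le_riemannian_dist) simp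
        finally show ?thesis .
      qed
      then show ?thesis using V(1,2)[OF pq(2)] True pq
        by (intro exI[of _ "L p"] exI[of _ "V p \<times> V p"]) (auto simp: open_Times)
    next
      case False
      obtain V1 V2 \<mu> where \<mu>: "open V1" "open V2" "p \<in> V1" "q \<in> V2" "\<mu> > 0"
        "\<And>x y. x \<in> V1 \<Longrightarrow> y \<in> V2 \<Longrightarrow> ennreal \<mu> \<le> C1_dist A g x y"
        by (rule C1_dist_separates[OF False]) blast
      obtain K where K: "C1_joined W K p q" using all pq by blast
      \<comment> \<open>Points \<open>x\<close> near \<open>p\<close> and \<open>y\<close> near \<open>q\<close> are joined through \<open>p\<close> and \<open>q\<close>, with a constant
        independent of \<open>x\<close> and \<open>y\<close>.\<close>
      define M where "M = max K (max (L p) (L q))"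
      have M: "M \<ge> 0" using V(3)[OF pq(2)] by (auto simp: M_def le_max_iff_disj)
      have "inner_dist A g W x y \<le> ennreal (2 * (2 * M) / \<mu>) * riemannian_dist A g x y"
        if xy: "x \<in> W \<inter> (V1 \<inter> V p)" "y \<in> W \<inter> (V2 \<inter> V q)" for x y
      proof -
        have "C1_joined W M x p" "C1_joined W M p q" "C1_joined W M q y"
          using near[OF pq(2), of x p] near[OF pq(3), of q y] K V(2) pq xy
          by (auto simp: M_def elim!: C1_joined_mono)
        then have "C1_joined W (2 * (2 * M)) x y"
          using C1_joined_trans[of W M x p q] C1_joined_mono[of W M q y "2 * M"] M
          by (intro C1_joined_trans[of W "2 * M" x q y]) auto
        then have "inner_dist A g W x y \<le> ennreal (2 * (2 * M))" by (rule inner_dist_le_joined)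
        also have "\<dots> = ennreal (2 * (2 * M) / \<mu>) * ennreal \<mu>"
          using M \<mu>(5) by (simp flip: ennreal_mult)
        also have "\<dots> \<le> ennreal (2 * (2 * M) / \<mu>) * riemannian_dist A g x y"
          using \<mu>(6)[of x y] xy C1_dist_le_riemannian_dist[of x y] by (intro mult_left_mono) auto
        finally show ?thesis .
      qed
      then show ?thesis using V(1,2) pq \<mu>
        by (intro exI[of _ "2 * (2 * M) / \<mu>"] exI[of _ "(V1 \<inter> V p) \<times> (V2 \<inter> V q)"]) (auto simp: open_Times open_Int)
    qed
  qed
  then obtain C where C: "\<And>x y. x \<in> W \<Longrightarrow> y \<in> W \<Longrightarrow> inner_dist A g W x y \<le> ennreal C * riemannian_dist A g x y"
    by force
  show ?thesis unfolding lipschitz_normally_embedded_def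
  proof (intro exI[of _ "max C 1"] conjI ballI)
    fix x y assume "x \<in> W" "y \<in> W"
    then have "inner_dist A g W x y \<le> ennreal C * riemannian_dist A g x y" by (rule C)
    also have "\<dots> \<le> ennreal (max C 1) * riemannian_dist A g x y" by (intro mult_right_mono ennreal_leI) auto
    finally show "inner_dist A g W x y \<le> ennreal (max C 1) * riemannian_dist A g x y" .
  qed simp
qed

end
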